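(* Let $\{\phi_s\}_{s\in\mathbb R}$ be a minimal $W^{\rm u}$ flow of a codimension one $C^{1+\varepsilon}$ Anosov flow $\{f_t\}_{t\in\mathbb R}$ on a compact connected Riemannian manifold $M$, with unique invariant Borel probability measure $\mu$, uniformly expanding parametrisation $\{\widetilde\phi_s\}_{s\in\mathbb R}$ and associated function $s^*$. Suppose that (1) the flow $\{\phi_s\}_{s\in\mathbb R}$ is of class $C^1$ and $\{\widetilde\phi_s\}_{s\in\mathbb R}$ is a $C^1$ reparametrisation of $\{\phi_s\}_{s\in\mathbb R}$; (2) the derivative $u_{t,s}(x):=(\partial_1\partial_2 s^* )(t,s,x)$ exists and is continuous in $s,t\in\mathbb R$ and $x\in M$. Let $\mathcal H=L^2(M,\mu)$, let $U^\phi_s\varphi=\varphi\circ\phi_s$, and let $H_\phi$ be the self-adjoint generator of $\{U^\phi_s\}_{s\in\mathbb R}$. Then $$\lim_{s\to\infty}\big\langle\psi,U^\phi_s\varphi\big\rangle=0\quad\text{for all }\psi\in\mathcal H\text{ and }\varphi\in\ker(H_\phi)^\perp.$$ In particular, the flow $\{\phi_s\}_{s\in\mathbb R}$ is strongly mixing with respect to the measure $\mu$.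
   Context: Setting. $M$ is a compact connected Riemannian manifold with distance $d$. $\{f_t\}_{t\in\mathbb R}$ is a $C^{1+\varepsilon}$ Anosov flow on $M$ ($\varepsilon>0$): $(t,x)\mapsto f_t(x)$ is of class $C^{1+\varepsilon}$, there are no fixed points, and through each $x\in M$ pass three submanifolds $W^{\rm u}(x)=\{y\mid\lim_{t\to-\infty}d(f_t(x),f_t(y))=0\}$, $W^{\rm s}(x)=\{y\mid\lim_{t\to+\infty}d(f_t(x),f_t(y))=0\}$ and $\mathrm{Orb}(x)=\{f_t(x)\mid t\in\mathbb R\}$, whose tangent spaces $E^{\rm u}_x,E^{\rm s}_x,E_x$ vary continuously with $x$ and satisfy $T_xM=E^{\rm u}_x\oplus E^{\rm s}_x\oplus E_x$. The flow is codimension one, meaning here that $\{W^{\rm u}(x)\}_{x\in M}$ is a one-dimensional orientable continuous foliation of $M$, and this foliation defines a continuous minimal flow $\{\phi_s\}_{s\in\mathbb R}$ on $M$ whose orbits are the unstable manifolds $W^{\rm u}(x)$; such a flow is called a minimal $W^{\rm u}$ flow. It is known to be uniquely ergodic, with unique invariant Borel probability measure $\mu$. Since $f_t(W^{\rm u}(x))=W^{\rm u}(f_t(x))$, there is a function $s^*:\mathbb R\times\mathbb R\times M\to\mathbb R$ with $$(f_t\circ\phi_s)(x)=(\phi_{s^*(t,s,x)}\circ f_t)(x)\quad\text{for all }s,t\in\mathbb R,\ x\in M.$$ It is known that the foliation $\{W^{\rm u}(x)\}_{x\in M}$ admits a uniformly expanding parametrisation: a continuous flow $\{\widetilde\phi_s\}_{s\in\mathbb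 R}$, which is a continuous reparametrisation of $\{\phi_s\}$, such that $f_t\circ\widetilde\phi_s=\widetilde\phi_{\lambda^ts}\circ f_t$ for some constant $\lambda>1$ and all $s,t\in\mathbb R$. The flow $\{\widetilde\phi_s\}$ is uniquely ergodic with unique invariant probability measure $\widetilde\mu$, and $\widetilde\mu$ is invariant under $\{f_t\}$. $C^1$ reparametrisation. That $\{\widetilde\phi_s\}$ is a $C^1$ reparametrisation of $\{\phi_s\}$ means that there is $\tau\in C^1(M\times\mathbb R;\mathbb R)$ with $\phi_s(x)=\widetilde\phi_{\tau(x,s)}(x)$, $\tau(x,0)=0$, $\tau(x,\cdot)$ strictly increasing, $\tau(x,s+t)=\tau(x,s)+\tau(\phi_s(x),t)$ for all $s,t\in\mathbb R$, $x\in M$, and in particular $(\partial_2\tau)(x,0)>0$ for all $x\in M$. Under hypothesis (1), $\{\phi_s\}$ has a continuous vector field $X_\phi$; the function $\rho(x):=1/(\partial_2\tau)(x,0)$ belongs to $C(M;(0,\infty))$; $\{\widetilde\phi_s\}$ has vector field $\rho X_\phi$; and $\widetilde\mu=\mu/\widetilde\rho$ with $\widetilde\rho:=\rho\int_M\rho^{-1}\,d\mu$. Operators. The scalar product of $\mathcal H=L^2(M,\mu)$ is antilinear in the first argument. The operators $U^\phi_s\varphi=\varphi\circ\phi_s$ form a strongly continuous unitary group with self-adjoint generator $H_\phi\varphi=\lim_{s\to0}is^{-1}(U^\phi_s-1)\varphi$ (so $U^\phi_s=e^{-isH_\phi}$), which is essentially self-adjoint on $C^1(M)$ with $H_\phi\varphi=iX_\phi\varphi$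 for $\varphi\in C^1(M)$. *)

theory Defs
  imports "HOL-Probability.Probability"
begin

section \<open>Differentiability classes in Euclidean space\<close>

text \<open>The set \<open>S\<close> is meant to be open in the next two definitions.\<close>

primrec Ck_on :: "nat \<Rightarrow> ('a::euclidean_space \<Rightarrow> 'b::real_normed_vector) \<Rightarrow> 'a set \<Rightarrow> bool" where
  "Ck_on 0 F S \<longleftrightarrow> continuous_on S F"
| "Ck_on (Suc k) F S \<longleftrightarrow>
     (\<forall>x\<in>S. F differentiable (at x)) \<and>
     (\<forall>v. Ck_on k (\<lambda>x. frechet_derivative F (at x) v) S)"

definition smooth_on :: "('a::euclidean_space \<Rightarrow> 'b::real_normed_vector) \<Rightarrow> 'a set \<Rightarrow> bool" where
  "smooth_on F S \<longleftrightarrow> (\<forall>k. Ck_on k F S)"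

definition locally_Hoelder_on ::
    "real \<Rightarrow> ('a::metric_space \<Rightarrow> 'b::metric_space) \<Rightarrow> 'a set \<Rightarrow> bool" where
  "locally_Hoelder_on \<alpha> F S \<longleftrightarrow>
     (\<forall>x\<in>S. \<exists>r>0. \<exists>C. \<forall>y\<in>S \<inter> ball x r. \<forall>z\<in>S \<inter> ball x r.
        dist (F y) (F z) \<le> C * dist y z powr \<alpha>)"

primrec Ck_Hoelder_on ::
    "nat \<Rightarrow> real \<Rightarrow> ('a::euclidean_space \<Rightarrow> 'b::real_normed_vector) \<Rightarrow> 'a set \<Rightarrow> bool" where
  "Ck_Hoelder_on 0 \<alpha> F S \<longleftrightarrow> locally_Hoelder_on \<alpha> F S"
| "Ck_Hoelder_on (Suc k) \<alpha> F S \<longleftrightarrow>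
     (\<forall>x\<in>S. F differentiable (at x)) \<and>
     (\<forall>v. Ck_Hoelder_on k \<alpha> (\<lambda>x. frechet_derivative F (at x) v) S)"

text \<open>Class \<open>C\<close> to the power \<open>1 + \<epsilon>\<close>, for every real \<open>\<epsilon> > 0\<close>: write \<open>1 + \<epsilon> = k + \<alpha>\<close> with
  \<open>k = \<lceil>\<epsilon>\<rceil>\<close> and \<open>0 < \<alpha> \<le> 1\<close>. For \<open>0 < \<epsilon> \<le> 1\<close> this says that the first derivative is locally
  \<open>\<epsilon>\<close>-Hoelder.\<close>

definition C1_plus_on ::
    "real \<Rightarrow> ('a::euclidean_space \<Rightarrow> 'b::real_normed_vector) \<Rightarrow> 'a set \<Rightarrow> bool" where
  "C1_plus_on \<epsilon> F S \<longleftrightarrow> Ck_Hoelder_on (nat \<lceil>\<epsilon>\<rceil>) (1 + \<epsilon> - real_of_int \<lceil>\<epsilon>\<rceil>) F S"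


section \<open>Riemannian manifolds\<close>

text \<open>The manifold is a whole type \<open>'m\<close> of class \<open>metric_space\<close>, modelled on \<open>'e\<close>. A chart is a
  pair \<open>(U, \<kappa>)\<close>; the values of \<open>\<kappa>\<close> outside \<open>U\<close> are irrelevant. Tangent vectors and tangent
  spaces at a point are given by their coordinates with respect to each chart around it.\<close>

type_synonym ('m, 'e) chart = "'m set \<times> ('m \<Rightarrow> 'e)"

definition chart_inv :: "('m, 'e) chart \<Rightarrow> 'e \<Rightarrow> 'm" where
  "chart_inv c = inv_into (fst c) (snd c)"

definition smooth_atlas :: "('m::topological_space, 'e::euclidean_space) chart set \<Rightarrow> bool" where
  "smooth_atlas A \<longleftrightarrow>
     (\<Union>c\<in>A. fst c) = UNIV \<and>
     (\<forall>c\<in>A. open (fst c) \<and> open (snd c ` fst c) \<and>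
        homeomorphism (fst c) (snd c ` fst c) (snd c) (chart_inv c)) \<and>
     (\<forall>c\<in>A. \<forall>c'\<in>A. smooth_on (snd c' \<circ> chart_inv c) (snd c ` (fst c \<inter> fst c')))"

definition coord_change ::
    "('m, 'e::euclidean_space) chart \<Rightarrow> ('m, 'e) chart \<Rightarrow> 'm \<Rightarrow> 'e \<Rightarrow> 'e" where
  "coord_change c c' x = frechet_derivative (snd c' \<circ> chart_inv c) (at (snd c x))"

text \<open>\<open>g c x v w\<close> is the scalar product of the tangent vectors at \<open>x\<close> whose coordinates in the
  chart \<open>c\<close> are \<open>v\<close> and \<open>w\<close>.\<close>

definition riemannian_metric ::
    "('m::topological_space, 'e::euclidean_space) chart set \<Rightarrow>
     (('m, 'e) chart \<Rightarrow> 'm \<Rightarrow> 'e \<Rightarrow> 'e \<Rightarrow> real) \<Rightarrow> bool" where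
  "riemannian_metric A g \<longleftrightarrow>
     (\<forall>c\<in>A. \<forall>x\<in>fst c. bilinear (g c x) \<and> (\<forall>v w. g c x v w = g c x w v) \<and>
        (\<forall>v. v \<noteq> 0 \<longrightarrow> g c x v v > 0)) \<and>
     (\<forall>c\<in>A. \<forall>v w. smooth_on (\<lambda>z. g c (chart_inv c z) v w) (snd c ` fst c)) \<and>
     (\<forall>c\<in>A. \<forall>c'\<in>A. \<forall>x\<in>fst c \<inter> fst c'. \<forall>v w.
        g c x v w = g c' x (coord_change c c' x v) (coord_change c c' x w))"

definition C1_curve_on ::
    "('m::topological_space, 'e::euclidean_space) chart set \<Rightarrow> real set \<Rightarrow> (real \<Rightarrow> 'm) \<Rightarrow> bool" where
  "C1_curve_on A I \<gamma> \<longleftrightarrow>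
     continuous_on I \<gamma> \<and>
     (\<forall>c\<in>A. (\<forall>t\<in>I. \<gamma> t \<in> fst c \<longrightarrow> (snd c \<circ> \<gamma>) differentiable (at t within I)) \<and>
        continuous_on {t\<in>I. \<gamma> t \<in> fst c} (\<lambda>t. vector_derivative (snd c \<circ> \<gamma>) (at t within I)))"

definition piecewise_C1_curve ::
    "('m::topological_space, 'e::euclidean_space) chart set \<Rightarrow> (real \<Rightarrow> 'm) \<Rightarrow> bool" where
  "piecewise_C1_curve A \<gamma> \<longleftrightarrow>
     (\<exists>K. finite K \<and>
        (\<forall>a b. 0 \<le> a \<and> a < b \<and> b \<le> 1 \<and> {a<..<b} \<inter> K = {} \<longrightarrow> C1_curve_on A {a..b} \<gamma>))"

text \<open>The speed does not depend on the chosen chart. It may be meaningless at the finitely many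
  corners and at the end points, which does not affect the length.\<close>

definition curve_speed ::
    "('m::topological_space, 'e::euclidean_space) chart set \<Rightarrow>
     (('m, 'e) chart \<Rightarrow> 'm \<Rightarrow> 'e \<Rightarrow> 'e \<Rightarrow> real) \<Rightarrow> (real \<Rightarrow> 'm) \<Rightarrow> real \<Rightarrow> real" where
  "curve_speed A g \<gamma> t =
     (let c = (SOME c. c \<in> A \<and> \<gamma> t \<in> fst c); v = vector_derivative (snd c \<circ> \<gamma>) (at t)
      in sqrt (g c (\<gamma> t) v v))"

definition riemannian_distance ::
    "('m::topological_space, 'e::euclidean_space) chart set \<Rightarrow>
     (('m, 'e) chart \<Rightarrow> 'm \<Rightarrow> 'e \<Rightarrow> 'e \<Rightarrow> real) \<Rightarrow> 'm \<Rightarrow> 'm \<Rightarrow> real" where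
  "riemannian_distance A g x y =
     Inf {integral {0..1} (curve_speed A g \<gamma>) | \<gamma>.
            piecewise_C1_curve A \<gamma> \<and> \<gamma> 0 = x \<and> \<gamma> 1 = y}"

definition compact_connected_riemannian_manifold ::
    "('m::metric_space, 'e::euclidean_space) chart set \<Rightarrow>
     (('m, 'e) chart \<Rightarrow> 'm \<Rightarrow> 'e \<Rightarrow> 'e \<Rightarrow> real) \<Rightarrow> bool" where
  "compact_connected_riemannian_manifold A g \<longleftrightarrow>
     compact (UNIV :: 'm set) \<and> connected (UNIV :: 'm set) \<and>
     smooth_atlas A \<and> riemannian_metric A g \<and>
     (\<forall>x y. dist x y = riemannian_distance A g x y)"


section \<open>Injectively immersed submanifolds and their tangent spaces\<close>

text \<open>\<open>V\<close> is an open subset of the vector space \<open>L\<close>, \<open>p\<close> is an injective \<open>C\<^sup>1\<close> immersion of \<open>V\<close>, and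
  \<open>E c (p z)\<close> is the image of its differential at \<open>z\<close> in the coordinates of \<open>c\<close>.\<close>

definition C1_injective_immersion ::
    "('m::topological_space, 'e::euclidean_space) chart set \<Rightarrow> 'e set \<Rightarrow> 'e set \<Rightarrow> ('e \<Rightarrow> 'm) \<Rightarrow>
     (('m, 'e) chart \<Rightarrow> 'm \<Rightarrow> 'e set) \<Rightarrow> bool" where
  "C1_injective_immersion A L V p E \<longleftrightarrow>
     openin (top_of_set L) V \<and> continuous_on V p \<and> inj_on p V \<and>
     (\<forall>c\<in>A. \<exists>D.
        (\<forall>z\<in>V. p z \<in> fst c \<longrightarrow>
           ((snd c \<circ> p) has_derivative D z) (at z within L) \<and>
           inj_on (D z) L \<and> D z ` L = E c (p z)) \<and>
        (\<forall>v\<in>L. continuous_on {z\<in>V. p z \<in> fst c} (\<lambda>z. D z v)))"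

text \<open>\<open>W\<close> is an injectively immersed (not necessarily embedded) \<open>C\<^sup>1\<close> submanifold of dimension
  \<open>dim L\<close>, whose tangent space at \<open>y \<in> W\<close> is \<open>E c y\<close> in the coordinates of \<open>c\<close>. The last clause says
  that the local parametrisations in \<open>P\<close> have open overlaps and continuous transition maps
  (which are then \<open>C\<^sup>1\<close>).\<close>

definition immersed_C1_submanifold ::
    "('m::topological_space, 'e::euclidean_space) chart set \<Rightarrow> 'm set \<Rightarrow>
     (('m, 'e) chart \<Rightarrow> 'm \<Rightarrow> 'e set) \<Rightarrow> bool" where
  "immersed_C1_submanifold A W E \<longleftrightarrow>
     (\<exists>L P. subspace L \<and> countable P \<and>
        (\<forall>(V, p)\<in>P. C1_injective_immersion A L V p E) \<and>
        W = (\<Union>(V, p)\<in>P. p ` V) \<and>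
        (\<forall>(V, p)\<in>P. \<forall>(V', q)\<in>P.
           openin (top_of_set L) (V \<inter> p -` (q ` V')) \<and>
           continuous_on (V \<inter> p -` (q ` V')) (inv_into V' q \<circ> p)))"

text \<open>Continuity with respect to the topology of the Grassmannian: in each chart the orthogonal
  projection (here \<open>closest_point\<close>) onto the subspace depends continuously on the base point.\<close>

definition continuous_subspace_field ::
    "('m::topological_space, 'e::euclidean_space) chart set \<Rightarrow>
     (('m, 'e) chart \<Rightarrow> 'm \<Rightarrow> 'e set) \<Rightarrow> bool" where
  "continuous_subspace_field A E \<longleftrightarrow>
     (\<forall>c\<in>A. (\<forall>x\<in>fst c. subspace (E c x)) \<and>
        (\<forall>v. continuous_on (fst c) (\<lambda>x. closest_point (E c x) v)))"


section \<open>Flows\<close>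

definition continuous_flow :: "(real \<Rightarrow> 'm::topological_space \<Rightarrow> 'm) \<Rightarrow> bool" where
  "continuous_flow F \<longleftrightarrow>
     continuous_on UNIV (\<lambda>(t, x). F t x) \<and>
     (\<forall>x. F 0 x = x) \<and> (\<forall>s t x. F (s + t) x = F s (F t x))"

text \<open>The map \<open>(t, x) \<mapsto> F t x\<close> has the differentiability class \<open>R\<close> in all charts.\<close>

definition flow_of_class ::
    "((real \<times> 'e \<Rightarrow> 'e) \<Rightarrow> (real \<times> 'e) set \<Rightarrow> bool) \<Rightarrow>
     ('m::topological_space, 'e::euclidean_space) chart set \<Rightarrow> (real \<Rightarrow> 'm \<Rightarrow> 'm) \<Rightarrow> bool" where
  "flow_of_class R A F \<longleftrightarrow>
     continuous_flow F \<and>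
     (\<forall>c\<in>A. \<forall>c'\<in>A.
        R (\<lambda>(t, z). snd c' (F t (chart_inv c z)))
          {(t, z). z \<in> snd c ` fst c \<and> F t (chart_inv c z) \<in> fst c'})"

abbreviation C1_flow ::
    "('m::topological_space, 'e::euclidean_space) chart set \<Rightarrow> (real \<Rightarrow> 'm \<Rightarrow> 'm) \<Rightarrow> bool" where
  "C1_flow \<equiv> flow_of_class (Ck_on 1)"

definition orbit :: "(real \<Rightarrow> 'm \<Rightarrow> 'm) \<Rightarrow> 'm \<Rightarrow> 'm set" where
  "orbit F x = range (\<lambda>t. F t x)"

definition minimal_flow :: "(real \<Rightarrow> 'm::topological_space \<Rightarrow> 'm) \<Rightarrow> bool" where
  "minimal_flow F \<longleftrightarrow> (\<forall>x. closure (orbit F x) = UNIV)"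

definition Wu :: "(real \<Rightarrow> 'm::metric_space \<Rightarrow> 'm) \<Rightarrow> 'm \<Rightarrow> 'm set" where
  "Wu f x = {y. ((\<lambda>t. dist (f t x) (f t y)) \<longlongrightarrow> 0) at_bot}"

definition Ws :: "(real \<Rightarrow> 'm::metric_space \<Rightarrow> 'm) \<Rightarrow> 'm \<Rightarrow> 'm set" where
  "Ws f x = {y. ((\<lambda>t. dist (f t x) (f t y)) \<longlongrightarrow> 0) at_top}"

definition anosov_flow ::
    "('m::metric_space, 'e::euclidean_space) chart set \<Rightarrow> real \<Rightarrow> (real \<Rightarrow> 'm \<Rightarrow> 'm) \<Rightarrow> bool" where
  "anosov_flow A \<epsilon> f \<longleftrightarrow>
     flow_of_class (C1_plus_on \<epsilon>) A f \<and>
     \<not> (\<exists>x. \<forall>t. f t x = x) \<and>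
     (\<exists>Eu Es E0.
        (\<forall>x. immersed_C1_submanifold A (Wu f x) Eu) \<and>
        (\<forall>x. immersed_C1_submanifold A (Ws f x) Es) \<and>
        (\<forall>x. immersed_C1_submanifold A (orbit f x) E0) \<and>
        continuous_subspace_field A Eu \<and> continuous_subspace_field A Es \<and>
        continuous_subspace_field A E0 \<and>
        (\<forall>c\<in>A. \<forall>x\<in>fst c. \<forall>v. \<exists>!(a, b, d).
           a \<in> Eu c x \<and> b \<in> Es c x \<and> d \<in> E0 c x \<and> v = a + b + d))"


section \<open>One-dimensional continuous foliations\<close>

text \<open>A foliated chart maps \<open>U\<close> homeomorphically onto the open unit cube, such that the connected
  components of the intersections of \<open>U\<close> with the leaves (the plaques) correspond to the line
  segments parallel to the basis vector \<open>b\<close>.\<close>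

definition same_plaque :: "'e::euclidean_space \<Rightarrow> 'e \<Rightarrow> 'e \<Rightarrow> bool" where
  "same_plaque b z w \<longleftrightarrow> (\<forall>i\<in>Basis - {b}. z \<bullet> i = w \<bullet> i)"

definition foliated_chart ::
    "'m set set \<Rightarrow> 'e \<Rightarrow> ('m::topological_space, 'e::euclidean_space) chart \<Rightarrow> bool" where
  "foliated_chart \<F> b c \<longleftrightarrow>
     open (fst c) \<and> snd c ` fst c = box 0 One \<and>
     homeomorphism (fst c) (box 0 One) (snd c) (chart_inv c) \<and>
     (\<forall>l\<in>\<F>. \<forall>C\<in>components (fst c \<inter> l). \<exists>w\<in>box 0 One.
        snd c ` C = {z \<in> box 0 One. same_plaque b z w})"

text \<open>The last clause says that the changes between the foliated charts in \<open>\<C>\<close> preserve the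
  orientation of the plaques.\<close>

definition orientable_continuous_foliation_1 ::
    "'e::euclidean_space itself \<Rightarrow> 'm::topological_space set set \<Rightarrow> bool" where
  "orientable_continuous_foliation_1 _ \<F> \<longleftrightarrow>
     \<Union>\<F> = UNIV \<and> pairwise disjnt \<F> \<and> (\<forall>l\<in>\<F>. l \<noteq> {} \<and> connected l) \<and>
     (\<exists>b\<in>(Basis :: 'e set). \<exists>\<C> :: ('m, 'e) chart set.
        (\<forall>c\<in>\<C>. foliated_chart \<F> b c) \<and> (\<Union>c\<in>\<C>. fst c) = UNIV \<and>
        (\<forall>c\<in>\<C>. \<forall>c'\<in>\<C>. \<forall>x\<in>fst c \<inter> fst c'.
           \<exists>N. open N \<and> x \<in> N \<and> N \<subseteq> fst c \<inter> fst c' \<and>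
             (\<forall>y\<in>N. same_plaque b (snd c x) (snd c y) \<longrightarrow>
                (snd c x \<bullet> b < snd c y \<bullet> b \<longleftrightarrow> snd c' x \<bullet> b < snd c' y \<bullet> b))))"

definition codimension_one_anosov_flow ::
    "('m::metric_space, 'e::euclidean_space) chart set \<Rightarrow> real \<Rightarrow> (real \<Rightarrow> 'm \<Rightarrow> 'm) \<Rightarrow> bool" where
  "codimension_one_anosov_flow A \<epsilon> f \<longleftrightarrow>
     anosov_flow A \<epsilon> f \<and> orientable_continuous_foliation_1 TYPE('e) (range (Wu f))"

definition minimal_Wu_flow ::
    "(real \<Rightarrow> 'm::metric_space \<Rightarrow> 'm) \<Rightarrow> (real \<Rightarrow> 'm \<Rightarrow> 'm) \<Rightarrow> bool" where
  "minimal_Wu_flow f \<phi> \<longleftrightarrow>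
     continuous_flow \<phi> \<and> minimal_flow \<phi> \<and> (\<forall>x. orbit \<phi> x = Wu f x)"


section \<open>Reparametrisations\<close>

definition reparametrisation_cocycle ::
    "(real \<Rightarrow> 'm \<Rightarrow> 'm) \<Rightarrow> (real \<Rightarrow> 'm \<Rightarrow> 'm) \<Rightarrow> ('m \<Rightarrow> real \<Rightarrow> real) \<Rightarrow> bool" where
  "reparametrisation_cocycle \<phi> \<phi>' \<tau> \<longleftrightarrow>
     (\<forall>x s. \<phi> s x = \<phi>' (\<tau> x s) x) \<and>
     (\<forall>x. \<tau> x 0 = 0) \<and> (\<forall>x. strict_mono (\<tau> x)) \<and>
     (\<forall>x s t. \<tau> x (s + t) = \<tau> x s + \<tau> (\<phi> s x) t)"

definition continuous_reparametrisation ::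
    "(real \<Rightarrow> 'm::topological_space \<Rightarrow> 'm) \<Rightarrow> (real \<Rightarrow> 'm \<Rightarrow> 'm) \<Rightarrow> bool" where
  "continuous_reparametrisation \<phi> \<phi>' \<longleftrightarrow>
     (\<exists>\<tau>. continuous_on UNIV (\<lambda>(x, s). \<tau> x s) \<and> reparametrisation_cocycle \<phi> \<phi>' \<tau>)"

text \<open>The positivity of the derivative at time \<open>0\<close> is part of the notion; it does not follow from
  strict monotonicity alone.\<close>

definition C1_reparametrisation ::
    "('m::topological_space, 'e::euclidean_space) chart set \<Rightarrow>
     (real \<Rightarrow> 'm \<Rightarrow> 'm) \<Rightarrow> (real \<Rightarrow> 'm \<Rightarrow> 'm) \<Rightarrow> bool" where
  "C1_reparametrisation A \<phi> \<phi>' \<longleftrightarrow>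
     (\<exists>\<tau>. (\<forall>c\<in>A. Ck_on 1 (\<lambda>(z, s). \<tau> (chart_inv c z) s) ((snd c ` fst c) \<times> UNIV)) \<and>
        reparametrisation_cocycle \<phi> \<phi>' \<tau> \<and>
        (\<forall>x. deriv (\<tau> x) 0 > 0))"

definition uniformly_expanding_parametrisation ::
    "(real \<Rightarrow> 'm::topological_space \<Rightarrow> 'm) \<Rightarrow> (real \<Rightarrow> 'm \<Rightarrow> 'm) \<Rightarrow> (real \<Rightarrow> 'm \<Rightarrow> 'm) \<Rightarrow> bool" where
  "uniformly_expanding_parametrisation f \<phi> \<phi>' \<longleftrightarrow>
     continuous_flow \<phi>' \<and> continuous_reparametrisation \<phi> \<phi>' \<and>
     (\<exists>lam>1. \<forall>s t x. f t (\<phi>' s x) = \<phi>' (lam powr t * s) (f t x))"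

text \<open>\<open>u t s x\<close> is the derivative of \<open>sst t s x\<close> first in \<open>s\<close> and then in \<open>t\<close>.\<close>

definition is_mixed_derivative ::
    "(real \<Rightarrow> real \<Rightarrow> 'm \<Rightarrow> real) \<Rightarrow> (real \<Rightarrow> real \<Rightarrow> 'm \<Rightarrow> real) \<Rightarrow> bool" where
  "is_mixed_derivative sst u \<longleftrightarrow>
     (\<exists>v. \<forall>t s x. ((\<lambda>r. sst t r x) has_real_derivative v t s x) (at s) \<and>
        ((\<lambda>r. v r s x) has_real_derivative u t s x) (at t))"


section \<open>Invariant measures and the Koopman group\<close>

definition invariant_probability ::
    "(real \<Rightarrow> 'm::topological_space \<Rightarrow> 'm) \<Rightarrow> 'm measure \<Rightarrow> bool" where
  "invariant_probability F \<nu> \<longleftrightarrow>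
     prob_space \<nu> \<and> sets \<nu> = sets borel \<and> (\<forall>t. distr \<nu> borel (F t) = \<nu>)"

definition unique_invariant_probability ::
    "(real \<Rightarrow> 'm::topological_space \<Rightarrow> 'm) \<Rightarrow> 'm measure \<Rightarrow> bool" where
  "unique_invariant_probability F \<mu> \<longleftrightarrow>
     invariant_probability F \<mu> \<and> (\<forall>\<nu>. invariant_probability F \<nu> \<longrightarrow> \<nu> = \<mu>)"

text \<open>Elements of the Hilbert space of square integrable functions are handled through their
  representatives; all notions below are invariant under almost everywhere equality.\<close>

definition L2 :: "'m measure \<Rightarrow> ('m \<Rightarrow> complex) set" where
  "L2 M = {h. h \<in> borel_measurable M \<and> integrable M (\<lambda>x. (cmod (h x))\<^sup>2)}"

definition L2_inner :: "'m measure \<Rightarrow> ('m \<Rightarrow> complex) \<Rightarrow> ('m \<Rightarrow> complex) \<Rightarrow> complex" where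
  "L2_inner M \<psi> \<eta> = (LINT x|M. cnj (\<psi> x) * \<eta> x)"

definition L2_norm :: "'m measure \<Rightarrow> ('m \<Rightarrow> complex) \<Rightarrow> real" where
  "L2_norm M h = sqrt (LINT x|M. (cmod (h x))\<^sup>2)"

definition koopman :: "(real \<Rightarrow> 'm \<Rightarrow> 'm) \<Rightarrow> real \<Rightarrow> ('m \<Rightarrow> complex) \<Rightarrow> 'm \<Rightarrow> complex" where
  "koopman F s h = (\<lambda>x. h (F s x))"

text \<open>The graph of the (unbounded) generator \<open>H\<close> of \<open>U s = exp (- i s H)\<close>; its domain consists
  of those \<open>h\<close> for which the strong limit of \<open>i s\<^sup>-\<^sup>1 (U s - 1) h\<close> as \<open>s\<close> tends to \<open>0\<close> exists.\<close>

definition generator_graph ::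
    "'m measure \<Rightarrow> (real \<Rightarrow> ('m \<Rightarrow> complex) \<Rightarrow> 'm \<Rightarrow> complex) \<Rightarrow>
     (('m \<Rightarrow> complex) \<times> ('m \<Rightarrow> complex)) set" where
  "generator_graph M U =
     {(h, k). h \<in> L2 M \<and> k \<in> L2 M \<and>
        ((\<lambda>s. L2_norm M (\<lambda>x. \<i> / complex_of_real s * (U s h x - h x) - k x)) \<longlongrightarrow> 0) (at 0)}"

definition operator_kernel ::
    "(('m \<Rightarrow> complex) \<times> ('m \<Rightarrow> complex)) set \<Rightarrow> ('m \<Rightarrow> complex) set" where
  "operator_kernel H = {h. (h, \<lambda>_. 0) \<in> H}"

definition L2_orthogonal_complement ::
    "'m measure \<Rightarrow> ('m \<Rightarrow> complex) set \<Rightarrow> ('m \<Rightarrow> complex) set" where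
  "L2_orthogonal_complement M K = {h \<in> L2 M. \<forall>k\<in>K. L2_inner M k h = 0}"

definition strongly_mixing :: "'m measure \<Rightarrow> (real \<Rightarrow> 'm \<Rightarrow> 'm) \<Rightarrow> bool" where
  "strongly_mixing M F \<longleftrightarrow>
     (\<forall>B\<in>sets M. \<forall>C\<in>sets M.
        ((\<lambda>s. measure M (B \<inter> (F s -` C \<inter> space M))) \<longlongrightarrow> measure M B * measure M C) at_top)"

end

theory Submission
  imports Defs
begin

text \<open>By invariance of the measure up to a density close to 1, \<open>\<langle>\<psi>, \<eta> \<circ> \<phi>\<^sub>s\<rangle>\<close> changes little when \<open>x\<close> is
  replaced by \<open>f\<^sub>t x\<close> with \<open>t\<close> small. Now \<open>\<phi>\<^sub>s (f\<^sub>t x) = f\<^sub>t (\<phi>\<^sub>\<sigma> x)\<close>, where \<open>\<sigma> = \<sigma>(t)\<close> solves \<open>s\<^sup>*(t, \<sigma>, x) = s\<close>.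
  As \<open>\<partial>\<^sub>1 s\<^sup>*(t, s, x)\<close> is the integral of \<open>u\<^sub>t\<^sub>,\<^sub>0\<close> along the orbit of \<open>\<phi>\<close>, ergodicity shows that \<open>\<sigma>\<close> moves at almost
  constant speed \<open>C s\<close> with \<open>C = \<integral>u\<^sub>0\<^sub>,\<^sub>0 d\<mu> \<ge> ln \<lambda> > 0\<close>. Hence the average over \<open>0 \<le> t \<le> d\<close> of \<open>\<eta> (\<phi>\<^sub>\<sigma> x)\<close> is almost
  an ergodic average of \<open>\<eta>\<close> over an orbit segment of length \<open>C d s\<close>, which tends to the mean of \<open>\<eta>\<close> as
  \<open>s \<rightarrow> \<infinity>\<close>. Only ergodicity in the mean is used, and it follows from unique ergodicity without Riesz
  representation. For \<open>\<eta> \<in> ker(H)\<^sup>\<bottom>\<close> the mean vanishes because the constants lie in the kernel.\<close>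

section \<open>Continuous functions on a compact probability space\<close>

text \<open>The obstacle is that \<mu> is not known to be invariant under f. Let
  \<open>w t x\<close> be the derivative of \<open>sst t s x\<close> in s at s = 0, the rate at
  which \<open>f t\<close> stretches the orbits of \<phi>. Conjugating \<phi> by \<open>f t\<close>
  changes only the speed along orbits, by the factor \<open>1 / w t\<close>, so the conjugated flow
  preserves the measure with density \<open>w t\<close>; by unique ergodicity the image under
  \<open>f t\<close> of this measure, normalised, is again \<mu>. The normalising constant is
  \<open>lam powr t\<close>. It is found with the test function \<theta>, the velocity of the
  expanding parametrisation relative to \<phi>, since
  \<open>\<theta> (f t x) * w t x = lam powr t * \<theta> x\<close>; comparison to first order at t
  = 0 makes C positive. Freeness of \<phi>, a consequence of minimality and expansion, makes times
  along orbits unique. This yields the cocycle identity of \<open>sst\<close> and the explicit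
  solution \<open>sst (- t) s (f t x)\<close> for \<sigma>. The time window d is fixed by the
  desired accuracy before s tends to infinity, so L1 convergence of the ergodic averages is
  enough.\<close>

lemma compact_continuous_bounded:
  fixes h :: "'m::metric_space \<Rightarrow> 'b::real_normed_vector"
  assumes "compact (UNIV :: 'm set)" "continuous_on UNIV h"
  obtains K where "K > 0" "\<And>x. norm (h x) \<le> K"
proof -
  have "bounded (range h)"
    using assms compact_continuous_image compact_imp_bounded by blast
  then show thesis
    using that by (auto simp: bounded_pos)
qed

text \<open>Restricting t to [-1, 1] makes the parameter space compact, so continuity becomes
  uniform in x. The small time windows of the later estimates are obtained in this way.\<close>

lemma uniform_small_time:
  fixes G :: "real \<Rightarrow> 'm::metric_space \<Rightarrow> 'b::metric_space"
  assumes "compact (UNIV :: 'm set)" "continuous_on UNIV (\<lambda>(t, x). G t x)" "e > 0"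
  obtains d where "d > 0" "\<And>t x. \<bar>t\<bar> \<le> d \<Longrightarrow> dist (G t x) (G 0 x) < e"
proof -
  have "compact ({-1..1::real} \<times> (UNIV :: 'm set))"
    using assms(1) by (intro compact_Times) auto
  moreover have "continuous_on ({-1..1::real} \<times> (UNIV :: 'm set)) (\<lambda>(t, x). G t x)"
    using assms(2) continuous_on_subset by blast
  ultimately have "uniformly_continuous_on ({-1..1::real} \<times> (UNIV :: 'm set)) (\<lambda>(t, x). G t x)"
    by (rule compact_uniformly_continuous[rotated])
  then obtain d where d: "d > 0"
    "\<And>p q. p \<in> {-1..1::real} \<times> (UNIV :: 'm set) \<Longrightarrow> q \<in> {-1..1} \<times> UNIV \<Longrightarrow> dist q p < d
       \<Longrightarrow> dist ((\<lambda>(t, x). G t x) q) ((\<lambda>(t, x). G t x) p) < e"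
    using assms(3) unfolding uniformly_continuous_on_def by metis
  show thesis
  proof
    show "min 1 (d / 2) > 0" using d(1) by simp
    fix t x assume t: "\<bar>t\<bar> \<le> min 1 (d / 2)"
    then show "dist (G t x) (G 0 x) < e"
      using d(2)[of "(0, x)" "(t, x)"] d(1) by (auto simp: dist_Pair_Pair dist_real_def abs_le_iff)
  qed
qed

text \<open>The function is a pointwise limit of functions that see r only through a rounded value,
  and each of these is glued from countably many sections. This avoids comparing the product
  sigma-algebra with the Borel sets of the product.\<close>

lemma measurable_continuous_param:
  fixes G :: "real \<Rightarrow> 'm \<Rightarrow> real"
  assumes "\<And>r. G r \<in> borel_measurable N" "\<And>x. continuous_on UNIV (\<lambda>r. G r x)"
  shows "(\<lambda>(r, x). G r x) \<in> borel_measurable (borel \<Otimes>\<^sub>M N)"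
proof (rule borel_measurable_LIMSEQ_real)
  fix p :: "real \<times> 'm"
  assume "p \<in> space (borel \<Otimes>\<^sub>M N)"
  obtain r x where p: "p = (r, x)" by (cases p)
  have "(\<lambda>n. real_of_int \<lfloor>real (Suc n) * r\<rfloor> / real (Suc n)) \<longlonglongrightarrow> r"
  proof (rule Lim_null[THEN iffD2], rule Lim_null_comparison)
    show "\<forall>\<^sub>F n in sequentially.
        norm (real_of_int \<lfloor>real (Suc n) * r\<rfloor> / real (Suc n) - r) \<le> 1 / real (Suc n)"
    proof (rule always_eventually, rule allI)
      fix n
      have "real_of_int \<lfloor>real (Suc n) * r\<rfloor> / real (Suc n) - r
          = (real_of_int \<lfloor>real (Suc n) * r\<rfloor> - real (Suc n) * r) / real (Suc n)"
        by (simp add: field_simps)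
      moreover have "\<bar>real_of_int \<lfloor>real (Suc n) * r\<rfloor> - real (Suc n) * r\<bar> \<le> 1"
        by linarith
      ultimately show "norm (real_of_int \<lfloor>real (Suc n) * r\<rfloor> / real (Suc n) - r) \<le> 1 / real (Suc n)"
        by (simp add: abs_divide divide_right_mono)
    qed
    show "(\<lambda>n. 1 / real (Suc n)) \<longlonglongrightarrow> 0"
      using LIMSEQ_Suc lim_1_over_n by blast
  qed
  moreover have "isCont (\<lambda>r. G r x) r"
    using assms(2)[of x] by (simp add: continuous_on_eq_continuous_at)
  ultimately show "(\<lambda>n. G (real_of_int \<lfloor>real (Suc n) * fst p\<rfloor> / real (Suc n)) (snd p))
      \<longlonglongrightarrow> (\<lambda>(r, x). G r x) p"
    unfolding p by (simp add: isCont_tendsto_compose[where g="\<lambda>r. G r x"])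
next
  fix n
  show "(\<lambda>p. G (real_of_int \<lfloor>real (Suc n) * fst p\<rfloor> / real (Suc n)) (snd p))
      \<in> borel_measurable (borel \<Otimes>\<^sub>M N)"
  proof (rule measurable_compose_countable[where f = "\<lambda>i p. G (real_of_int i / real (Suc n)) (snd p)"
        and g = "\<lambda>p. \<lfloor>real (Suc n) * fst p\<rfloor>"])
    show "(\<lambda>p. G (real_of_int i / real (Suc n)) (snd p)) \<in> borel_measurable (borel \<Otimes>\<^sub>M N)" for i
      using assms(1) by measurable
  qed measurable
qed

lemma continuous_imp_measurable_borel:
  fixes h :: "'m::topological_space \<Rightarrow> 'b::topological_space"
  assumes "sets M = sets borel" "continuous_on UNIV h"
  shows "h \<in> borel_measurable M"
  using borel_measurable_continuous_onI[OF assms(2)] assms(1) measurable_cong_sets by blast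

lemma continuous_on_curry:
  assumes "continuous_on UNIV (\<lambda>(r, x). G r x)"
  shows "continuous_on UNIV (\<lambda>r. G r x)" "continuous_on UNIV (\<lambda>x. G r x)"
proof -
  show "continuous_on UNIV (\<lambda>r. G r x)"
    using continuous_on_compose2[OF assms, of UNIV "\<lambda>r. (r, x)"] by (simp add: continuous_on_Pair)
  show "continuous_on UNIV (\<lambda>x. G r x)"
    using continuous_on_compose2[OF assms, of UNIV "\<lambda>x. (r, x)"] by (simp add: continuous_on_Pair)
qed

locale compact_borel_probability = prob_space M for M :: "'m::metric_space measure" +
  assumes compact_UNIV: "compact (UNIV :: 'm set)"
    and sets_M: "sets M = sets borel"
begin

lemma continuous_integrable:
  fixes h :: "'m \<Rightarrow> 'b::{banach, second_countable_topology}"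
  assumes "continuous_on UNIV h"
  shows "integrable M h"
proof -
  obtain K where "\<And>x. norm (h x) \<le> K"
    using compact_continuous_bounded[OF compact_UNIV assms] by blast
  then show ?thesis
    using continuous_imp_measurable_borel[OF sets_M assms] by (intro integrable_const_bound[of _ K]) auto
qed

text \<open>The time integral is a gauge integral. Cutting G off by an indicator turns it into a
  Lebesgue integral of a function that is bounded on a rectangle of finite measure, so Fubini
  applies.\<close>

lemma integral_swap_param:
  fixes G :: "real \<Rightarrow> 'm \<Rightarrow> real"
  assumes cont: "continuous_on UNIV (\<lambda>(r, x). G r x)"
  shows "(LINT x|M. integral {a..b} (\<lambda>r. G r x)) = integral {a..b} (\<lambda>r. LINT x|M. G r x)"
    and "continuous_on UNIV (\<lambda>x. integral {a..b} (\<lambda>r. G r x))"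
    and "(\<lambda>r. LINT x|M. G r x) integrable_on {a..b}"
proof -
  note contr = continuous_on_curry(1)[OF cont] and contx = continuous_on_curry(2)[OF cont]
  have "compact ({a..b} \<times> (UNIV :: 'm set))"
    using compact_UNIV by (intro compact_Times) auto
  then have "bounded ((\<lambda>(r, x). G r x) ` ({a..b} \<times> UNIV))"
    using cont compact_continuous_image compact_imp_bounded continuous_on_subset
    by (metis subset_UNIV)
  then obtain K where K: "K > 0" "\<And>r x. r \<in> {a..b} \<Longrightarrow> \<bar>G r x\<bar> \<le> K"
    unfolding bounded_pos by fastforce
  interpret L: sigma_finite_measure "lborel :: real measure" by (rule sigma_finite_lborel)
  interpret P: pair_sigma_finite "lborel :: real measure" M ..
  have meas: "(\<lambda>(r, x). indicator {a..b} r * G r x) \<in> borel_measurable (lborel \<Otimes>\<^sub>M M)"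
  proof -
    have "(\<lambda>(r, x). G r x) \<in> borel_measurable (borel \<Otimes>\<^sub>M M)"
      using continuous_imp_measurable_borel[OF sets_M contx] contr by (intro measurable_continuous_param) auto
    then have "(\<lambda>(r, x). indicator {a..b} r * G r x) \<in> borel_measurable (borel \<Otimes>\<^sub>M M)"
      by measurable
    then show ?thesis
      using measurable_cong_sets[OF sets_pair_measure_cong[OF sets_lborel refl] refl] by blast
  qed
  have int: "integrable (lborel \<Otimes>\<^sub>M M) (\<lambda>(r, x). indicator {a..b} r * G r x)"
  proof (rule Bochner_Integration.integrable_bound[OF _ meas])
    have "emeasure (lborel \<Otimes>\<^sub>M M) ({a..b} \<times> space M) < \<infinity>"
      by (simp add: emeasure_pair_measure_Times ennreal_mult_eq_top_iff emeasure_lborel_Icc_eq less_top[symmetric])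
    then show "integrable (lborel \<Otimes>\<^sub>M M) (\<lambda>p. indicator ({a..b} \<times> space M) p * K)"
      by (intro integrable_mult_left integrable_real_indicator) auto
    show "AE p in lborel \<Otimes>\<^sub>M M. norm ((\<lambda>(r, x). indicator {a..b} r * G r x) p)
        \<le> norm (indicator ({a..b} \<times> space M) p * K)"
      using K by (intro AE_I2) (auto simp: indicator_def space_pair_measure)
  qed
  have hk: "(LINT r|lborel. indicator {a..b} r * h r) = integral {a..b} h"
    if "set_integrable lborel {a..b} h" for h :: "real \<Rightarrow> real"
    using set_borel_integral_eq_integral(2)[OF that] by (simp add: set_lebesgue_integral_def)
  have ci: "set_integrable lborel {a..b} (\<lambda>r. G r x)" for x
    by (intro borel_integrable_atLeastAtMost') (use contr continuous_on_subset in blast)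
  have "integrable lborel (\<lambda>r. LINT x|M. indicator {a..b} r * G r x)"
    using P.integrable_fst[OF int] by simp
  then have i2: "set_integrable lborel {a..b} (\<lambda>r. LINT x|M. G r x)"
    by (simp add: set_integrable_def)
  show "(LINT x|M. integral {a..b} (\<lambda>r. G r x)) = integral {a..b} (\<lambda>r. LINT x|M. G r x)"
    using P.Fubini_integral[OF int] hk[OF i2] hk[OF ci] by simp
  show "(\<lambda>r. LINT x|M. G r x) integrable_on {a..b}"
    using set_borel_integral_eq_integral(1)[OF i2] .
  have "continuous_on (UNIV \<times> cbox a b) (\<lambda>(x, r). G r x)"
    using continuous_on_compose2[OF cont, of _ prod.swap] 
    by (auto simp: split_beta intro!: continuous_intros)
  then show "continuous_on UNIV (\<lambda>x. integral {a..b} (\<lambda>r. G r x))"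
    using integral_continuous_on_param[of UNIV a b "\<lambda>x r. G r x"] by simp
qed

end


section \<open>Density of continuous functions\<close>

lemma cmod_add_square_le: "(cmod (a + b))\<^sup>2 \<le> 2 * (cmod a)\<^sup>2 + 2 * (cmod b)\<^sup>2"
proof -
  have "(cmod (a + b))\<^sup>2 \<le> (cmod a + cmod b)\<^sup>2"
    by (intro power_mono norm_triangle_ineq) auto
  also have "\<dots> \<le> 2 * (cmod a)\<^sup>2 + 2 * (cmod b)\<^sup>2"
    using sum_squares_bound[of "cmod a" "cmod b"] by (simp add: power2_sum)
  finally show ?thesis .
qed

lemma open_indicator_continuous_limit:
  fixes U :: "'m::metric_space set"
  assumes "open U"
  obtains h :: "nat \<Rightarrow> 'm \<Rightarrow> real" where "\<And>n. continuous_on UNIV (h n)"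
    "\<And>n x. 0 \<le> h n x" "\<And>n x. h n x \<le> 1" "\<And>x. (\<lambda>n. h n x) \<longlonglongrightarrow> indicator U x"
\<comment> \<open>This case is split off because \<open>infdist x {}\<close> is 0 by convention,
  which would give the limit 0 instead of 1.\<close>
proof (cases "U = UNIV")
  case True
  then show thesis by (intro that[of "\<lambda>_ _. 1"]) auto
next
  case False
  show thesis
  proof (rule that)
    let ?h = "\<lambda>n x. min 1 (real n * infdist x (- U))"
    show "continuous_on UNIV (?h n)" for n
      by (intro continuous_intros)
    show "0 \<le> ?h n x" "?h n x \<le> 1" for n x
      by (auto simp: infdist_nonneg)
    show "(\<lambda>n. ?h n x) \<longlonglongrightarrow> indicator U x" for x
    proof (cases "x \<in> U")
      case True
      then have "infdist x (- U) > 0"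
        using assms False in_closed_iff_infdist_zero[of "- U" x] infdist_nonneg[of x "- U"]
        by (auto simp: less_le)
      then obtain N where N: "1 \<le> real N * infdist x (- U)"
        using reals_Archimedean3 less_imp_le by blast
      have "\<forall>\<^sub>F n in sequentially. ?h n x = 1"
      proof (rule eventually_sequentiallyI)
        fix n assume "N \<le> n"
        then have "real N * infdist x (- U) \<le> real n * infdist x (- U)"
          by (intro mult_right_mono) (auto simp: infdist_nonneg)
        then show "?h n x = 1" using N by simp
      qed
      then show ?thesis using True by (simp add: tendsto_eventually)
    next
      case False
      then show ?thesis by simp
    qed
  qed
qed

text \<open>Open sets form an intersection-stable generator of the Borel sets, and their indicators
  are bounded pointwise limits of continuous functions. Invariance of a measure can therefore be
  tested on continuous functions.\<close>

lemma prob_measure_eqI_continuous: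
  fixes M N :: "'m::metric_space measure"
  assumes M: "prob_space M" "sets M = sets borel" and N: "prob_space N" "sets N = sets borel"
    and eq: "\<And>h :: 'm \<Rightarrow> real. continuous_on UNIV h \<Longrightarrow> (\<And>x. \<bar>h x\<bar> \<le> 1) \<Longrightarrow>
      (LINT x|M. h x) = (LINT x|N. h x)"
  shows "M = N"
proof (rule measure_eqI_generator_eq[where E = "Collect open" and \<Omega> = UNIV and A = "\<lambda>_. UNIV"])
  interpret M: prob_space M by fact
  interpret N: prob_space N by fact
  fix U :: "'m set" assume "U \<in> Collect open"
  then have U: "open U" by simp
  obtain h :: "nat \<Rightarrow> 'm \<Rightarrow> real" where h: "\<And>n. continuous_on UNIV (h n)"
    "\<And>n x. 0 \<le> h n x" "\<And>n x. h n x \<le> 1" "\<And>x. (\<lambda>n. h n x) \<longlonglongrightarrow> indicator U x"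
    by (rule open_indicator_continuous_limit[OF U]) (rule that, assumption+)
  have lim: "(\<lambda>n. LINT x|P. h n x) \<longlonglongrightarrow> measure P U"
    if "prob_space P" "sets P = sets borel" for P :: "'m measure"
  proof -
    interpret P: prob_space P by fact
    have sp: "space P = UNIV" using sets_eq_imp_space_eq[OF that(2)] by simp
    have "(\<lambda>n. LINT x|P. h n x) \<longlonglongrightarrow> (LINT x|P. indicator U x)"
    proof (rule integral_dominated_convergence)
      show "integrable P (\<lambda>_. 1 :: real)" by simp
      show "(indicator U :: 'm \<Rightarrow> real) \<in> borel_measurable P"
        using U that(2) by (intro borel_measurable_indicator) simp
      show "h n \<in> borel_measurable P" for n
        using continuous_imp_measurable_borel[OF that(2) h(1)] .
      show "AE x in P. (\<lambda>n. h n x) \<longlonglongrightarrow> indicator U x" using h(4) by simp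
      show "AE x in P. norm (h n x) \<le> 1" for n using h(2,3) by simp
    qed
    then show ?thesis using sp by simp
  qed
  have "\<bar>h n x\<bar> \<le> 1" for n x using h(2,3)[of n x] by simp
  then have "(\<lambda>n. LINT x|M. h n x) = (\<lambda>n. LINT x|N. h n x)"
    using eq[OF h(1)] by simp
  then have "measure M U = measure N U"
    using lim[OF M] lim[OF N] LIMSEQ_unique by metis
  then show "emeasure M U = emeasure N U"
    by (simp add: M.emeasure_eq_measure N.emeasure_eq_measure)
next
  interpret M: prob_space M by fact
  show "emeasure M UNIV \<noteq> \<infinity>" by simp
qed (use M(2) N(2) in \<open>auto simp: Int_stable_def borel_def\<close>)

context compact_borel_probability
begin

lemma space_M: "space M = UNIV"
  using sets_eq_imp_space_eq[OF sets_M] by simp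

text \<open>A Dynkin class argument: the approximable sets contain the open sets and are closed
  under complements, through \<open>1 - h\<close>, and under countable disjoint unions.\<close>

lemma set_continuous_approx:
  assumes "B \<in> sets M" "e > 0"
  obtains h :: "'m \<Rightarrow> real" where "continuous_on UNIV h" "\<And>x. 0 \<le> h x" "\<And>x. h x \<le> 1"
    "(LINT x|M. \<bar>indicator B x - h x\<bar>) < e"
proof -
  define Q where "Q B \<longleftrightarrow> (\<forall>e>0. \<exists>h :: 'm \<Rightarrow> real. continuous_on UNIV h \<and> (\<forall>x. 0 \<le> h x \<and> h x \<le> 1) \<and>
    (LINT x|M. \<bar>indicator B x - h x\<bar>) < e)" for B
  have int: "integrable M (\<lambda>x. \<bar>indicator B x - h x\<bar>)"
    if "continuous_on UNIV h" "B \<in> sets M" for B and h :: "'m \<Rightarrow> real"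
    using that continuous_integrable[OF that(1)]
    by (intro integrable_abs Bochner_Integration.integrable_diff integrable_real_indicator) (auto simp: less_top[symmetric])
  have sig: "sets M = sigma_sets UNIV (Collect open)"
    using sets_M by (simp add: borel_def)
  have "Q B"
  proof (rule sigma_sets_induct_disjoint[of "Collect open" UNIV B Q])
    show "Int_stable (Collect open :: 'm set set)" by (auto simp: Int_stable_def)
    show "B \<in> sigma_sets UNIV (Collect open)" using assms(1) sig by simp
  next
    fix U :: "'m set" assume "U \<in> Collect open"
    then have U: "open U" by simp
    obtain h :: "nat \<Rightarrow> 'm \<Rightarrow> real" where h: "\<And>n. continuous_on UNIV (h n)"
      "\<And>n x. 0 \<le> h n x" "\<And>n x. h n x \<le> 1" "\<And>x. (\<lambda>n. h n x) \<longlonglongrightarrow> indicator U x"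
      by (rule open_indicator_continuous_limit[OF U]) (rule that, assumption+)
    have "(\<lambda>n. LINT x|M. \<bar>indicator U x - h n x\<bar>) \<longlonglongrightarrow> (LINT x|M. 0 :: real)"
    proof (rule integral_dominated_convergence)
      show "integrable M (\<lambda>_. 1 :: real)" by simp
      show "(\<lambda>x. \<bar>indicator U x - h n x\<bar>) \<in> borel_measurable M" for n
        by (intro borel_measurable_integrable int h(1)) (use U sets_M in simp)
      show "AE x in M. (\<lambda>n. \<bar>indicator U x - h n x\<bar>) \<longlonglongrightarrow> 0"
      proof (rule AE_I2)
        fix x
        have "(\<lambda>n. \<bar>indicator U x - h n x\<bar>) \<longlonglongrightarrow> \<bar>indicator U x - indicator U x\<bar>"
          by (intro tendsto_intros h(4))
        then show "(\<lambda>n. \<bar>indicator U x - h n x\<bar>) \<longlonglongrightarrow> 0" by simp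
      qed
      show "AE x in M. norm \<bar>indicator U x - h n x\<bar> \<le> 1" for n
      proof (rule AE_I2)
        fix x show "norm \<bar>indicator U x - h n x\<bar> \<le> 1"
          using h(2,3)[of n x] by (auto simp: indicator_def)
      qed
    qed simp
    then have "\<exists>n. (LINT x|M. \<bar>indicator U x - h n x\<bar>) < e" if "e > 0" for e
      using that order_tendstoD(2)[of _ 0 sequentially e] by (auto simp: eventually_sequentially)
    then show "Q U"
      unfolding Q_def using h(1,2,3) by metis
  next
    show "Q {}" unfolding Q_def by (auto intro!: exI[of _ "\<lambda>_. 0"])
  next
    fix B :: "'m set" assume "Q B"
    show "Q (UNIV - B)"
      unfolding Q_def
    proof (intro allI impI)
      fix e :: real assume "e > 0"
      then obtain h :: "'m \<Rightarrow> real" where h: "continuous_on UNIV h" "\<forall>x. 0 \<le> h x \<and> h x \<le> 1"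
        "(LINT x|M. \<bar>indicator B x - h x\<bar>) < e"
        using \<open>Q B\<close> unfolding Q_def by blast
      have "\<bar>indicator (UNIV - B) x - (1 - h x)\<bar> = \<bar>indicator B x - h x\<bar>" for x
        by (auto simp: indicator_def)
      then show "\<exists>h :: 'm \<Rightarrow> real. continuous_on UNIV h \<and> (\<forall>x. 0 \<le> h x \<and> h x \<le> 1) \<and>
          (LINT x|M. \<bar>indicator (UNIV - B) x - h x\<bar>) < e"
        using h by (intro exI[of _ "\<lambda>x. 1 - h x"]) (auto intro!: continuous_intros)
    qed
  next
    fix A :: "nat \<Rightarrow> 'm set"
    assume A: "disjoint_family A" "range A \<subseteq> sigma_sets UNIV (Collect open)" "\<And>i. Q (A i)"
    then have Am: "A i \<in> sets M" for i unfolding sig by blast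
    show "Q (\<Union>i. A i)"
      unfolding Q_def
    proof (intro allI impI)
      fix e :: real assume e: "e > 0"
      have "(\<lambda>n. measure M (\<Union>i<n. A i)) \<longlonglongrightarrow> measure M (\<Union>n. \<Union>i<n. A i)"
        using Am by (intro finite_Lim_measure_incseq) (auto simp: incseq_def, meson lessThan_iff less_le_trans)
      moreover have "(\<Union>n. \<Union>i<n. A i) = (\<Union>i. A i)" by auto
      ultimately have "(\<lambda>n. measure M (\<Union>i<n. A i)) \<longlonglongrightarrow> measure M (\<Union>i. A i)"
        by simp
      then have "\<forall>\<^sub>F n in sequentially. measure M (\<Union>i. A i) - e / 2 < measure M (\<Union>i<n. A i)"
        using e by (intro order_tendstoD(1)) auto
      then obtain n where n: "measure M (\<Union>i. A i) - e / 2 < measure M (\<Union>i<n. A i)"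
        by (auto simp: eventually_sequentially)
      define T where "T = (\<Union>i. A i) - (\<Union>i<n. A i)"
      have Tm: "T \<in> sets M" unfolding T_def using Am by auto
      have mT: "measure M T < e / 2"
        unfolding T_def using n Am by (subst finite_measure_Diff) auto
      \<comment> \<open>\<open>Suc n\<close> instead of \<open>n\<close> keeps the divisor positive;
        the n summands still add up to at most e / 2, and the tail T accounts for the other
        half.\<close>
      have e2: "e / (2 * real (Suc n)) > 0" using e by simp
      have "\<forall>i. \<exists>h :: 'm \<Rightarrow> real. continuous_on UNIV h \<and> (\<forall>x. 0 \<le> h x \<and> h x \<le> 1) \<and>
        (LINT x|M. \<bar>indicator (A i) x - h x\<bar>) < e / (2 * real (Suc n))"
        using A(3)[unfolded Q_def, rule_format, OF e2] by blast
      from choice[OF this] obtain h :: "nat \<Rightarrow> 'm \<Rightarrow> real" where h: "\<And>i. continuous_on UNIV (h i)"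
        "\<And>i x. 0 \<le> h i x" "\<And>i. (LINT x|M. \<bar>indicator (A i) x - h i x\<bar>) < e / (2 * real (Suc n))"
        by blast
      \<comment> \<open>Cutting the sum off at 1 restores the range [0, 1] and moves no value away
        from the indicator, which is 0 or 1.\<close>
      let ?g = "\<lambda>x. min 1 (\<Sum>i<n. h i x)"
      have g: "continuous_on UNIV ?g" using h(1) by (intro continuous_intros)
      have "(LINT x|M. \<bar>indicator (\<Union>i. A i) x - ?g x\<bar>)
          \<le> (LINT x|M. indicator T x + (\<Sum>i<n. \<bar>indicator (A i) x - h i x\<bar>))"
      proof (rule integral_mono)
        show "integrable M (\<lambda>x. \<bar>indicator (\<Union>i. A i) x - ?g x\<bar>)"
          using g Am by (intro int) auto
        show "integrable M (\<lambda>x. indicator T x + (\<Sum>i<n. \<bar>indicator (A i) x - h i x\<bar>))"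
          using Tm int[OF h(1) Am] by (intro Bochner_Integration.integrable_add Bochner_Integration.integrable_sum integrable_real_indicator) (auto simp: less_top[symmetric])
        fix x
        have "indicator (\<Union>i. A i) x = indicator T x + (indicator (\<Union>i<n. A i) x :: real)"
          by (auto simp: T_def indicator_def)
        moreover have "(indicator (\<Union>i<n. A i) x :: real) = (\<Sum>i<n. indicator (A i) x)"
          using A(1) by (intro indicator_UN_disjoint) (auto simp: disjoint_family_on_def)
        moreover have "\<bar>indicator (\<Union>i. A i) x - ?g x\<bar> \<le> \<bar>indicator (\<Union>i. A i) x - (\<Sum>i<n. h i x)\<bar>"
          by (auto simp: indicator_def)
        moreover have "\<bar>(\<Sum>i<n. indicator (A i) x) - (\<Sum>i<n. h i x)\<bar> \<le> (\<Sum>i<n. \<bar>indicator (A i) x - h i x\<bar>)"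
          unfolding sum_subtractf[symmetric] by (rule sum_abs)
        moreover have "(indicator T x :: real) \<ge> 0" by simp
        ultimately show "\<bar>indicator (\<Union>i. A i) x - ?g x\<bar> \<le> indicator T x + (\<Sum>i<n. \<bar>indicator (A i) x - h i x\<bar>)"
          by linarith
      qed
      also have "\<dots> = measure M T + (\<Sum>i<n. LINT x|M. \<bar>indicator (A i) x - h i x\<bar>)"
        using Tm int[OF h(1) Am] space_M
        by (subst Bochner_Integration.integral_add) (auto simp: less_top[symmetric])
      also have "(\<Sum>i<n. LINT x|M. \<bar>indicator (A i) x - h i x\<bar>) \<le> (\<Sum>i<n. e / (2 * real (Suc n)))"
        using h(3) by (intro sum_mono) (auto intro: less_imp_le)
      also have "\<dots> \<le> e / 2"
        using e by (simp add: field_simps)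
      finally have "(LINT x|M. \<bar>indicator (\<Union>i. A i) x - ?g x\<bar>) < e" using mT by linarith
      moreover have "\<forall>x. 0 \<le> ?g x \<and> ?g x \<le> 1" using h(2) by (auto intro: sum_nonneg)
      ultimately show "\<exists>h :: 'm \<Rightarrow> real. continuous_on UNIV h \<and> (\<forall>x. 0 \<le> h x \<and> h x \<le> 1) \<and>
          (LINT x|M. \<bar>indicator (\<Union>i. A i) x - h x\<bar>) < e"
        using g by blast
    qed
  qed auto
  then obtain h :: "'m \<Rightarrow> real" where "continuous_on UNIV h" "\<forall>x. 0 \<le> h x \<and> h x \<le> 1"
    "(LINT x|M. \<bar>indicator B x - h x\<bar>) < e"
    using assms(2) unfolding Q_def by blast
  then show thesis using that by blast
qed

text \<open>Squared distances are used so that \<open>cmod_add_square_le\<close> can replace the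
  triangle inequality of the norm. Integrability is a separate clause because the integral of a
  non-integrable function is 0 by default, and the bound would then say nothing.\<close>

definition L2_approximable :: "('m \<Rightarrow> complex) \<Rightarrow> bool" where
  "L2_approximable h \<longleftrightarrow> h \<in> borel_measurable M \<and>
     (\<forall>e>0. \<exists>g. continuous_on UNIV g \<and> integrable M (\<lambda>x. (cmod (h x - g x))\<^sup>2) \<and>
        (LINT x|M. (cmod (h x - g x))\<^sup>2) < e)"

lemma L2_approximable_close:
  assumes h: "h \<in> borel_measurable M"
    and ex: "\<And>e. e > 0 \<Longrightarrow> \<exists>k. L2_approximable k \<and> integrable M (\<lambda>x. (cmod (h x - k x))\<^sup>2) \<and>
        (LINT x|M. (cmod (h x - k x))\<^sup>2) < e"
  shows "L2_approximable h"
  unfolding L2_approximable_def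
proof (intro conjI h allI impI)
  fix e :: real assume e: "e > 0"
  \<comment> \<open>\<open>cmod_add_square_le\<close> doubles each of the two errors, hence the
    quarters.\<close>
  obtain k where k: "L2_approximable k" "integrable M (\<lambda>x. (cmod (h x - k x))\<^sup>2)"
    "(LINT x|M. (cmod (h x - k x))\<^sup>2) < e / 4"
    using ex[of "e / 4"] e by auto
  obtain g where g: "continuous_on UNIV g" "integrable M (\<lambda>x. (cmod (k x - g x))\<^sup>2)"
    "(LINT x|M. (cmod (k x - g x))\<^sup>2) < e / 4"
    using k(1) e unfolding L2_approximable_def by (meson divide_pos_pos zero_less_numeral)
  have gm: "g \<in> borel_measurable M"
    using continuous_imp_measurable_borel[OF sets_M g(1)] .
  have le: "(cmod (h x - g x))\<^sup>2 \<le> 2 * (cmod (h x - k x))\<^sup>2 + 2 * (cmod (k x - g x))\<^sup>2" for x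
    using cmod_add_square_le[of "h x - k x" "k x - g x"] by simp
  have bi: "integrable M (\<lambda>x. 2 * (cmod (h x - k x))\<^sup>2 + 2 * (cmod (k x - g x))\<^sup>2)"
    using k g by simp
  have int: "integrable M (\<lambda>x. (cmod (h x - g x))\<^sup>2)"
    by (rule Bochner_Integration.integrable_bound[OF bi]) (use h gm le in auto)
  have "(LINT x|M. (cmod (h x - g x))\<^sup>2)
      \<le> (LINT x|M. 2 * (cmod (h x - k x))\<^sup>2 + 2 * (cmod (k x - g x))\<^sup>2)"
    by (intro integral_mono int bi le)
  also have "\<dots> < e" using k g by simp
  finally show "\<exists>g. continuous_on UNIV g \<and> integrable M (\<lambda>x. (cmod (h x - g x))\<^sup>2) \<and>
      (LINT x|M. (cmod (h x - g x))\<^sup>2) < e"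
    using g(1) int by blast
qed

lemma L2_approximable_indicator:
  assumes B: "B \<in> sets M"
  shows "L2_approximable (\<lambda>x. indicator B x *\<^sub>R c)"
  unfolding L2_approximable_def
proof (intro conjI allI impI)
  show "(\<lambda>x. indicator B x *\<^sub>R c) \<in> borel_measurable M" using B by measurable
  fix e :: real assume e: "e > 0"
  \<comment> \<open>The added 1 keeps the divisor positive when c = 0.\<close>
  define e' where "e' = e / ((cmod c)\<^sup>2 + 1)"
  have pos: "(cmod c)\<^sup>2 + 1 > 0" by (smt (verit) zero_le_power2)
  have e': "e' > 0" unfolding e'_def using e pos by simp
  obtain k :: "'m \<Rightarrow> real" where k: "continuous_on UNIV k" "\<And>x. 0 \<le> k x" "\<And>x. k x \<le> 1"
    "(LINT x|M. \<bar>indicator B x - k x\<bar>) < e'"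
    using set_continuous_approx[OF B e'] by metis
  have int: "integrable M (\<lambda>x. \<bar>indicator B x - k x\<bar>)"
    using B continuous_integrable[OF k(1)]
    by (intro integrable_abs Bochner_Integration.integrable_diff integrable_real_indicator)
      (auto simp: less_top[symmetric])
  have km: "k \<in> borel_measurable M"
    using continuous_imp_measurable_borel[OF sets_M k(1)] .
  have eq: "(cmod (indicator B x *\<^sub>R c - k x *\<^sub>R c))\<^sup>2 = \<bar>indicator B x - k x\<bar>\<^sup>2 * (cmod c)\<^sup>2" for x
    by (simp add: scaleR_diff_left[symmetric] power_mult_distrib del: scaleR_conv_of_real)
  \<comment> \<open>L1 approximation becomes L2 approximation because the difference is at most 1
    and thus dominates its square.\<close>
  have le: "(cmod (indicator B x *\<^sub>R c - k x *\<^sub>R c))\<^sup>2 \<le> \<bar>indicator B x - k x\<bar> * (cmod c)\<^sup>2" for x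
  proof -
    have "\<bar>indicator B x - k x\<bar> \<le> 1" using k(2,3)[of x] by (auto simp: indicator_def)
    then have "\<bar>indicator B x - k x\<bar>\<^sup>2 \<le> \<bar>indicator B x - k x\<bar>"
      using power_decreasing[of 1 2 "\<bar>indicator B x - k x\<bar>"] by simp
    then show ?thesis unfolding eq by (intro mult_right_mono) auto
  qed
  have bi: "integrable M (\<lambda>x. \<bar>indicator B x - k x\<bar> * (cmod c)\<^sup>2)" using int by simp
  have int2: "integrable M (\<lambda>x. (cmod (indicator B x *\<^sub>R c - k x *\<^sub>R c))\<^sup>2)"
    by (rule Bochner_Integration.integrable_bound[OF bi]) (use B km le in auto)
  have "(LINT x|M. (cmod (indicator B x *\<^sub>R c - k x *\<^sub>R c))\<^sup>2)
      \<le> (LINT x|M. \<bar>indicator B x - k x\<bar> * (cmod c)\<^sup>2)"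
    by (intro integral_mono int2 bi le)
  also have "\<dots> = (LINT x|M. \<bar>indicator B x - k x\<bar>) * (cmod c)\<^sup>2" by simp
  also have "\<dots> \<le> e' * (cmod c)\<^sup>2" using k(4) by (intro mult_right_mono) auto
  also have "\<dots> < e' * ((cmod c)\<^sup>2 + 1)" using e' by simp
  also have "\<dots> = e" using pos by (simp add: e'_def)
  finally show "\<exists>g. continuous_on UNIV g \<and> integrable M (\<lambda>x. (cmod (indicator B x *\<^sub>R c - g x))\<^sup>2) \<and>
      (LINT x|M. (cmod (indicator B x *\<^sub>R c - g x))\<^sup>2) < e"
    using int2 k(1) by (intro exI[of _ "\<lambda>x. k x *\<^sub>R c"]) (auto intro!: continuous_intros)
qed

lemma L2_approximable_add:
  assumes h: "L2_approximable h" and k: "L2_approximable k"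
  shows "L2_approximable (\<lambda>x. h x + k x)"
  unfolding L2_approximable_def
proof (intro conjI allI impI)
  have hm: "h \<in> borel_measurable M" "k \<in> borel_measurable M"
    using h k unfolding L2_approximable_def by auto
  then show "(\<lambda>x. h x + k x) \<in> borel_measurable M" by measurable
  fix e :: real assume e: "e > 0"
  obtain a where a: "continuous_on UNIV a" "integrable M (\<lambda>x. (cmod (h x - a x))\<^sup>2)"
    "(LINT x|M. (cmod (h x - a x))\<^sup>2) < e / 4"
    using h e unfolding L2_approximable_def by (meson divide_pos_pos zero_less_numeral)
  obtain b where b: "continuous_on UNIV b" "integrable M (\<lambda>x. (cmod (k x - b x))\<^sup>2)"
    "(LINT x|M. (cmod (k x - b x))\<^sup>2) < e / 4"
    using k e unfolding L2_approximable_def by (meson divide_pos_pos zero_less_numeral)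
  have abm: "a \<in> borel_measurable M" "b \<in> borel_measurable M"
    using continuous_imp_measurable_borel[OF sets_M] a(1) b(1) by auto
  have le: "(cmod (h x + k x - (a x + b x)))\<^sup>2 \<le> 2 * (cmod (h x - a x))\<^sup>2 + 2 * (cmod (k x - b x))\<^sup>2" for x
    using cmod_add_square_le[of "h x - a x" "k x - b x"] by (simp add: algebra_simps)
  have bi: "integrable M (\<lambda>x. 2 * (cmod (h x - a x))\<^sup>2 + 2 * (cmod (k x - b x))\<^sup>2)"
    using a b by simp
  have int: "integrable M (\<lambda>x. (cmod (h x + k x - (a x + b x)))\<^sup>2)"
    by (rule Bochner_Integration.integrable_bound[OF bi]) (use hm abm le in auto)
  have "(LINT x|M. (cmod (h x + k x - (a x + b x)))\<^sup>2)
      \<le> (LINT x|M. 2 * (cmod (h x - a x))\<^sup>2 + 2 * (cmod (k x - b x))\<^sup>2)"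
    by (intro integral_mono int bi le)
  also have "\<dots> < e" using a b by simp
  finally show "\<exists>g. continuous_on UNIV g \<and> integrable M (\<lambda>x. (cmod (h x + k x - g x))\<^sup>2) \<and>
      (LINT x|M. (cmod (h x + k x - g x))\<^sup>2) < e"
    using a(1) b(1) int by (intro exI[of _ "\<lambda>x. a x + b x"]) (auto intro!: continuous_intros)
qed

lemma L2_approximable_simple:
  assumes "simple_function M h"
  shows "L2_approximable h"
proof -
  have fin: "finite (h ` space M)" using assms by (simp add: simple_function_def)
  have sum: "L2_approximable (\<lambda>x. \<Sum>y\<in>Y. indicator (h -` {y} \<inter> space M) x *\<^sub>R y)"
    if "finite Y" for Y
    using that
  proof (induction Y rule: finite_induct)
    case empty
    show ?case using L2_approximable_indicator[of "{}" 0] by simp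
  next
    case (insert y Y)
    have "h -` {y} \<inter> space M \<in> sets M"
      using assms by (simp add: simple_functionD(2))
    then show ?case
      unfolding sum.insert[OF insert.hyps]
      by (intro L2_approximable_add L2_approximable_indicator insert.IH)
  qed
  have "(\<lambda>x. \<Sum>y\<in>h ` space M. indicator (h -` {y} \<inter> space M) x *\<^sub>R y) = h"
    by (rule ext, rule simple_function_indicator_representation_banach[OF assms, symmetric])
      (simp add: space_M)
  then show ?thesis using sum[OF fin] by (simp only:)
qed

text \<open>Simple functions bounded by 2 |h| converge to h. Their distance to h is at most 3 |h|,
  so 9 |h|^2 is an integrable majorant for dominated convergence.\<close>

lemma L2_imp_approximable:
  assumes h: "h \<in> L2 M"
  shows "L2_approximable h"
proof -
  have hm: "h \<in> borel_measurable M" and hi: "integrable M (\<lambda>x. (cmod (h x))\<^sup>2)"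
    using h unfolding L2_def by auto
  obtain F where F: "\<And>i. simple_function M (F i)" "\<And>x. x \<in> space M \<Longrightarrow> (\<lambda>i. F i x) \<longlonglongrightarrow> h x"
    "\<And>i x. x \<in> space M \<Longrightarrow> dist (F i x) 0 \<le> 2 * dist (h x) 0"
    using borel_measurable_implies_sequence_metric[OF hm, of 0] by metis
  have Fm: "F i \<in> borel_measurable M" for i
    using F(1) borel_measurable_simple_function by blast
  have le: "(cmod (h x - F i x))\<^sup>2 \<le> 9 * (cmod (h x))\<^sup>2" for i x
  proof -
    have "cmod (h x - F i x) \<le> 3 * cmod (h x)"
      using F(3)[of x i] norm_triangle_ineq4[of "h x" "F i x"] space_M by simp
    then have "(cmod (h x - F i x))\<^sup>2 \<le> (3 * cmod (h x))\<^sup>2" by (intro power_mono) auto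
    then show ?thesis by (simp add: power_mult_distrib)
  qed
  have bi: "integrable M (\<lambda>x. 9 * (cmod (h x))\<^sup>2)" using hi by simp
  have int: "integrable M (\<lambda>x. (cmod (h x - F i x))\<^sup>2)" for i
    by (rule Bochner_Integration.integrable_bound[OF bi]) (use hm Fm le in auto)
  have "(\<lambda>i. LINT x|M. (cmod (h x - F i x))\<^sup>2) \<longlonglongrightarrow> (LINT x|M. 0 :: real)"
  proof (rule integral_dominated_convergence[OF _ _ bi])
    show "AE x in M. (\<lambda>i. (cmod (h x - F i x))\<^sup>2) \<longlonglongrightarrow> 0"
    proof (rule AE_I2)
      fix x assume "x \<in> space M"
      then have "(\<lambda>i. (cmod (h x - F i x))\<^sup>2) \<longlonglongrightarrow> (cmod (h x - h x))\<^sup>2"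
        by (intro tendsto_intros F(2))
      then show "(\<lambda>i. (cmod (h x - F i x))\<^sup>2) \<longlonglongrightarrow> 0" by simp
    qed
  qed (use hm Fm le in auto)
  then have "\<exists>i. (LINT x|M. (cmod (h x - F i x))\<^sup>2) < e" if "e > 0" for e
    using that order_tendstoD(2)[of _ 0 sequentially e] by (auto simp: eventually_sequentially)
  then show ?thesis
    using L2_approximable_close[OF hm] L2_approximable_simple[OF F(1)] int by metis
qed

lemma L2_continuous_approx:
  assumes "h \<in> L2 M" "e > 0"
  obtains g where "continuous_on UNIV g" "integrable M (\<lambda>x. (cmod (h x - g x))\<^sup>2)"
    "(LINT x|M. (cmod (h x - g x))\<^sup>2) < e"
  using L2_imp_approximable[OF assms(1)] assms(2) that unfolding L2_approximable_def by blast

section \<open>Estimates for the pairing of square integrable functions\<close>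

lemma integrable_L2_mult:
  fixes a b :: "'m \<Rightarrow> complex"
  assumes a: "a \<in> borel_measurable M" "integrable M (\<lambda>x. (cmod (a x))\<^sup>2)"
    and b: "b \<in> borel_measurable M" "integrable M (\<lambda>x. (cmod (b x))\<^sup>2)"
  shows "integrable M (\<lambda>x. cnj (a x) * b x)"
proof (rule Bochner_Integration.integrable_bound)
  show "integrable M (\<lambda>x. (cmod (a x))\<^sup>2 + (cmod (b x))\<^sup>2)" using a b by simp
  show "(\<lambda>x. cnj (a x) * b x) \<in> borel_measurable M"
  proof -
    have "(\<lambda>x. cnj (a x)) \<in> borel_measurable M"
      by (rule borel_measurable_continuous_on[OF _ a(1)]) (intro continuous_intros)
    then show ?thesis using b(1) by (rule borel_measurable_times)
  qed
  show "AE x in M. norm (cnj (a x) * b x) \<le> norm ((cmod (a x))\<^sup>2 + (cmod (b x))\<^sup>2)"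
  proof (rule AE_I2)
    fix x
    have "cmod (a x) * cmod (b x) \<le> (cmod (a x))\<^sup>2 + (cmod (b x))\<^sup>2"
    proof -
      have "2 * (cmod (a x) * cmod (b x)) \<le> (cmod (a x))\<^sup>2 + (cmod (b x))\<^sup>2"
        using sum_squares_bound[of "cmod (a x)" "cmod (b x)"] by (simp add: mult.assoc)
      moreover have "0 \<le> cmod (a x) * cmod (b x)" by simp
      ultimately show ?thesis by linarith
    qed
    then show "norm (cnj (a x) * b x) \<le> norm ((cmod (a x))\<^sup>2 + (cmod (b x))\<^sup>2)"
      by (simp add: norm_mult)
  qed
qed

lemma L2_integrable:
  assumes "h \<in> L2 M"
  shows "integrable M h"
proof -
  have "integrable M (\<lambda>x. cnj 1 * h x)"
    by (rule integrable_L2_mult) (use assms in \<open>auto simp: L2_def\<close>)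
  then show ?thesis by simp
qed

text \<open>The weighted arithmetic-geometric inequality in place of Cauchy-Schwarz. If one of the
  two squared norms is at most e^2, the weight e or 1 / e yields a bound of order e.\<close>

lemma integral_L2_mult_bound:
  fixes a b :: "'m \<Rightarrow> complex"
  assumes a: "a \<in> borel_measurable M" "integrable M (\<lambda>x. (cmod (a x))\<^sup>2)"
    and b: "b \<in> borel_measurable M" "integrable M (\<lambda>x. (cmod (b x))\<^sup>2)"
    and c: "c > 0"
  shows "2 * cmod (LINT x|M. cnj (a x) * b x) \<le> (LINT x|M. (cmod (a x))\<^sup>2) / c + c * (LINT x|M. (cmod (b x))\<^sup>2)"
proof -
  note i = integrable_L2_mult[OF a b]
  have "2 * (cmod (a x) * cmod (b x)) \<le> (cmod (a x))\<^sup>2 / c + c * (cmod (b x))\<^sup>2" for x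
  proof -
    have "2 * (cmod (a x)) * (c * cmod (b x)) \<le> (cmod (a x))\<^sup>2 + (c * cmod (b x))\<^sup>2"
      by (rule sum_squares_bound)
    then show ?thesis using c by (simp add: field_simps power2_eq_square)
  qed
  then have "(LINT x|M. 2 * cmod (cnj (a x) * b x)) \<le> (LINT x|M. (cmod (a x))\<^sup>2 / c + c * (cmod (b x))\<^sup>2)"
    by (intro integral_mono integrable_mult_right integrable_norm i) (use a b in \<open>auto simp: norm_mult\<close>)
  also have "\<dots> = (LINT x|M. (cmod (a x))\<^sup>2) / c + c * (LINT x|M. (cmod (b x))\<^sup>2)"
    using a b by simp
  finally have le: "(LINT x|M. 2 * cmod (cnj (a x) * b x))
      \<le> (LINT x|M. (cmod (a x))\<^sup>2) / c + c * (LINT x|M. (cmod (b x))\<^sup>2)" .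
  have "2 * cmod (LINT x|M. cnj (a x) * b x) \<le> (LINT x|M. 2 * cmod (cnj (a x) * b x))"
    by simp
  from order_trans[OF this le] show ?thesis .
qed

text \<open>The pairings differ by the integral of \<open>cnj (\<psi> x - a x) * \<eta> x + cnj (a
  x) * (\<eta> x - b x)\<close>. The bound has to depend on \<psi> and \<eta> only, so the norm of a
  is estimated by that of \<psi>.\<close>

lemma correlation_perturbation:
  fixes \<psi> \<eta> a b :: "'m \<Rightarrow> complex"
  assumes m: "\<psi> \<in> L2 M" "\<eta> \<in> L2 M" "a \<in> L2 M" "b \<in> L2 M"
    and e: "0 < e" "e \<le> 1"
    and d: "(LINT x|M. (cmod (\<psi> x - a x))\<^sup>2) \<le> e\<^sup>2" "(LINT x|M. (cmod (\<eta> x - b x))\<^sup>2) \<le> e\<^sup>2"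
    and di: "integrable M (\<lambda>x. (cmod (\<psi> x - a x))\<^sup>2)" "integrable M (\<lambda>x. (cmod (\<eta> x - b x))\<^sup>2)"
  shows "2 * cmod ((LINT x|M. cnj (\<psi> x) * \<eta> x) - (LINT x|M. cnj (a x) * b x))
    \<le> e * (4 + (LINT x|M. (cmod (\<eta> x))\<^sup>2) + 2 * (LINT x|M. (cmod (\<psi> x))\<^sup>2))"
proof -
  let ?n = "\<lambda>h. LINT x|M. (cmod (h x))\<^sup>2"
  have mm: "\<psi> \<in> borel_measurable M" "\<eta> \<in> borel_measurable M" "a \<in> borel_measurable M" "b \<in> borel_measurable M"
    and ii: "integrable M (\<lambda>x. (cmod (\<psi> x))\<^sup>2)" "integrable M (\<lambda>x. (cmod (\<eta> x))\<^sup>2)"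
      "integrable M (\<lambda>x. (cmod (a x))\<^sup>2)" "integrable M (\<lambda>x. (cmod (b x))\<^sup>2)"
    using m unfolding L2_def by auto
  have dm: "(\<lambda>x. \<psi> x - a x) \<in> borel_measurable M" "(\<lambda>x. \<eta> x - b x) \<in> borel_measurable M"
    using mm by measurable
  have i: "integrable M (\<lambda>x. cnj (\<psi> x - a x) * \<eta> x)" "integrable M (\<lambda>x. cnj (a x) * (\<eta> x - b x))"
    "integrable M (\<lambda>x. cnj (\<psi> x) * \<eta> x)" "integrable M (\<lambda>x. cnj (a x) * b x)"
    using integrable_L2_mult[OF dm(1) di(1) mm(2) ii(2)] integrable_L2_mult[OF mm(3) ii(3) dm(2) di(2)]
      integrable_L2_mult[OF mm(1) ii(1) mm(2) ii(2)] integrable_L2_mult[OF mm(3) ii(3) mm(4) ii(4)] by auto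
  have na: "?n a \<le> 2 * ?n \<psi> + 2"
  proof -
    have "(cmod (a x))\<^sup>2 \<le> 2 * (cmod (\<psi> x))\<^sup>2 + 2 * (cmod (\<psi> x - a x))\<^sup>2" for x
      using cmod_add_square_le[of "\<psi> x" "a x - \<psi> x"] by (simp add: norm_minus_commute)
    then have "?n a \<le> (LINT x|M. 2 * (cmod (\<psi> x))\<^sup>2 + 2 * (cmod (\<psi> x - a x))\<^sup>2)"
      using ii di by (intro integral_mono) auto
    also have "\<dots> = 2 * ?n \<psi> + 2 * (LINT x|M. (cmod (\<psi> x - a x))\<^sup>2)" using ii di by simp
    also have "(LINT x|M. (cmod (\<psi> x - a x))\<^sup>2) \<le> 1"
      using d(1) power_le_one[of e 2] e by linarith
    finally show ?thesis by simp
  qed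
  have 1: "2 * cmod (LINT x|M. cnj (\<psi> x - a x) * \<eta> x) \<le> e + e * ?n \<eta>"
  proof -
    have "2 * cmod (LINT x|M. cnj (\<psi> x - a x) * \<eta> x) \<le> (LINT x|M. (cmod (\<psi> x - a x))\<^sup>2) / e + e * ?n \<eta>"
      by (rule integral_L2_mult_bound[OF dm(1) di(1) mm(2) ii(2) e(1)])
    also have "(LINT x|M. (cmod (\<psi> x - a x))\<^sup>2) / e \<le> e"
      using d(1) e by (simp add: pos_divide_le_eq power2_eq_square)
    finally show ?thesis by simp
  qed
  have 2: "2 * cmod (LINT x|M. cnj (a x) * (\<eta> x - b x)) \<le> e * ?n a + e"
  proof -
    have "2 * cmod (LINT x|M. cnj (a x) * (\<eta> x - b x)) \<le> ?n a / (1 / e) + (1 / e) * (LINT x|M. (cmod (\<eta> x - b x))\<^sup>2)"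
      by (rule integral_L2_mult_bound[OF mm(3) ii(3) dm(2) di(2)]) (use e in simp)
    also have "(1 / e) * (LINT x|M. (cmod (\<eta> x - b x))\<^sup>2) \<le> e"
      using d(2) e by (simp add: pos_divide_le_eq power2_eq_square)
    finally show ?thesis by (simp add: mult.commute)
  qed
  have "(LINT x|M. cnj (\<psi> x) * \<eta> x) - (LINT x|M. cnj (a x) * b x)
      = (LINT x|M. cnj (\<psi> x - a x) * \<eta> x + cnj (a x) * (\<eta> x - b x))"
    using i by (subst Bochner_Integration.integral_diff[symmetric]) (auto simp: algebra_simps)
  also have "\<dots> = (LINT x|M. cnj (\<psi> x - a x) * \<eta> x) + (LINT x|M. cnj (a x) * (\<eta> x - b x))"
    by (rule Bochner_Integration.integral_add[OF i(1,2)])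
  finally have eq: "(LINT x|M. cnj (\<psi> x) * \<eta> x) - (LINT x|M. cnj (a x) * b x)
      = (LINT x|M. cnj (\<psi> x - a x) * \<eta> x) + (LINT x|M. cnj (a x) * (\<eta> x - b x))" .
  have "2 * cmod ((LINT x|M. cnj (\<psi> x) * \<eta> x) - (LINT x|M. cnj (a x) * b x))
      \<le> 2 * cmod (LINT x|M. cnj (\<psi> x - a x) * \<eta> x) + 2 * cmod (LINT x|M. cnj (a x) * (\<eta> x - b x))"
    unfolding eq distrib_left[symmetric] by (intro mult_left_mono norm_triangle_ineq) simp
  also have "\<dots> \<le> (e + e * ?n \<eta>) + (e * (2 * ?n \<psi> + 2) + e)"
    using 1 2 mult_left_mono[OF na, of e] e by linarith
  also have "\<dots> = e * (4 + ?n \<eta> + 2 * ?n \<psi>)" by (simp add: algebra_simps)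
  finally show ?thesis .
qed

lemma continuous_L2:
  assumes "continuous_on UNIV h"
  shows "h \<in> L2 M"
  unfolding L2_def using assms continuous_imp_measurable_borel[OF sets_M assms]
  by (auto intro!: continuous_integrable continuous_intros)

end


section \<open>The mean ergodic theorem for a uniquely ergodic flow\<close>

text \<open>An antiderivative on the whole line turns orbit integrals into differences of values,
  which handles shifts by negative times without oriented integrals.\<close>

lemma continuous_antiderivative:
  fixes k :: "real \<Rightarrow> real"
  assumes "continuous_on UNIV k"
  obtains H where "\<And>r. (H has_real_derivative k r) (at r)"
proof -
  have "\<exists>H. \<forall>r::real. (-\<infinity>::ereal) < ereal r \<longrightarrow> ereal r < \<infinity> \<longrightarrow> (H has_vector_derivative k r) (at r)"
    by (rule einterval_antiderivative)
      (use assms in \<open>auto simp: continuous_on_eq_continuous_at\<close>)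
  then show thesis
    using that by (auto simp: has_real_derivative_iff_has_vector_derivative)
qed

lemma antiderivative_integral:
  fixes k :: "real \<Rightarrow> real"
  assumes "\<And>r. (H has_real_derivative k r) (at r)" "a \<le> b"
  shows "integral {a..b} k = H b - H a"
  using assms
  by (intro integral_unique fundamental_theorem_of_calculus)
    (auto simp: has_real_derivative_iff_has_vector_derivative[symmetric] intro: has_field_derivative_at_within)

lemma antiderivative_lipschitz:
  fixes k :: "real \<Rightarrow> real"
  assumes "\<And>r. (H has_real_derivative k r) (at r)" "\<And>r. \<bar>k r\<bar> \<le> K"
  shows "\<bar>H b - H a\<bar> \<le> K * \<bar>b - a\<bar>"
  using field_differentiable_bound[of UNIV H k K b a] assms by simp

lemma square_le_perturb:
  fixes a b K c :: real
  assumes "\<bar>a\<bar> \<le> K" "\<bar>b\<bar> \<le> K" "\<bar>a - b\<bar> \<le> c"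
  shows "a\<^sup>2 \<le> b\<^sup>2 + 2 * K * c"
proof -
  have "a\<^sup>2 - b\<^sup>2 = (a - b) * (a + b)" by (simp add: algebra_simps power2_eq_square)
  also have "\<dots> \<le> \<bar>a - b\<bar> * \<bar>a + b\<bar>" by (metis abs_ge_self abs_mult)
  also have "\<dots> \<le> c * (2 * K)" using assms by (intro mult_mono) auto
  finally show ?thesis by (simp add: algebra_simps)
qed

locale uniquely_ergodic_flow = compact_borel_probability M for M :: "'m::metric_space measure" +
  fixes \<phi> :: "real \<Rightarrow> 'm \<Rightarrow> 'm"
  assumes flow: "continuous_flow \<phi>"
    and unique: "unique_invariant_probability \<phi> M"
begin

definition avg :: "('m \<Rightarrow> real) \<Rightarrow> real \<Rightarrow> 'm \<Rightarrow> real" where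
  "avg h S x = integral {0..S} (\<lambda>r. h (\<phi> r x)) / S"

lemma flow_0 [simp]: "\<phi> 0 x = x"
  and flow_add: "\<phi> (s + t) x = \<phi> s (\<phi> t x)"
  and flow_joint: "continuous_on UNIV (\<lambda>(r, x). \<phi> r x)"
  using flow unfolding continuous_flow_def by auto

lemma flow_continuous: "continuous_on UNIV (\<phi> r)"
  using continuous_on_curry(2)[OF flow_joint] .

lemma flow_measurable: "\<phi> r \<in> measurable M borel"
  by (rule continuous_imp_measurable_borel[OF sets_M flow_continuous])

lemma comp_flow_joint:
  assumes "continuous_on UNIV h"
  shows "continuous_on UNIV (\<lambda>(r, x). h (\<phi> r x))"
  using continuous_on_compose2[OF assms flow_joint] by (simp add: split_beta)

lemma comp_flow_continuous:
  assumes "continuous_on UNIV h"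
  shows "continuous_on UNIV (\<lambda>r. h (\<phi> r x))" "continuous_on UNIV (\<lambda>x. h (\<phi> r x))"
  using continuous_on_curry[OF comp_flow_joint[OF assms]] by auto

lemma distr_flow: "distr M borel (\<phi> r) = M"
  using unique unfolding unique_invariant_probability_def invariant_probability_def by blast

lemma integral_flow:
  fixes h :: "'m \<Rightarrow> 'b::{banach, second_countable_topology}"
  assumes "h \<in> borel_measurable M"
  shows "(LINT x|M. h (\<phi> r x)) = (LINT x|M. h x)"
proof -
  have "h \<in> borel_measurable borel" using assms measurable_cong_sets[OF sets_M refl] by blast
  then have "(LINT x|M. h (\<phi> r x)) = (LINT x|distr M borel (\<phi> r). h x)"
    by (intro integral_distr[symmetric] flow_measurable)
  then show ?thesis by (simp add: distr_flow)
qed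

lemma avg_continuous: "continuous_on UNIV h \<Longrightarrow> continuous_on UNIV (avg h S)"
  unfolding avg_def divide_inverse
  by (intro continuous_on_mult continuous_on_const integral_swap_param(2) comp_flow_joint)

lemma integral_avg:
  assumes "continuous_on UNIV h" "S > 0"
  shows "(LINT x|M. avg h S x) = (LINT x|M. h x)"
proof -
  have "(LINT x|M. avg h S x) = (LINT x|M. integral {0..S} (\<lambda>r. h (\<phi> r x))) / S"
    by (simp add: avg_def)
  also have "(LINT x|M. integral {0..S} (\<lambda>r. h (\<phi> r x))) = integral {0..S} (\<lambda>r. LINT x|M. h (\<phi> r x))"
    by (intro integral_swap_param(1) comp_flow_joint assms)
  also have "\<dots> = S * (LINT x|M. h x)"
    using assms by (simp add: integral_flow continuous_imp_measurable_borel[OF sets_M])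
  finally show ?thesis using assms by simp
qed

text \<open>The windows [t, S + t] and [0, S] differ in two pieces of length |t|, so long averages
  are almost invariant.\<close>

lemma avg_shift:
  assumes "continuous_on UNIV h" "\<And>x. \<bar>h x\<bar> \<le> K" "S > 0"
  shows "\<bar>avg h S x\<bar> \<le> K" "\<bar>avg h S (\<phi> t x) - avg h S x\<bar> \<le> 2 * K * \<bar>t\<bar> / S"
proof -
  obtain H where H: "\<And>r. (H has_real_derivative h (\<phi> r x)) (at r)"
    using continuous_antiderivative[OF comp_flow_continuous(1)[OF assms(1)]] by blast
  note lip = antiderivative_lipschitz[OF H assms(2)]
  have 1: "avg h S x = (H S - H 0) / S"
    unfolding avg_def using antiderivative_integral[OF H] assms(3) by simp
  then show "\<bar>avg h S x\<bar> \<le> K"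
    using lip[of S 0] assms(3) by (simp add: pos_divide_le_eq)
  have "((\<lambda>r. H (r + t)) has_real_derivative h (\<phi> r (\<phi> t x))) (at r)" for r
    using H[of "r + t"] by (simp add: DERIV_shift flow_add)
  then have 2: "avg h S (\<phi> t x) = (H (S + t) - H t) / S"
    unfolding avg_def using antiderivative_integral[of "\<lambda>r. H (r + t)"] assms(3) by simp
  have "avg h S (\<phi> t x) - avg h S x = ((H (S + t) - H S) - (H t - H 0)) / S"
    unfolding 1 2 by (simp add: diff_divide_distrib)
  then have "\<bar>avg h S (\<phi> t x) - avg h S x\<bar> = \<bar>(H (S + t) - H S) - (H t - H 0)\<bar> / S"
    using assms(3) by simp
  also have "\<dots> \<le> 2 * K * \<bar>t\<bar> / S"
    using lip[of "S + t" S] lip[of t 0] assms(3) by (intro divide_right_mono) auto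
  finally show "\<bar>avg h S (\<phi> t x) - avg h S x\<bar> \<le> 2 * K * \<bar>t\<bar> / S" .
qed

text \<open>Interchanging the integrals writes the double average as a mean of
  \<open>avg h R (\<phi> q x)\<close> over q in [0, S], and each of these is close to
  \<open>avg h R x\<close> by \<open>avg_shift\<close>. A long average hardly notices that the
  function was first averaged over a shorter time.\<close>

lemma avg_avg:
  assumes h: "continuous_on UNIV h" "\<And>x. \<bar>h x\<bar> \<le> K" and S: "S > 0" and R: "R > 0"
  shows "\<bar>avg (avg h S) R x - avg h R x\<bar> \<le> 2 * K * S / R"
proof -
  have K: "K \<ge> 0" using h(2) abs_ge_zero order_trans by blast
  have c: "continuous_on UNIV (\<lambda>(r, q). h (\<phi> (q + r) x))"
    using continuous_on_compose2[OF comp_flow_continuous(1)[OF h(1), of x], of UNIV "\<lambda>p. snd p + fst p",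
        OF continuous_on_add[OF continuous_on_snd[OF continuous_on_id] continuous_on_fst[OF continuous_on_id]]]
    by (simp add: split_beta)
  have "avg (avg h S) R x = integral {0..R} (\<lambda>r. integral {0..S} (\<lambda>q. h (\<phi> (q + r) x))) / S / R"
    unfolding avg_def by (simp add: flow_add)
  also have "integral {0..R} (\<lambda>r. integral {0..S} (\<lambda>q. h (\<phi> (q + r) x)))
      = integral {0..S} (\<lambda>q. integral {0..R} (\<lambda>r. h (\<phi> (q + r) x)))"
    using integral_swap_continuous[of 0 0 R S "\<lambda>r q. h (\<phi> (q + r) x)"] continuous_on_subset[OF c]
    by simp
  also have "\<dots> / S / R = integral {0..S} (\<lambda>q. avg h R (\<phi> q x)) / S"
    using R by (simp add: avg_def flow_add[symmetric] add.commute)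
  finally have eq: "avg (avg h S) R x = integral {0..S} (\<lambda>q. avg h R (\<phi> q x)) / S" .
  have int: "(\<lambda>q. avg h R (\<phi> q x)) integrable_on {0..S}"
    using comp_flow_continuous(1)[OF avg_continuous[OF h(1)]] continuous_on_subset
    by (intro integrable_continuous_real) blast
  have "integral {0..S} (\<lambda>q. avg h R (\<phi> q x)) - S * avg h R x
      = integral {0..S} (\<lambda>q. avg h R (\<phi> q x) - avg h R x)"
    using S int by (subst integral_diff) auto
  also have "\<bar>\<dots>\<bar> \<le> 2 * K * S / R * (S - 0)"
    unfolding real_norm_def[symmetric]
  proof (rule integral_bound)
    show "continuous_on {0..S} (\<lambda>q. avg h R (\<phi> q x) - avg h R x)"
      using comp_flow_continuous(1)[OF avg_continuous[OF h(1)]] continuous_on_subset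
      by (intro continuous_intros) blast
    fix q assume q: "q \<in> {0..S}"
    have "\<bar>avg h R (\<phi> q x) - avg h R x\<bar> \<le> 2 * K * \<bar>q\<bar> / R"
      using avg_shift(2)[OF h R] .
    also have "\<dots> \<le> 2 * K * S / R"
      using q K R by (intro divide_right_mono mult_left_mono) auto
    finally show "norm (avg h R (\<phi> q x) - avg h R x) \<le> 2 * K * S / R" by simp
  qed (use S in simp)
  finally show ?thesis
    unfolding eq using S by (simp add: field_simps abs_le_iff)
qed

text \<open>Jensen's inequality along each orbit, obtained by expanding the square of
  \<open>g (\<phi> r x) - avg g R x\<close>, followed by invariance of the measure.\<close>

lemma avg_square_contraction:
  assumes g: "continuous_on UNIV g" and R: "R > 0"
  shows "(LINT x|M. (avg g R x)\<^sup>2) \<le> (LINT x|M. (g x)\<^sup>2)"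
proof -
  have g2: "continuous_on UNIV (\<lambda>x. (g x)\<^sup>2)" using g by (intro continuous_intros)
  have "(avg g R x)\<^sup>2 \<le> avg (\<lambda>x. (g x)\<^sup>2) R x" for x
  proof -
    let ?a = "avg g R x"
    have i1: "(\<lambda>r. g (\<phi> r x)) integrable_on {0..R}"
      using comp_flow_continuous(1)[OF g] continuous_on_subset
      by (intro integrable_continuous_real) blast
    have i2: "(\<lambda>r. (g (\<phi> r x))\<^sup>2) integrable_on {0..R}"
      using comp_flow_continuous(1)[OF g2] continuous_on_subset
      by (intro integrable_continuous_real) blast
    have Ra: "integral {0..R} (\<lambda>r. g (\<phi> r x)) = R * ?a" using R by (simp add: avg_def)
    have "0 \<le> integral {0..R} (\<lambda>r. (g (\<phi> r x))\<^sup>2 - 2 * ?a * g (\<phi> r x) + ?a\<^sup>2)"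
    proof (rule integral_nonneg)
      show "(\<lambda>r. (g (\<phi> r x))\<^sup>2 - 2 * ?a * g (\<phi> r x) + ?a\<^sup>2) integrable_on {0..R}"
        by (intro integrable_add integrable_diff i1 i2 integrable_on_mult_right) auto
      show "0 \<le> (g (\<phi> r x))\<^sup>2 - 2 * ?a * g (\<phi> r x) + ?a\<^sup>2" for r
        using zero_le_power2[of "g (\<phi> r x) - ?a"] by (simp add: power2_diff algebra_simps)
    qed
    also have "\<dots> = integral {0..R} (\<lambda>r. (g (\<phi> r x))\<^sup>2) - 2 * ?a * (R * ?a) + R * ?a\<^sup>2"
    proof (rule integral_unique, intro has_integral_add has_integral_diff has_integral_mult_right)
      show "((\<lambda>r. (g (\<phi> r x))\<^sup>2) has_integral integral {0..R} (\<lambda>r. (g (\<phi> r x))\<^sup>2)) {0..R}"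
        using i2 by (rule integrable_integral)
      show "((\<lambda>r. g (\<phi> r x)) has_integral R * ?a) {0..R}"
        using i1 unfolding Ra[symmetric] by (rule integrable_integral)
      show "((\<lambda>r. ?a\<^sup>2) has_integral R * ?a\<^sup>2) {0..R}"
        using has_integral_const_real[of "?a\<^sup>2" 0 R] R by simp
    qed
    finally have "R * ?a\<^sup>2 \<le> integral {0..R} (\<lambda>r. (g (\<phi> r x))\<^sup>2)"
      by (simp add: power2_eq_square algebra_simps)
    then show ?thesis using R by (simp add: avg_def[of "\<lambda>x. (g x)\<^sup>2"] field_simps)
  qed
  moreover have "continuous_on UNIV (\<lambda>x. (avg g R x)\<^sup>2)"
    using avg_continuous[OF g] by (intro continuous_intros)
  ultimately have "(LINT x|M. (avg g R x)\<^sup>2) \<le> (LINT x|M. avg (\<lambda>x. (g x)\<^sup>2) R x)"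
    by (intro integral_mono continuous_integrable avg_continuous g2)
  then show ?thesis using integral_avg[OF g2 R] by simp
qed

text \<open>Unique ergodicity enters here: adding a constant to \<open>g\<close> gives the density of another
  invariant measure.\<close>

lemma invariant_square_integral_zero:
  fixes g :: "'m \<Rightarrow> real"
  assumes gm: "g \<in> borel_measurable M" and gK: "\<And>x. \<bar>g x\<bar> \<le> K"
    and ginv: "\<And>t x. g (\<phi> t x) = g x" and g0: "(LINT x|M. g x) = 0"
  shows "(LINT x|M. (g x)\<^sup>2) = 0"
proof -
  have K: "K \<ge> 0" using gK abs_ge_zero order_trans by blast
  \<comment> \<open>The shift by K + 1 makes the density nonnegative, the vanishing mean of g makes
    its integral 1, and the divisor is positive even if K = 0.\<close>
  define d where "d x = (g x + K + 1) / (K + 1)" for x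
  have dm: "d \<in> borel_measurable M" unfolding d_def using gm by measurable
  have d0: "d x \<ge> 0" for x
    unfolding d_def using gK[of x] K by (intro divide_nonneg_nonneg) (auto simp: abs_le_iff)
  have gi: "integrable M g"
    using gm gK by (intro integrable_const_bound[of _ K]) auto
  have gi2: "integrable M (\<lambda>x. (g x)\<^sup>2)"
  proof (rule integrable_const_bound[of _ "K\<^sup>2"])
    show "AE x in M. norm ((g x)\<^sup>2) \<le> K\<^sup>2"
      using gK K by (auto simp: abs_le_square_iff[symmetric])
  qed (use gm in measurable)
  have di: "integrable M d" unfolding d_def using gi by simp
  have d1: "(LINT x|M. d x) = 1" unfolding d_def using gi g0 K by (simp add: prob_space)
  define N where "N = density M (\<lambda>x. ennreal (d x))"
  have setsN: "sets N = sets borel" unfolding N_def by (simp add: sets_M)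
  have "emeasure N (space N) = ennreal (LINT x|M. d x)"
    unfolding N_def using dm d0 di
    by (simp add: emeasure_density nn_integral_eq_integral cong: nn_integral_cong)
  then have probN: "prob_space N" using d1 by (intro prob_spaceI) simp
  have "distr N borel (\<phi> t) = N" for t
  proof (rule measure_eqI)
    fix B assume "B \<in> sets (distr N borel (\<phi> t))"
    then have B: "B \<in> sets borel" by simp
    then have BM: "B \<in> sets M" by (simp add: sets_M)
    have fN: "\<phi> t \<in> measurable N borel"
      using flow_measurable measurable_cong_sets[OF setsN refl] measurable_cong_sets[OF sets_M refl] by blast
    have pB: "\<phi> t -` B \<in> sets M"
      using measurable_sets[OF flow_measurable B] by (simp add: space_M)
    have db: "(\<lambda>x. ennreal (d x) * indicator B x) \<in> borel_measurable borel"
    proof -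
      have "d \<in> borel_measurable borel" using dm measurable_cong_sets[OF sets_M refl] by blast
      then show ?thesis using B by measurable
    qed
    have "emeasure (distr N borel (\<phi> t)) B = emeasure N (\<phi> t -` B)"
      using emeasure_distr[OF fN B] by (simp add: N_def space_M)
    also have "\<dots> = (\<integral>\<^sup>+x. ennreal (d x) * indicator (\<phi> t -` B) x \<partial>M)"
      unfolding N_def using dm pB by (intro emeasure_density) measurable
    also have "\<dots> = (\<integral>\<^sup>+x. ennreal (d (\<phi> t x)) * indicator B (\<phi> t x) \<partial>M)"
      by (intro nn_integral_cong) (auto simp: d_def ginv indicator_def)
    also have "\<dots> = (\<integral>\<^sup>+x. ennreal (d x) * indicator B x \<partial>distr M borel (\<phi> t))"
      using db by (intro nn_integral_distr[symmetric] flow_measurable) auto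
    also have "\<dots> = emeasure N B"
      unfolding distr_flow N_def using dm BM by (intro emeasure_density[symmetric]) measurable
    finally show "emeasure (distr N borel (\<phi> t)) B = emeasure N B" .
  qed (simp add: setsN)
  then have "invariant_probability \<phi> N"
    unfolding invariant_probability_def using probN setsN by blast
  then have NM: "N = M"
    using unique unfolding unique_invariant_probability_def by blast
  \<comment> \<open>Testing the equality N = M with g itself leaves only the square of g, since the
    linear term has integral 0.\<close>
  have "(LINT x|N. g x) = (LINT x|M. d x *\<^sub>R g x)"
    unfolding N_def using gm dm d0 by (intro integral_density) auto
  also have "\<dots> = (LINT x|M. ((g x)\<^sup>2 + (K + 1) * g x) / (K + 1))"
    by (intro Bochner_Integration.integral_cong) (auto simp: d_def power2_eq_square algebra_simps)
  also have "\<dots> = (LINT x|M. (g x)\<^sup>2) / (K + 1)"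
    using gi gi2 g0 by simp
  finally show ?thesis using NM g0 K by simp
qed

text \<open>Riesz' argument: the averages have asymptotically minimal norm among convex combinations of
  translates of \<open>h\<close>, so by the parallelogram law they form a Cauchy sequence.\<close>

lemma mean_ergodic_square:
  assumes h: "continuous_on UNIV h" and h0: "(LINT x|M. h x) = 0"
  shows "((\<lambda>S. LINT x|M. (avg h S x)\<^sup>2) \<longlongrightarrow> 0) at_top"
proof -
  obtain K where K: "K > 0" "\<And>x. \<bar>h x\<bar> \<le> K"
    using compact_continuous_bounded[OF compact_UNIV h] by auto
  define a where "a S = (LINT x|M. (avg h S x)\<^sup>2)" for S
  have ac: "continuous_on UNIV (avg h S)" for S by (rule avg_continuous[OF h])
  have abd: "\<bar>avg h S x\<bar> \<le> K" if "S > 0" for S x by (rule avg_shift(1)[OF h K(2) that])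
  have sqi: "integrable M (\<lambda>x. (g x)\<^sup>2)" if "continuous_on UNIV g" for g :: "'m \<Rightarrow> real"
    using that by (intro continuous_integrable continuous_intros)
  have pert: "(LINT x|M. (g x)\<^sup>2) \<le> (LINT x|M. (g' x)\<^sup>2) + 2 * K * c"
    if "continuous_on UNIV g" "continuous_on UNIV g'" "\<And>x. \<bar>g x\<bar> \<le> K" "\<And>x. \<bar>g' x\<bar> \<le> K"
      "\<And>x. \<bar>g x - g' x\<bar> \<le> c" for g g' :: "'m \<Rightarrow> real" and c
  proof -
    have "(LINT x|M. (g x)\<^sup>2) \<le> (LINT x|M. (g' x)\<^sup>2 + 2 * K * c)"
      using that sqi by (intro integral_mono square_le_perturb) auto
    then show ?thesis using sqi[OF that(2)] by (simp add: prob_space)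
  qed
  \<comment> \<open>The long average of h is close to that of \<open>avg h S\<close>, whose norm
    does not exceed the norm of \<open>avg h S\<close>. Hence a eventually drops to within any
    margin of each of its values, and so it converges to its infimum.\<close>
  have A: "a R \<le> a S + 4 * K\<^sup>2 * S / R" if "S > 0" "R > 0" for S R
  proof -
    have "a R \<le> (LINT x|M. (avg (avg h S) R x)\<^sup>2) + 2 * K * (2 * K * S / R)"
      unfolding a_def
    proof (rule pert)
      show "\<bar>avg (avg h S) R x\<bar> \<le> K" for x
        using avg_shift(1)[OF ac abd[OF that(1)] that(2)] .
      show "\<bar>avg h R x - avg (avg h S) R x\<bar> \<le> 2 * K * S / R" for x
        using avg_avg[OF h K(2) that] by (simp add: abs_minus_commute)
    qed (use ac avg_continuous abd that in auto)
    also have "(LINT x|M. (avg (avg h S) R x)\<^sup>2) \<le> a S"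
      unfolding a_def by (rule avg_square_contraction[OF ac that(2)])
    finally show ?thesis by (simp add: power2_eq_square algebra_simps)
  qed
  have a0: "a S \<ge> 0" for S unfolding a_def by simp
  define m where "m = Inf (a ` {0<..})"
  have bdd: "bdd_below (a ` {0<..})" using a0 by (intro bdd_belowI2[of _ 0]) auto
  have ma: "m \<le> a S" if "S > 0" for S
    unfolding m_def using bdd that by (intro cInf_lower) auto
  have alim: "(a \<longlongrightarrow> m) at_top"
  proof (rule tendstoI)
    fix e :: real assume e: "e > 0"
    have "\<exists>y\<in>a ` {0<..}. y < m + e / 2"
      using cInf_lessD[of "a ` {0<..}" "m + e / 2"] e unfolding m_def by auto
    then obtain S where S: "S > 0" "a S < m + e / 2" by auto
    have "((\<lambda>R. 4 * K\<^sup>2 * S / R) \<longlongrightarrow> 0) at_top"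
      by (intro tendsto_divide_0[OF tendsto_const] filterlim_at_top_imp_at_infinity filterlim_ident)
    then have "\<forall>\<^sub>F R in at_top. 4 * K\<^sup>2 * S / R < e / 2"
      using e by (intro order_tendstoD(2)) auto
    then show "\<forall>\<^sub>F R in at_top. dist (a R) m < e"
      using eventually_gt_at_top[of 0]
    proof eventually_elim
      case (elim R)
      then show ?case using A[OF S(1), of R] S(2) ma[of R] by (simp add: dist_real_def abs_less_iff)
    qed
  qed
  \<comment> \<open>The midpoint g of two averages also has long averages close to those of h, so
    its squared norm is at least m; the parallelogram law then bounds the distance of the
    two.\<close>
  have B: "(LINT x|M. (avg h S x - avg h T x)\<^sup>2) \<le> 2 * (a S + a T - 2 * m)"
    if ST: "S > 0" "T > 0" for S T
  proof -
    define g where "g x = (avg h S x + avg h T x) / 2" for x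
    have gc: "continuous_on UNIV g" unfolding g_def using ac by (intro continuous_intros) auto
    have gK: "\<bar>g x\<bar> \<le> K" for x
      using abd[OF ST(1), of x] abd[OF ST(2), of x] unfolding g_def by (auto simp: abs_le_iff)
    have "m \<le> (LINT x|M. (g x)\<^sup>2) + 4 * K\<^sup>2 * (S + T) / R" if R: "R > 0" for R
    proof -
      have "avg g R x = (avg (avg h S) R x + avg (avg h T) R x) / 2" for x
      proof -
        have i: "(\<lambda>r. avg h S (\<phi> r x)) integrable_on {0..R}" for S
          using comp_flow_continuous(1)[OF ac] continuous_on_subset
          by (intro integrable_continuous_real) blast
        have "integral {0..R} (\<lambda>r. g (\<phi> r x)) = (integral {0..R} (\<lambda>r. avg h S (\<phi> r x))
            + integral {0..R} (\<lambda>r. avg h T (\<phi> r x))) / 2"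
          unfolding g_def using integral_add[OF i i, of S T] by simp
        then show ?thesis unfolding avg_def[of _ R] by (simp add: add_divide_distrib)
      qed
      then have d: "\<bar>avg h R x - avg g R x\<bar> \<le> 2 * K * (S + T) / R" for x
      proof -
        have "\<bar>avg h R x - avg g R x\<bar> \<le> 2 * K * S / R + 2 * K * T / R"
        proof -
          have "\<bar>w - (u + v) / 2\<bar> \<le> p + q" if "\<bar>u - w\<bar> \<le> p" "\<bar>v - w\<bar> \<le> q" for u v w p q :: real
            using that unfolding abs_le_iff by (auto simp: field_simps)
          then show ?thesis
            unfolding \<open>avg g R x = (avg (avg h S) R x + avg (avg h T) R x) / 2\<close>
            using avg_avg[OF h K(2) ST(1) R, of x] avg_avg[OF h K(2) ST(2) R, of x] by blast
        qed
        then show ?thesis by (simp add: algebra_simps add_divide_distrib)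
      qed
      have "m \<le> a R" by (rule ma[OF R])
      also have "a R \<le> (LINT x|M. (avg g R x)\<^sup>2) + 2 * K * (2 * K * (S + T) / R)"
        unfolding a_def using d by (intro pert ac avg_continuous gc abd R avg_shift(1)[OF gc gK R])
      also have "(LINT x|M. (avg g R x)\<^sup>2) \<le> (LINT x|M. (g x)\<^sup>2)"
        by (rule avg_square_contraction[OF gc R])
      finally show ?thesis by (simp add: power2_eq_square algebra_simps)
    qed
    moreover have "((\<lambda>R. (LINT x|M. (g x)\<^sup>2) + 4 * K\<^sup>2 * (S + T) / R) \<longlongrightarrow> (LINT x|M. (g x)\<^sup>2) + 0) at_top"
      by (intro tendsto_add tendsto_const tendsto_divide_0[OF tendsto_const]
          filterlim_at_top_imp_at_infinity filterlim_ident)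
    ultimately have mg: "m \<le> (LINT x|M. (g x)\<^sup>2)"
      by (intro tendsto_lowerbound[where F = at_top, of _ _ m])
        (auto intro: eventually_mono[OF eventually_gt_at_top[of 0]])
    have "(avg h S x - avg h T x)\<^sup>2 = 2 * (avg h S x)\<^sup>2 + 2 * (avg h T x)\<^sup>2 - 4 * (g x)\<^sup>2" for x
      unfolding g_def by (simp add: power2_eq_square field_simps)
    then have "(LINT x|M. (avg h S x - avg h T x)\<^sup>2) = 2 * a S + 2 * a T - 4 * (LINT x|M. (g x)\<^sup>2)"
      unfolding a_def using sqi[OF ac] sqi[OF gc] by simp
    then show ?thesis using mg by simp
  qed
  define f where "f n x = avg h (real (Suc n)) x" for n x
  have fc: "continuous_on UNIV (f n)" for n unfolding f_def by (rule ac)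
  have fm: "f n \<in> borel_measurable M" for n by (rule continuous_imp_measurable_borel[OF sets_M fc])
  have fb: "\<bar>f n x\<bar> \<le> K" for n x unfolding f_def by (rule abd) simp
  have alim_nat: "(\<lambda>n. a (real (Suc n))) \<longlonglongrightarrow> m"
    by (rule filterlim_compose[OF alim])
      (rule filterlim_compose[OF filterlim_real_sequentially filterlim_Suc])
  \<comment> \<open>The bound |y| \<le> y^2 / (2 e) + e / 2 passes from L2 to L1, where a
    subsequence that is Cauchy almost everywhere can be extracted.\<close>
  have cauchy: "\<exists>N. \<forall>i\<ge>N. \<forall>j\<ge>N. (LINT x|M. norm (f i x - f j x)) < e" if e: "e > 0" for e
  proof -
    have "\<forall>\<^sub>F n in sequentially. a (real (Suc n)) < m + e\<^sup>2 / 8"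
      using alim_nat e by (intro order_tendstoD(2)) auto
    then obtain N where N: "\<And>n. n \<ge> N \<Longrightarrow> a (real (Suc n)) < m + e\<^sup>2 / 8"
      by (auto simp: eventually_sequentially)
    have "(LINT x|M. norm (f i x - f j x)) < e" if "i \<ge> N" "j \<ge> N" for i j
    proof -
      have pos: "real (Suc n) > 0" for n by simp
      have aux: "X < E" if "X \<le> 2 * (p + q - 2 * m)" "p < m + E / 8" "q < m + E / 8" "0 < E"
        for X p q E :: real
        using that by (simp add: field_simps)
      have dc: "continuous_on UNIV (\<lambda>x. f i x - f j x)" by (intro continuous_intros fc)
      have "norm (f i x - f j x) \<le> (f i x - f j x)\<^sup>2 / (2 * e) + e / 2" for x
      proof -
        have "2 * e * \<bar>f i x - f j x\<bar> \<le> (f i x - f j x)\<^sup>2 + e\<^sup>2"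
          using sum_squares_bound[of "\<bar>f i x - f j x\<bar>" e] by (simp add: algebra_simps)
        then show ?thesis using e by (simp add: field_simps power2_eq_square)
      qed
      then have "(LINT x|M. norm (f i x - f j x)) \<le> (LINT x|M. (f i x - f j x)\<^sup>2 / (2 * e) + e / 2)"
        using sqi[OF dc] integrable_abs[OF continuous_integrable[OF dc]] by (intro integral_mono) auto
      also have "\<dots> = (LINT x|M. (f i x - f j x)\<^sup>2) / (2 * e) + e / 2"
        using sqi[OF dc] by (simp add: prob_space)
      also have "(LINT x|M. (f i x - f j x)\<^sup>2) < e\<^sup>2"
        using aux B[OF pos pos, of i j] N[OF that(1)] N[OF that(2)] zero_less_power[OF e, of 2]
        unfolding f_def by blast
      then have "(LINT x|M. (f i x - f j x)\<^sup>2) / (2 * e) + e / 2 < e\<^sup>2 / (2 * e) + e / 2"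
        using e by (simp add: divide_strict_right_mono)
      also have "\<dots> = e" using e by (simp add: power2_eq_square)
      finally show ?thesis .
    qed
    then show ?thesis by blast
  qed
  obtain r where r: "strict_mono r" "AE x in M. Cauchy (\<lambda>i. f (r i) x)"
    using cauchy_L1_AE_cauchy_subseq[of M f, OF continuous_integrable[OF fc] cauchy] by blast
  \<comment> \<open>With the default 0 off the convergence set, g is invariant at every point and
    not just almost everywhere: shifted averages differ by a null sequence, so that set is itself
    invariant.\<close>
  define g where "g x = (if Cauchy (\<lambda>i. f (r i) x) then lim (\<lambda>i. f (r i) x) else 0)" for x
  have glim: "(\<lambda>i. f (r i) x) \<longlonglongrightarrow> g x" if "Cauchy (\<lambda>i. f (r i) x)" for x
    unfolding g_def using that by (simp add: Cauchy_convergent_iff convergent_LIMSEQ_iff)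
  have gm: "g \<in> borel_measurable M"
  proof -
    have "{x \<in> space M. Cauchy (\<lambda>i. f (r i) x)} \<in> sets M"
      using fm by (intro sets_Collect_Cauchy) auto
    moreover have "(\<lambda>x. lim (\<lambda>i. f (r i) x)) \<in> borel_measurable M"
      using fm by (intro borel_measurable_lim_metric) auto
    ultimately show ?thesis unfolding g_def by (intro measurable_If) auto
  qed
  have gK: "\<bar>g x\<bar> \<le> K" for x
  proof (cases "Cauchy (\<lambda>i. f (r i) x)")
    case True
    then show ?thesis
      using LIMSEQ_le_const2[OF tendsto_rabs[OF glim]] fb by blast
  next
    case False
    then show ?thesis using K(1) by (simp add: g_def)
  qed
  have ginv: "g (\<phi> t x) = g x" for t x
  proof -
    have "(\<lambda>i. 2 * K * \<bar>t\<bar> / real (Suc (r i))) \<longlonglongrightarrow> 0"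
      by (intro tendsto_divide_0[OF tendsto_const] filterlim_at_top_imp_at_infinity
          filterlim_compose[OF filterlim_real_sequentially] filterlim_compose[OF filterlim_Suc]
          filterlim_subseq r(1))
    then have d: "(\<lambda>i. f (r i) (\<phi> t x) - f (r i) x) \<longlonglongrightarrow> 0"
      by (rule Lim_null_comparison[rotated])
        (use avg_shift(2)[OF h K(2), of "real (Suc (r _))" t x] in \<open>auto simp: f_def\<close>)
    have iff: "(\<lambda>i. f (r i) (\<phi> t x)) \<longlonglongrightarrow> l \<longleftrightarrow> (\<lambda>i. f (r i) x) \<longlonglongrightarrow> l" for l
      using tendsto_add[OF d, of "\<lambda>i. f (r i) x" l] tendsto_diff[OF _ d, of "\<lambda>i. f (r i) (\<phi> t x)" l] by auto
    then show ?thesis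
      unfolding g_def Cauchy_convergent_iff convergent_def lim_def by simp
  qed
  have L: "(\<lambda>i. LINT x|M. f (r i) x) \<longlonglongrightarrow> (LINT x|M. g x)"
    by (rule integral_dominated_convergence[where w = "\<lambda>_. K"])
      (use gm fm fb r(2) glim in auto)
  have "(LINT x|M. f i x) = 0" for i
    unfolding f_def using integral_avg[OF h, of "real (Suc i)"] h0 by simp
  then have g0: "(LINT x|M. g x) = 0" using L by (simp add: LIMSEQ_const_iff)
  have L2: "(\<lambda>i. LINT x|M. (f (r i) x)\<^sup>2) \<longlonglongrightarrow> (LINT x|M. (g x)\<^sup>2)"
  proof (rule integral_dominated_convergence[where w = "\<lambda>_. K\<^sup>2"])
    show "AE x in M. (\<lambda>i. (f (r i) x)\<^sup>2) \<longlonglongrightarrow> (g x)\<^sup>2"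
      using r(2) by eventually_elim (intro tendsto_power glim)
    show "AE x in M. norm ((f (r i) x)\<^sup>2) \<le> K\<^sup>2" for i
      using fb K(1) by (intro AE_I2) (simp add: abs_le_square_iff[symmetric])
  qed (use gm fm in auto)
  have "(LINT x|M. (f n x)\<^sup>2) = a (real (Suc n))" for n unfolding f_def a_def ..
  then have "(\<lambda>i. LINT x|M. (f (r i) x)\<^sup>2) \<longlonglongrightarrow> m"
    using LIMSEQ_subseq_LIMSEQ[OF alim_nat r(1)] by (simp add: o_def)
  \<comment> \<open>The whole family already tends to m, so one subsequence identifies m as the
    squared norm of the invariant function g.\<close>
  then have "m = (LINT x|M. (g x)\<^sup>2)" using L2 LIMSEQ_unique by blast
  then have "m = 0" using invariant_square_integral_zero[OF gm gK ginv g0] by simp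
  then show ?thesis using alim unfolding a_def by simp
qed

text \<open>Subtracting the mean reduces to mean zero. The L1 form is the one in which averages
  enter the shear estimate.\<close>

lemma mean_ergodic:
  assumes h: "continuous_on UNIV h"
  shows "((\<lambda>S. LINT x|M. \<bar>avg h S x - (LINT x|M. h x)\<bar>) \<longlongrightarrow> 0) at_top"
proof -
  define c where "c = (LINT x|M. h x)"
  have hc: "continuous_on UNIV (\<lambda>x. h x - c)" using h by (intro continuous_intros)
  have "(LINT x|M. h x - c) = 0"
    using continuous_integrable[OF h] by (simp add: c_def prob_space)
  then have lim: "((\<lambda>S. LINT x|M. (avg (\<lambda>x. h x - c) S x)\<^sup>2) \<longlongrightarrow> 0) at_top"
    by (rule mean_ergodic_square[OF hc])
  have "((\<lambda>S. LINT x|M. \<bar>avg h S x - c\<bar>) \<longlongrightarrow> 0) at_top"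
  proof (rule tendstoI)
    fix e :: real assume e: "e > 0"
    then have "\<forall>\<^sub>F S in at_top. (LINT x|M. (avg (\<lambda>x. h x - c) S x)\<^sup>2) < e\<^sup>2"
      using lim by (intro order_tendstoD(2)) auto
    then show "\<forall>\<^sub>F S in at_top. dist (LINT x|M. \<bar>avg h S x - c\<bar>) 0 < e"
      using eventually_gt_at_top[of 0]
    proof eventually_elim
      case (elim S)
      have eq: "avg (\<lambda>x. h x - c) S x = avg h S x - c" for x
      proof -
        have "(\<lambda>r. h (\<phi> r x)) integrable_on {0..S}"
          using comp_flow_continuous(1)[OF h] continuous_on_subset
          by (intro integrable_continuous_real) blast
        then have "integral {0..S} (\<lambda>r. h (\<phi> r x) - c) = integral {0..S} (\<lambda>r. h (\<phi> r x)) - S * c"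
          using elim(2) by (subst integral_diff) auto
        then show ?thesis using elim(2) by (simp add: avg_def diff_divide_distrib)
      qed
      have dc: "continuous_on UNIV (\<lambda>x. avg h S x - c)"
        by (intro continuous_intros avg_continuous h)
      then have dc2: "integrable M (\<lambda>x. (avg h S x - c)\<^sup>2)"
        by (intro continuous_integrable continuous_on_power)
      have "\<bar>avg h S x - c\<bar> \<le> (avg h S x - c)\<^sup>2 / (2 * e) + e / 2" for x
      proof -
        have "2 * e * \<bar>avg h S x - c\<bar> \<le> (avg h S x - c)\<^sup>2 + e\<^sup>2"
          using sum_squares_bound[of "\<bar>avg h S x - c\<bar>" e] by (simp add: algebra_simps)
        then show ?thesis using e by (simp add: field_simps power2_eq_square)
      qed
      then have "(LINT x|M. \<bar>avg h S x - c\<bar>) \<le> (LINT x|M. (avg h S x - c)\<^sup>2 / (2 * e) + e / 2)"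
        using dc2 integrable_abs[OF continuous_integrable[OF dc]] by (intro integral_mono) auto
      also have "\<dots> = (LINT x|M. (avg h S x - c)\<^sup>2) / (2 * e) + e / 2"
        using dc2 by (simp add: prob_space)
      also have "\<dots> < e\<^sup>2 / (2 * e) + e / 2"
        using elim(1) e unfolding eq by (simp add: divide_strict_right_mono)
      also have "\<dots> = e" using e by (simp add: power2_eq_square)
      finally show ?case by simp
    qed
  qed
  then show ?thesis unfolding c_def .
qed

lemma L2_comp_flow:
  assumes "h \<in> borel_measurable M" "integrable M (\<lambda>x. (cmod (h x))\<^sup>2)"
  shows "(\<lambda>x. h (\<phi> s x)) \<in> borel_measurable M" "integrable M (\<lambda>x. (cmod (h (\<phi> s x)))\<^sup>2)"
    "(LINT x|M. (cmod (h (\<phi> s x)))\<^sup>2) = (LINT x|M. (cmod (h x))\<^sup>2)"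
proof -
  have hb: "h \<in> borel_measurable borel" using assms(1) measurable_cong_sets[OF sets_M refl] by blast
  show "(\<lambda>x. h (\<phi> s x)) \<in> borel_measurable M"
    by (rule measurable_compose[OF flow_measurable hb])
  have sq: "(\<lambda>x. (cmod (h x))\<^sup>2) \<in> borel_measurable borel" using hb by measurable
  have "integrable (distr M borel (\<phi> s)) (\<lambda>x. (cmod (h x))\<^sup>2)" unfolding distr_flow by (rule assms(2))
  then show "integrable M (\<lambda>x. (cmod (h (\<phi> s x)))\<^sup>2)"
    by (rule integrable_distr[OF flow_measurable])
  show "(LINT x|M. (cmod (h (\<phi> s x)))\<^sup>2) = (LINT x|M. (cmod (h x))\<^sup>2)"
    using assms(1) by (intro integral_flow) measurable
qed

end


section \<open>Flows sheared by an expanding flow\<close>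

text \<open>By the mean value theorem in r, the difference quotient of \<sigma> is minus that of F
  in t, divided by F' at an intermediate point. Continuity of \<sigma> is a hypothesis because the
  application has an explicit formula for \<sigma>.\<close>

lemma implicit_function_real_derivative:
  fixes F F' :: "real \<Rightarrow> real \<Rightarrow> real"
  assumes dt: "((\<lambda>t. F t (\<sigma> t0)) has_real_derivative a) (at t0)"
    and dr: "\<And>t r. (F t has_real_derivative F' t r) (at r)"
    and cont: "isCont (\<lambda>(t, r). F' t r) (t0, \<sigma> t0)" and nz: "F' t0 (\<sigma> t0) \<noteq> 0"
    and \<sigma>: "isCont \<sigma> t0" "\<And>t. F t (\<sigma> t) = c"
  shows "(\<sigma> has_real_derivative - a / F' t0 (\<sigma> t0)) (at t0)"
proof -
  define r0 where "r0 = \<sigma> t0"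
  have "\<exists>\<xi>. \<bar>\<xi> - r0\<bar> \<le> \<bar>\<sigma> t - r0\<bar> \<and> F t (\<sigma> t) - F t r0 = (\<sigma> t - r0) * F' t \<xi>" for t
  proof -
    consider "\<sigma> t = r0" | "r0 < \<sigma> t" | "\<sigma> t < r0" by linarith
    then show ?thesis
    proof cases
      case 2
      then obtain z where "r0 < z" "z < \<sigma> t" "F t (\<sigma> t) - F t r0 = (\<sigma> t - r0) * F' t z"
        using MVT2[of r0 "\<sigma> t" "F t" "F' t"] dr by blast
      then show ?thesis by (intro exI[of _ z]) auto
    next
      case 3
      then obtain z where "\<sigma> t < z" "z < r0" "F t r0 - F t (\<sigma> t) = (r0 - \<sigma> t) * F' t z"
        using MVT2[of "\<sigma> t" r0 "F t" "F' t"] dr by blast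
      then show ?thesis by (intro exI[of _ z]) (auto simp: algebra_simps)
    qed auto
  qed
  then obtain \<xi> where \<xi>: "\<And>t. \<bar>\<xi> t - r0\<bar> \<le> \<bar>\<sigma> t - r0\<bar>"
    "\<And>t. F t (\<sigma> t) - F t r0 = (\<sigma> t - r0) * F' t (\<xi> t)"
    by metis
  have \<sigma>lim: "(\<sigma> \<longlongrightarrow> r0) (at t0)" using \<sigma>(1) by (simp add: isCont_def r0_def)
  then have "((\<lambda>t. \<bar>\<sigma> t - r0\<bar>) \<longlongrightarrow> 0) (at t0)"
    by (simp add: LIM_zero tendsto_rabs_zero)
  then have "((\<lambda>t. \<xi> t - r0) \<longlongrightarrow> 0) (at t0)"
    by (rule Lim_null_comparison[rotated]) (use \<xi>(1) in simp)
  then have "(\<xi> \<longlongrightarrow> r0) (at t0)" by (rule LIM_zero_cancel)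
  then have "((\<lambda>t. (t, \<xi> t)) \<longlongrightarrow> (t0, r0)) (at t0)"
    by (intro tendsto_Pair) auto
  then have F'lim: "((\<lambda>t. F' t (\<xi> t)) \<longlongrightarrow> F' t0 r0) (at t0)"
    using isCont_tendsto_compose[OF cont[folded r0_def]] by force
  then have ev: "\<forall>\<^sub>F t in at t0. F' t (\<xi> t) \<noteq> 0"
    using nz tendsto_imp_eventually_ne unfolding r0_def by blast
  have "((\<lambda>t. (F t r0 - F t0 r0) / (t - t0)) \<longlongrightarrow> a) (at t0)"
    using dt unfolding has_field_derivative_iff r0_def .
  then have "((\<lambda>t. - ((F t r0 - F t0 r0) / (t - t0)) / F' t (\<xi> t)) \<longlongrightarrow> - a / F' t0 r0) (at t0)"
    using nz by (intro tendsto_intros F'lim) (auto simp: r0_def)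
  then have "((\<lambda>t. (\<sigma> t - r0) / (t - t0)) \<longlongrightarrow> - a / F' t0 r0) (at t0)"
  proof (rule Lim_transform_eventually)
    show "\<forall>\<^sub>F t in at t0. - ((F t r0 - F t0 r0) / (t - t0)) / F' t (\<xi> t) = (\<sigma> t - r0) / (t - t0)"
      using ev
    proof eventually_elim
      case (elim t)
      have "F t0 r0 = F t (\<sigma> t)" using \<sigma>(2) by (simp add: r0_def)
      then have "- (F t r0 - F t0 r0) = (\<sigma> t - r0) * F' t (\<xi> t)" using \<xi>(2)[of t] by simp
      then have "- ((F t r0 - F t0 r0) / (t - t0)) = (\<sigma> t - r0) * F' t (\<xi> t) / (t - t0)"
        by (metis minus_divide_left)
      then show ?case using elim by simp
    qed
  qed
  then show ?thesis unfolding has_field_derivative_iff r0_def .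
qed

text \<open>In the application \<open>\<theta>\<close> is \<open>\<partial>\<^sub>2\<tau>(\<cdot>, 0)\<close> for the cocycle \<open>\<tau>\<close> from \<open>\<phi>\<close> to the expanding
  parametrisation; its last property is the derivative at \<open>s = 0\<close> of
  \<open>\<lambda>\<^sup>t \<tau>(x, s) = \<tau>(f\<^sub>t x, s\<^sup>*(t, s, x))\<close>.\<close>

locale sheared_flow = uniquely_ergodic_flow M \<phi>
  for M :: "'m::metric_space measure" and \<phi> +
  fixes f :: "real \<Rightarrow> 'm \<Rightarrow> 'm" and sst v u :: "real \<Rightarrow> real \<Rightarrow> 'm \<Rightarrow> real"
    and \<theta> :: "'m \<Rightarrow> real" and lam :: real
  assumes f_flow: "continuous_flow f"
    and intertwine: "f t (\<phi> s x) = \<phi> (sst t s x) (f t x)"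
    and free: "\<phi> s x = x \<Longrightarrow> s = 0"
    and sst_deriv: "((\<lambda>r. sst t r x) has_real_derivative v t s x) (at s)"
    and v_deriv: "((\<lambda>r. v r s x) has_real_derivative u t s x) (at t)"
    and u_continuous: "continuous_on UNIV (\<lambda>(t, s, x). u t s x)"
    and lam: "lam > 1"
    and \<theta>_continuous: "continuous_on UNIV \<theta>" and \<theta>_pos: "\<theta> x > 0"
    and \<theta>_expand: "lam powr t * \<theta> x = \<theta> (f t x) * v t 0 x"
begin

text \<open>The rate at which \<open>f t\<close> stretches the orbit of \<phi> at x;
  \<open>u0\<close> is its time derivative.\<close>

definition w :: "real \<Rightarrow> 'm \<Rightarrow> real" where "w t x = v t 0 x"
definition u0 :: "real \<Rightarrow> 'm \<Rightarrow> real" where "u0 t x = u t 0 x"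

lemma f_0 [simp]: "f 0 x = x"
  and f_add: "f (s + t) x = f s (f t x)"
  and f_joint: "continuous_on UNIV (\<lambda>(t, x). f t x)"
  using f_flow unfolding continuous_flow_def by auto

lemma f_cancel [simp]: "f (- t) (f t x) = x" "f t (f (- t) x) = x"
  using f_add[of "- t" t x] f_add[of t "- t" x] by auto

lemma continuous_f: "continuous_on UNIV (f t)"
  using continuous_on_curry(2)[OF f_joint] .

text \<open>Freeness makes the time between two points of an orbit unique, so identities for
  \<open>sst\<close> can be verified by comparing points.\<close>

lemma flow_eqD: "\<phi> a x = \<phi> b x \<Longrightarrow> a = b"
proof -
  assume "\<phi> a x = \<phi> b x"
  then have "\<phi> (a - b) x = x"
    using flow_add[of "- b" a x] flow_add[of "- b" b x] by (simp add: algebra_simps)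
  then show ?thesis using free by fastforce
qed

lemma sst_add: "sst t (s + r) x = sst t s (\<phi> r x) + sst t r x"
proof (rule flow_eqD)
  show "\<phi> (sst t (s + r) x) (f t x) = \<phi> (sst t s (\<phi> r x) + sst t r x) (f t x)"
    unfolding flow_add intertwine[symmetric] ..
qed

lemma sst_0 [simp]: "sst t 0 x = 0"
  using sst_add[of t 0 0 x] by simp

lemma sst_time_0 [simp]: "sst 0 s x = s"
  using intertwine[of 0 s x] by (intro flow_eqD[of _ x]) simp

lemma v_eq: "v t s x = w t (\<phi> s x)"
proof -
  have "((\<lambda>r. sst t (r + s) x) has_real_derivative v t s x) (at 0)"
    using sst_deriv[of t x s] DERIV_shift[of "\<lambda>r. sst t r x" "v t s x" 0 s] by simp
  moreover have "((\<lambda>r. sst t r (\<phi> s x) + sst t s x) has_real_derivative w t (\<phi> s x) + 0) (at 0)"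
    unfolding w_def by (intro DERIV_add sst_deriv DERIV_const)
  ultimately show ?thesis unfolding sst_add by (simp add: DERIV_unique)
qed

lemma w_deriv: "((\<lambda>r. w r x) has_real_derivative u0 t x) (at t)"
  unfolding w_def u0_def by (rule v_deriv)

lemma w_0 [simp]: "w 0 x = 1"
proof -
  have "((\<lambda>r::real. r) has_real_derivative w 0 x) (at 0)"
    using sst_deriv[of 0 x 0] by (simp add: w_def)
  then show ?thesis using DERIV_ident DERIV_unique by blast
qed

section \<open>Joint continuity derived from the mixed derivative\<close>

lemma u0_joint: "continuous_on UNIV (\<lambda>(t, x). u0 t x)"
proof -
  have "continuous_on UNIV (\<lambda>p. (\<lambda>(t, s, x). u t s x) (fst p, 0, snd p))"
    by (rule continuous_on_compose2[OF u_continuous]) (auto intro!: continuous_intros)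
  then show ?thesis by (simp add: u0_def split_beta)
qed

lemma u0_continuous: "continuous_on UNIV (u0 t)"
  using continuous_on_curry(2)[OF u0_joint] .

text \<open>Continuity of \<open>v\<close> is not among the hypotheses; it is recovered by
  integrating the continuous \<open>u0\<close> from time 0, where w is 1. Rescaling to [0, 1] fixes
  the domain of integration and covers negative t.\<close>

lemma w_eq_integral: "w t x = 1 + integral {0..1} (\<lambda>q. t * u0 (t * q) x)"
proof -
  have "((\<lambda>q. w (t * q) x) has_real_derivative t * u0 (t * q) x) (at q)" for q
  proof -
    have "((\<lambda>q. t * q) has_real_derivative t) (at q)" by (auto intro!: derivative_eq_intros)
    from DERIV_chain2[where f = "\<lambda>r. w r x" and g = "\<lambda>q. t * q", OF w_deriv this]
    show ?thesis by (simp only: mult.commute[of t "u0 (t * q) x"])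
  qed
  then have "integral {0..1} (\<lambda>q. t * u0 (t * q) x) = w (t * 1) x - w (t * 0) x"
    by (rule antiderivative_integral) simp
  then show ?thesis by simp
qed

lemma w_joint: "continuous_on UNIV (\<lambda>(t, x). w t x)"
proof -
  have "continuous_on UNIV (\<lambda>z. (\<lambda>(t, x). u0 t x) (fst (fst z) * snd z, snd (fst z)))"
    by (rule continuous_on_compose2[OF u0_joint]) (auto intro!: continuous_intros)
  then have "continuous_on (UNIV \<times> cbox 0 1)
      (\<lambda>(p, q). fst p * u0 (fst p * q) (snd p))"
    unfolding split_beta by (intro continuous_intros) (auto elim: continuous_on_subset)
  then have "continuous_on UNIV (\<lambda>p. integral (cbox 0 1) (\<lambda>q. fst p * u0 (fst p * q) (snd p)))"
    by (rule integral_continuous_on_param)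
  then show ?thesis
    unfolding w_eq_integral split_beta by (intro continuous_intros) simp
qed

lemma w_continuous: "continuous_on UNIV (w t)"
  using continuous_on_curry(2)[OF w_joint] .

lemma sst_eq_integral: "sst t s x = integral {0..1} (\<lambda>q. s * w t (\<phi> (s * q) x))"
proof -
  have "((\<lambda>q. sst t (s * q) x) has_real_derivative s * w t (\<phi> (s * q) x)) (at q)" for q
  proof -
    have "((\<lambda>q. s * q) has_real_derivative s) (at q)" by (auto intro!: derivative_eq_intros)
    from DERIV_chain2[where f = "\<lambda>r. sst t r x" and g = "\<lambda>q. s * q", OF sst_deriv this]
    show ?thesis by (simp only: v_eq mult.commute[of s "w t (\<phi> (s * q) x)"])
  qed
  then have "integral {0..1} (\<lambda>q. s * w t (\<phi> (s * q) x)) = sst t (s * 1) x - sst t (s * 0) x"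
    by (rule antiderivative_integral) simp
  then show ?thesis by simp
qed

text \<open>The variable z encodes ((t, s, x), q): parameters first, integration variable second, as
  integrals depending on a parameter require.\<close>

lemma joint_orbit:
  fixes k :: "real \<Rightarrow> 'm \<Rightarrow> real"
  assumes "continuous_on UNIV (\<lambda>(t, x). k t x)"
  shows "continuous_on UNIV (\<lambda>z. fst (snd (fst z)) * k (fst (fst z)) (\<phi> (fst (snd (fst z)) * snd z) (snd (snd (fst z)))))"
proof -
  have "continuous_on UNIV (\<lambda>z::(real \<times> real \<times> 'm) \<times> real. (\<lambda>(t, x). \<phi> t x) (fst (snd (fst z)) * snd z, snd (snd (fst z))))"
    by (rule continuous_on_compose2[OF flow_joint]) (auto intro!: continuous_intros)
  then have "continuous_on UNIV (\<lambda>z::(real \<times> real \<times> 'm) \<times> real. (\<lambda>(t, x). k t x) (fst (fst z), \<phi> (fst (snd (fst z)) * snd z) (snd (snd (fst z)))))"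
    by (intro continuous_on_compose2[OF assms]) (auto intro!: continuous_intros)
  then show ?thesis by (auto intro!: continuous_intros)
qed

lemma sst_joint: "continuous_on UNIV (\<lambda>(t, s, x). sst t s x)"
proof -
  have "continuous_on (UNIV \<times> cbox 0 1)
      (\<lambda>(p, q). fst (snd p) * w (fst p) (\<phi> (fst (snd p) * q) (snd (snd p))))"
    using continuous_on_subset[OF joint_orbit[OF w_joint] subset_UNIV] by (simp add: split_beta)
  then have "continuous_on UNIV (\<lambda>p. integral (cbox 0 1) (\<lambda>q. fst (snd p) * w (fst p) (\<phi> (fst (snd p) * q) (snd (snd p)))))"
    by (rule integral_continuous_on_param)
  then show ?thesis
    unfolding sst_eq_integral split_beta by simp
qed

text \<open>The integral of \<open>u0 t\<close> along the orbit segment of length r, rescaled to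
  [0, 1]. For t = 0 and r > 0 it equals \<open>r * avg (u0 0) r x\<close>, which is where ergodic
  averages come in.\<close>

definition sst_dt :: "real \<Rightarrow> real \<Rightarrow> 'm \<Rightarrow> real" where
  "sst_dt t r x = integral {0..1} (\<lambda>q. r * u0 t (\<phi> (r * q) x))"

lemma sst_time_deriv: "((\<lambda>t. sst t r x) has_real_derivative sst_dt t r x) (at t)"
proof -
  have "((\<lambda>t. integral (cbox 0 1) (\<lambda>q. r * w t (\<phi> (r * q) x))) has_real_derivative
      integral (cbox 0 1) (\<lambda>q. r * u0 t (\<phi> (r * q) x))) (at t within UNIV)"
  proof (rule leibniz_rule_field_derivative)
    show "((\<lambda>t. r * w t (\<phi> (r * q) x)) has_real_derivative r * u0 t (\<phi> (r * q) x)) (at t within UNIV)" for t q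
      by (intro DERIV_cmult w_deriv)
    have "continuous_on UNIV (\<lambda>q. r * w t (\<phi> (r * q) x))" for t
      using continuous_on_compose2[OF joint_orbit[OF w_joint], of UNIV "\<lambda>q. ((t, r, x), q)"]
      by (simp add: continuous_on_Pair)
    then show "(\<lambda>q. r * w t (\<phi> (r * q) x)) integrable_on cbox 0 1" for t
      using continuous_on_subset by (intro integrable_continuous) blast
    have "continuous_on (UNIV \<times> cbox 0 1) (\<lambda>z. (\<lambda>z. fst (snd (fst z)) * u0 (fst (fst z)) (\<phi> (fst (snd (fst z)) * snd z) (snd (snd (fst z))))) ((fst z, r, x), snd z))"
      by (rule continuous_on_compose2[OF joint_orbit[OF u0_joint]]) (auto intro!: continuous_intros)
    then show "continuous_on (UNIV \<times> cbox 0 1) (\<lambda>(t, q). r * u0 t (\<phi> (r * q) x))"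
      by (simp add: split_beta)
  qed auto
  then show ?thesis unfolding sst_dt_def sst_eq_integral by simp
qed

end


section \<open>Transport of the invariant measure\<close>

context sheared_flow
begin

text \<open>The flow \<phi> seen through \<open>f t\<close>. It appears when x is replaced by
  \<open>f t x\<close> in a correlation and \<eta> is compared with its translate under
  \<open>f (- t)\<close>.\<close>

definition conj_flow :: "real \<Rightarrow> real \<Rightarrow> 'm \<Rightarrow> 'm" where
  "conj_flow t s x = f (- t) (\<phi> s (f t x))"

lemma conj_flow_add: "conj_flow t (s + r) x = conj_flow t s (conj_flow t r x)"
  unfolding conj_flow_def by (simp add: flow_add)

lemma conj_flow_sst: "conj_flow t (sst t r x) x = \<phi> r x"
  unfolding conj_flow_def by (simp add: intertwine[symmetric])

lemma conj_flow_joint: "continuous_on UNIV (\<lambda>(t, s, x). conj_flow t s x)"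
proof -
  have 1: "continuous_on UNIV (\<lambda>z::real \<times> real \<times> 'm. f (fst z) (snd (snd z)))"
    using continuous_on_compose2[OF f_joint, of UNIV "\<lambda>z. (fst z, snd (snd z))"]
    by (simp add: continuous_on_Pair continuous_on_fst continuous_on_snd continuous_on_id)
  have 2: "continuous_on UNIV (\<lambda>z::real \<times> real \<times> 'm. \<phi> (fst (snd z)) (f (fst z) (snd (snd z))))"
    using continuous_on_compose2[OF flow_joint, of UNIV "\<lambda>z. (fst (snd z), f (fst z) (snd (snd z)))"] 1
    by (simp add: continuous_on_Pair continuous_on_fst continuous_on_snd continuous_on_id)
  have 3: "continuous_on UNIV (\<lambda>z::real \<times> real \<times> 'm. f (- fst z) (\<phi> (fst (snd z)) (f (fst z) (snd (snd z)))))"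
    using continuous_on_compose2[OF f_joint, of UNIV "\<lambda>z. (- fst z, \<phi> (fst (snd z)) (f (fst z) (snd (snd z))))"] 2
    by (simp add: continuous_on_Pair continuous_on_fst continuous_on_snd continuous_on_id continuous_on_minus)
  then show ?thesis by (simp add: conj_flow_def split_beta)
qed

lemma conj_flow_continuous:
  "continuous_on UNIV (\<lambda>s. conj_flow t s x)" "continuous_on UNIV (\<lambda>x. conj_flow t s x)"
proof -
  show "continuous_on UNIV (\<lambda>s. conj_flow t s x)"
    using continuous_on_compose2[OF conj_flow_joint, of UNIV "\<lambda>s. (t, s, x)"]
    by (simp add: continuous_on_Pair)
  show "continuous_on UNIV (\<lambda>x. conj_flow t s x)"
    using continuous_on_compose2[OF conj_flow_joint, of UNIV "\<lambda>x. (t, s, x)"]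
    by (simp add: continuous_on_Pair)
qed

lemma w_small:
  assumes "\<kappa> > 0"
  obtains d where "d > 0" "\<And>t x. \<bar>t\<bar> \<le> d \<Longrightarrow> \<bar>w t x - 1\<bar> \<le> \<kappa>" "\<And>t x. \<bar>t\<bar> \<le> d \<Longrightarrow> \<bar>u0 t x - u0 0 x\<bar> \<le> \<kappa>"
proof -
  obtain d1 where d1: "d1 > 0" "\<And>t x. \<bar>t\<bar> \<le> d1 \<Longrightarrow> dist (w t x) (w 0 x) < \<kappa>"
    by (rule uniform_small_time[OF compact_UNIV w_joint assms]) (rule that)
  obtain d2 where d2: "d2 > 0" "\<And>t x. \<bar>t\<bar> \<le> d2 \<Longrightarrow> dist (u0 t x) (u0 0 x) < \<kappa>"
    by (rule uniform_small_time[OF compact_UNIV u0_joint assms]) (rule that)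
  show thesis
  proof
    show "min d1 d2 > 0" using d1 d2 by simp
    show "\<bar>w t x - 1\<bar> \<le> \<kappa>" if "\<bar>t\<bar> \<le> min d1 d2" for t x
      using d1(2)[of t x] that by (simp add: dist_real_def)
    show "\<bar>u0 t x - u0 0 x\<bar> \<le> \<kappa>" if "\<bar>t\<bar> \<le> min d1 d2" for t x
      using d2(2)[of t x] that by (simp add: dist_real_def)
  qed
qed

text \<open>The conjugated flow runs through the orbits of \<open>\<phi>\<close> at speed \<open>1 / w t\<close>; integrating along
  a long orbit segment shows that it preserves the density \<open>w t\<close>.\<close>

lemma integral_conj_flow:
  assumes h: "continuous_on UNIV h"
  shows "(LINT x|M. h (conj_flow t s x) * w t x) = (LINT x|M. h x * w t x)"
proof -
  obtain K where K: "K > 0" "\<And>x. \<bar>h x\<bar> \<le> K"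
    using compact_continuous_bounded[OF compact_UNIV h] by auto
  define k where "k x = h (conj_flow t s x) * w t x - h x * w t x" for x
  have hc: "continuous_on UNIV (\<lambda>x. h (conj_flow t s x))"
    using continuous_on_compose2[OF h conj_flow_continuous(2)] by simp
  have kc: "continuous_on UNIV k"
    unfolding k_def by (intro continuous_on_diff continuous_on_mult hc h w_continuous)
  have bound: "\<bar>avg k S x\<bar> \<le> 2 * K * \<bar>s\<bar> / S" if S: "S > 0" for S x
  proof -
    have "continuous_on UNIV (\<lambda>q. h (conj_flow t q x))"
      using continuous_on_compose2[OF h conj_flow_continuous(1)] by simp
    then obtain H where H: "\<And>q. (H has_real_derivative h (conj_flow t q x)) (at q)"
      using continuous_antiderivative by blast
    note lip = antiderivative_lipschitz[OF H K(2)]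
    \<comment> \<open>By \<open>conj_flow_sst\<close> the point \<open>\<phi> r x\<close> has
      conjugated time \<open>sst t r x\<close>, so \<open>w t\<close> is the Jacobian of the
      substitution from r to conjugated time.\<close>
    have der: "((\<lambda>r. H (a + sst t r x)) has_real_derivative h (conj_flow t a (\<phi> r x)) * w t (\<phi> r x)) (at r)" for a r
    proof -
      have "((\<lambda>r. a + sst t r x) has_real_derivative w t (\<phi> r x)) (at r)"
        using DERIV_add[OF DERIV_const sst_deriv] by (simp add: v_eq)
      from DERIV_chain2[where f = H and g = "\<lambda>r. a + sst t r x", OF H this]
      show ?thesis by (simp add: conj_flow_add conj_flow_sst)
    qed
    have 0: "conj_flow t 0 y = y" for y by (simp add: conj_flow_def)
    have "((\<lambda>r. H (s + sst t r x) - H (0 + sst t r x)) has_real_derivative k (\<phi> r x)) (at r)" for r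
      using DERIV_diff[OF der[of s r] der[of 0 r]] by (simp add: k_def 0)
    then have "integral {0..S} (\<lambda>r. k (\<phi> r x))
        = (H (s + sst t S x) - H (0 + sst t S x)) - (H (s + sst t 0 x) - H (0 + sst t 0 x))"
      using S by (intro antiderivative_integral) auto
    \<comment> \<open>Two increments of H over time s remain, one at each end of the segment, so the
      bound does not depend on S.\<close>
    then have "\<bar>integral {0..S} (\<lambda>r. k (\<phi> r x))\<bar> \<le> 2 * K * \<bar>s\<bar>"
      using lip[of "s + sst t S x" "sst t S x"] lip[of s 0] by simp
    then show ?thesis using S by (simp add: avg_def divide_right_mono)
  qed
  have "\<bar>LINT x|M. k x\<bar> \<le> 2 * K * \<bar>s\<bar> / S" if S: "S > 0" for S
  proof -
    have "\<bar>LINT x|M. avg k S x\<bar> \<le> (LINT x|M. \<bar>avg k S x\<bar>)"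
      using integral_norm_bound[of M "avg k S"] by simp
    also have "\<dots> \<le> (LINT x|M. 2 * K * \<bar>s\<bar> / S)"
      using bound[OF S] by (intro integral_mono integrable_abs continuous_integrable avg_continuous kc) auto
    finally show ?thesis using integral_avg[OF kc S] by (simp add: prob_space)
  qed
  then have "\<forall>\<^sub>F S in at_top. \<bar>LINT x|M. k x\<bar> \<le> 2 * K * \<bar>s\<bar> / S"
    by (intro eventually_mono[OF eventually_gt_at_top[of 0]]) auto
  moreover have "((\<lambda>S. 2 * K * \<bar>s\<bar> / S) \<longlongrightarrow> 0) at_top"
    by (intro tendsto_divide_0[OF tendsto_const] filterlim_at_top_imp_at_infinity filterlim_ident)
  ultimately have "\<bar>LINT x|M. k x\<bar> \<le> 0"
    by (intro tendsto_lowerbound[where F = at_top]) auto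
  moreover have "(LINT x|M. k x) = (LINT x|M. h (conj_flow t s x) * w t x) - (LINT x|M. h x * w t x)"
    unfolding k_def
    by (intro Bochner_Integration.integral_diff continuous_integrable continuous_on_mult hc h w_continuous)
  ultimately show ?thesis by simp
qed

definition Z :: "real \<Rightarrow> real" where "Z t = (LINT x|M. w t x)"

text \<open>The density \<open>w t / Z t\<close> is preserved by the conjugated flow, so its image
  under \<open>f t\<close> is preserved by \<phi> and equals M by unique ergodicity. This change of
  variables takes the place of invariance under \<open>f t\<close>.\<close>

lemma integral_f:
  assumes wpos: "\<And>x. w t x > 0" and Zpos: "Z t > 0" and h: "continuous_on UNIV h"
  shows "(LINT x|M. h x) = (LINT x|M. h (f t x) * w t x) / Z t"
proof -
  define D where "D = density M (\<lambda>x. ennreal (w t x / Z t))"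
  define N where "N = distr D borel (f t)"
  have wm: "w t \<in> borel_measurable M" by (rule continuous_imp_measurable_borel[OF sets_M w_continuous])
  have setsD: "sets D = sets M" unfolding D_def by simp
  have fD: "f t \<in> measurable D borel"
    using continuous_imp_measurable_borel[OF _ continuous_f] setsD sets_M by simp
  have "emeasure D (space D) = ennreal (LINT x|M. w t x / Z t)"
    unfolding D_def using wm wpos Zpos continuous_integrable[OF w_continuous, of t]
    by (simp add: emeasure_density nn_integral_eq_integral less_imp_le cong: nn_integral_cong)
  also have "(LINT x|M. w t x / Z t) = 1" using Zpos by (simp add: Z_def)
  finally have "prob_space D" by (intro prob_spaceI) simp
  then have probN: "prob_space N"
    unfolding N_def by (rule prob_space.prob_space_distr) (rule fD)
  have setsN: "sets N = sets borel" unfolding N_def by simp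
  have intN: "(LINT x|N. k x) = (LINT x|M. k (f t x) * w t x) / Z t"
    if k: "continuous_on UNIV k" for k :: "'m \<Rightarrow> real"
  proof -
    have kf: "continuous_on UNIV (\<lambda>x. k (f t x))"
      using continuous_on_compose2[OF k continuous_f] by simp
    have "(LINT x|N. k x) = (LINT x|D. k (f t x))"
      unfolding N_def by (intro integral_distr fD borel_measurable_continuous_onI k)
    also have "\<dots> = (LINT x|M. (w t x / Z t) *\<^sub>R k (f t x))"
      unfolding D_def using wm wpos Zpos continuous_imp_measurable_borel[OF sets_M kf]
      by (intro integral_density) (auto simp: less_imp_le)
    also have "\<dots> = (LINT x|M. k (f t x) * w t x / Z t)"
      by (intro Bochner_Integration.integral_cong) auto
    finally show ?thesis by simp
  qed
  have fN: "\<phi> s \<in> measurable N borel" for s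
    by (rule continuous_imp_measurable_borel[OF setsN flow_continuous])
  have "distr N borel (\<phi> s) = N" for s
  proof (rule prob_measure_eqI_continuous)
    show "prob_space (distr N borel (\<phi> s))"
      using probN fN by (rule prob_space.prob_space_distr)
    fix k :: "'m \<Rightarrow> real" assume k: "continuous_on UNIV k"
    have kf: "continuous_on UNIV (\<lambda>x. k (f t x))"
      using continuous_on_compose2[OF k continuous_f] by simp
    have "(LINT x|distr N borel (\<phi> s). k x) = (LINT x|N. k (\<phi> s x))"
      by (intro integral_distr fN borel_measurable_continuous_onI k)
    also have "\<dots> = (LINT x|M. k (\<phi> s (f t x)) * w t x) / Z t"
      by (rule intN[OF comp_flow_continuous(2)[OF k]])
    also have "(LINT x|M. k (\<phi> s (f t x)) * w t x) = (LINT x|M. k (f t x) * w t x)"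
      using integral_conj_flow[OF kf, of t s] by (simp add: conj_flow_def)
    finally show "(LINT x|distr N borel (\<phi> s). k x) = (LINT x|N. k x)"
      using intN[OF k] by simp
  qed (use probN setsN in auto)
  then have "invariant_probability \<phi> N"
    unfolding invariant_probability_def using probN setsN by blast
  then have "N = M"
    using unique unfolding unique_invariant_probability_def by blast
  then show ?thesis using intN[OF h] by simp
qed

lemma Z_bounds:
  assumes "\<And>x. \<bar>w t x - 1\<bar> \<le> \<kappa>"
  shows "\<bar>Z t - 1\<bar> \<le> \<kappa>"
proof -
  have i: "integrable M (w t)" by (rule continuous_integrable[OF w_continuous])
  have "Z t - 1 = (LINT x|M. w t x - 1)" unfolding Z_def using i by (simp add: prob_space)
  also have "\<bar>\<dots>\<bar> \<le> (LINT x|M. \<bar>w t x - 1\<bar>)"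
    using integral_norm_bound[of M "\<lambda>x. w t x - 1"] by simp
  also have "\<dots> \<le> (LINT x|M. \<kappa>)"
    using assms i by (intro integral_mono) auto
  finally show ?thesis by (simp add: prob_space)
qed

text \<open>With \<theta> as test function the transformed integrand
  \<open>\<theta> (f t x) * w t x\<close> is \<open>lam powr t * \<theta> x\<close>, and the
  positive integral of \<theta> cancels. Closeness of w to 1 makes the density and Z
  positive.\<close>

lemma Z_eq:
  assumes w: "\<And>x. \<bar>w t x - 1\<bar> \<le> 1 / 2"
  shows "Z t = lam powr t"
proof -
  have wpos: "w t x > 0" for x using w[of x] by (auto simp: abs_if split: if_splits)
  have Zpos: "Z t > 0" using Z_bounds[OF w] by (auto simp: abs_if split: if_splits)
  obtain x0 where x0: "\<And>x. \<theta> x0 \<le> \<theta> x"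
    using continuous_attains_inf[OF compact_UNIV _ \<theta>_continuous] by auto
  have \<theta>i: "integrable M \<theta>" by (rule continuous_integrable[OF \<theta>_continuous])
  have "\<theta> x0 = (LINT x|M. \<theta> x0)" by (simp add: prob_space)
  also have "\<dots> \<le> (LINT x|M. \<theta> x)" using \<theta>i x0 by (intro integral_mono) auto
  finally have pos: "(LINT x|M. \<theta> x) > 0" using \<theta>_pos[of x0] by simp
  have "(LINT x|M. \<theta> x) = (LINT x|M. \<theta> (f t x) * w t x) / Z t"
    by (rule integral_f[OF wpos Zpos \<theta>_continuous])
  also have "(LINT x|M. \<theta> (f t x) * w t x) = lam powr t * (LINT x|M. \<theta> x)"
    using \<theta>_expand[of t] by (simp add: w_def[symmetric] flip: integral_mult_right_zero)
  finally show ?thesis using pos Zpos by (simp add: field_simps)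
qed

definition C :: real where "C = (LINT x|M. u0 0 x)"

text \<open>C is formally the derivative at 0 of Z, which is \<open>lam powr t\<close> for small t.
  A comparison to first order at one small time d bounds C below by ln lam up to \<kappa>, without
  differentiating under the integral over M.\<close>

lemma C_pos: "C > 0"
proof -
  have "ln lam \<le> C + \<kappa>" if \<kappa>: "0 < \<kappa>" "\<kappa> \<le> 1 / 2" for \<kappa>
  proof -
    obtain d where d: "d > 0" "\<And>t x. \<bar>t\<bar> \<le> d \<Longrightarrow> \<bar>w t x - 1\<bar> \<le> \<kappa>"
      "\<And>t x. \<bar>t\<bar> \<le> d \<Longrightarrow> \<bar>u0 t x - u0 0 x\<bar> \<le> \<kappa>"
      by (rule w_small[OF \<kappa>(1)]) (rule that)
    have le: "w d x \<le> 1 + d * u0 0 x + \<kappa> * d" for x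
    proof -
      have "\<bar>(w d x - d * u0 0 x) - (w 0 x - 0 * u0 0 x)\<bar> \<le> \<kappa> * \<bar>d - 0\<bar>"
        unfolding real_norm_def[symmetric]
      proof (rule field_differentiable_bound[of "{0..d}" "\<lambda>t. w t x - t * u0 0 x" "\<lambda>t. u0 t x - u0 0 x"])
        show "((\<lambda>t. w t x - t * u0 0 x) has_real_derivative u0 t x - u0 0 x) (at t within {0..d})" for t
          by (auto intro!: derivative_eq_intros has_field_derivative_at_within[OF w_deriv])
      qed (use d in auto)
      then show ?thesis using d(1) by simp
    qed
    have "1 + d * ln lam \<le> exp (d * ln lam)" by (rule exp_ge_add_one_self)
    also have "\<dots> = lam powr d" using lam by (simp add: powr_def)
    also have "\<dots> = Z d"
    proof (rule Z_eq[symmetric])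
      show "\<bar>w d x - 1\<bar> \<le> 1 / 2" for x using d(1) d(2)[of d x] \<kappa>(2) by simp
    qed
    also have "\<dots> \<le> (LINT x|M. 1 + d * u0 0 x + \<kappa> * d)"
      unfolding Z_def using le continuous_integrable[OF u0_continuous] continuous_integrable[OF w_continuous]
      by (intro integral_mono) auto
    also have "\<dots> = 1 + d * C + \<kappa> * d"
      unfolding C_def using continuous_integrable[OF u0_continuous, of 0] by (simp add: prob_space)
    finally have "d * ln lam \<le> d * (C + \<kappa>)" by (simp add: algebra_simps)
    then show ?thesis using d(1) by simp
  qed
  \<comment> \<open>Half of ln lam is enough to leave C positive; the minimum with 1 / 2 meets the
    restriction on \<kappa>.\<close>
  from this[of "min (1 / 2) (ln lam / 2)"] have "ln lam \<le> C + min (1 / 2) (ln lam / 2)"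
    using lam by simp
  moreover have "ln lam > 0" using lam by simp
  ultimately show ?thesis by linarith
qed

end


section \<open>Sheared orbit segments\<close>

context sheared_flow
begin

text \<open>The solution \<sigma> of \<open>sst t \<sigma> x = s\<close>: undoing \<open>f t\<close>
  inverts the change of time, so the solution is \<open>sst\<close> at time - t. Its continuity in t
  is then immediate.\<close>

definition hit :: "real \<Rightarrow> 'm \<Rightarrow> real \<Rightarrow> real" where
  "hit s x t = sst (- t) s (f t x)"

lemma flow_hit: "\<phi> (hit s x t) x = conj_flow t s x"
  using intertwine[of "- t" s "f t x"] by (simp add: hit_def conj_flow_def)

lemma sst_hit: "sst t (hit s x t) x = s"
proof (rule flow_eqD)
  show "\<phi> (sst t (hit s x t) x) (f t x) = \<phi> s (f t x)"
    by (simp add: intertwine[symmetric] flow_hit conj_flow_def)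
qed

lemma hit_0 [simp]: "hit s x 0 = s"
  by (simp add: hit_def)

lemma hit_continuous: "continuous_on UNIV (hit s x)"
proof -
  have "continuous_on UNIV (\<lambda>t. (- t, s, f t x))"
    using continuous_on_curry(1)[OF f_joint] by (intro continuous_intros) auto
  from continuous_on_compose2[OF sst_joint this]
  show ?thesis by (simp add: hit_def[abs_def])
qed

lemma hit_deriv:
  assumes "w t (\<phi> (hit s x t) x) \<noteq> 0"
  shows "(hit s x has_real_derivative - sst_dt t (hit s x t) x / w t (\<phi> (hit s x t) x)) (at t)"
proof (rule implicit_function_real_derivative[where F = "\<lambda>t r. sst t r x" and F' = "\<lambda>t r. w t (\<phi> r x)"])
  show "((\<lambda>t'. sst t' (hit s x t) x) has_real_derivative sst_dt t (hit s x t) x) (at t)"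
    by (rule sst_time_deriv)
  show "((\<lambda>r. sst t r x) has_real_derivative w t (\<phi> r x)) (at r)" for t r
    using sst_deriv[of t x r] by (simp add: v_eq)
  have 1: "continuous_on UNIV (\<lambda>p::real \<times> real. (fst p, \<phi> (snd p) x))"
    using continuous_on_compose2[OF continuous_on_curry(1)[OF flow_joint] continuous_on_snd[OF continuous_on_id]]
    by (intro continuous_intros) auto
  have "continuous_on UNIV (\<lambda>p::real \<times> real. w (fst p) (\<phi> (snd p) x))"
    using continuous_on_compose2[OF w_joint 1] by simp
  then show "isCont (\<lambda>(t, r). w t (\<phi> r x)) (t, hit s x t)"
    by (simp add: continuous_on_eq_continuous_at case_prod_unfold)
  show "isCont (hit s x) t"
    using hit_continuous by (simp add: continuous_on_eq_continuous_at)
qed (use assms sst_hit in auto)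

lemma continuous_orbit_segment:
  assumes "continuous_on UNIV k"
  shows "continuous_on {a..b} (\<lambda>q. r * k (\<phi> (r * q) x :: 'm) :: real)"
proof -
  have "continuous_on UNIV (\<lambda>q. k (\<phi> (r * q) x))"
    using continuous_on_compose2[OF comp_flow_continuous(1)[OF assms, of x], of UNIV "\<lambda>q. r * q"]
    by (simp add: continuous_on_mult_left continuous_on_id)
  then show ?thesis
    using continuous_on_subset by (intro continuous_on_mult_left) blast
qed

text \<open>The equation \<open>sst t (hit s x t) x = s\<close> reads
  \<open>hit s x t * m = s\<close>, where m is the mean of \<open>w t\<close> on the orbit segment
  and lies within \<kappa> of 1; the factors 2 come from m \<ge> 1 / 2.\<close>

lemma hit_bounds:
  assumes s: "s > 0" and \<kappa>: "\<kappa> \<le> 1 / 2" and w: "\<And>y. \<bar>w t y - 1\<bar> \<le> \<kappa>"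
  shows "0 < hit s x t" "hit s x t \<le> 2 * s" "\<bar>hit s x t - s\<bar> \<le> 2 * \<kappa> * s"
proof -
  have \<kappa>0: "\<kappa> \<ge> 0" using w[of x] by simp
  define m where "m = integral {0..1} (\<lambda>q. 1 * w t (\<phi> (hit s x t * q) x))"
  have wc: "continuous_on {0..1} (\<lambda>q. w t (\<phi> (hit s x t * q) x))"
  proof -
    have "continuous_on UNIV (\<lambda>q. w t (\<phi> (hit s x t * q) x))"
      using continuous_on_compose2[OF comp_flow_continuous(1)[OF w_continuous, of t x], of UNIV "\<lambda>q. hit s x t * q"]
      by (simp add: continuous_on_mult_left continuous_on_id)
    then show ?thesis using continuous_on_subset by blast
  qed
  have eq: "s = hit s x t * m"
    using sst_eq_integral[of t "hit s x t" x] sst_hit[of t s x] by (simp add: m_def)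
  have "m - 1 = integral {0..1} (\<lambda>q. w t (\<phi> (hit s x t * q) x) - 1)"
    unfolding m_def using wc by (subst integral_diff) (auto intro: integrable_continuous_real)
  also have "\<bar>\<dots>\<bar> \<le> \<kappa> * (1 - 0)"
    unfolding real_norm_def[symmetric]
    by (rule integral_bound) (use w wc in \<open>auto intro!: continuous_intros\<close>)
  finally have m: "\<bar>m - 1\<bar> \<le> \<kappa>" by simp
  then have m2: "1 / 2 \<le> m" using \<kappa> by (auto simp: abs_if split: if_splits)
  then have m0: "m > 0" by simp
  show pos: "0 < hit s x t"
    by (rule zero_less_mult_pos2[OF _ m0]) (subst eq[symmetric], rule s)
  have "hit s x t * (1 / 2) \<le> hit s x t * m"
    using m2 pos by (intro mult_left_mono) auto
  then show le: "hit s x t \<le> 2 * s" unfolding eq[symmetric] by simp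
  have "\<bar>hit s x t - s\<bar> = hit s x t * \<bar>m - 1\<bar>"
  proof -
    have "hit s x t - hit s x t * m = hit s x t * (1 - m)" by (simp add: algebra_simps)
    then show ?thesis using pos unfolding eq[symmetric] by (simp add: abs_mult abs_minus_commute)
  qed
  also have "\<dots> \<le> (2 * s) * \<kappa>" using m le pos s by (intro mult_mono) auto
  finally show "\<bar>hit s x t - s\<bar> \<le> 2 * \<kappa> * s" by (simp add: algebra_simps)
qed

text \<open>Three replacements: \<open>u0 t\<close> by \<open>u0 0\<close>, the end
  \<open>hit s x t\<close> of the segment by s, and the orbit average by C. Every error is
  proportional to s, and only the last one depends on x.\<close>

lemma sst_dt_bound:
  assumes s: "s > 0" and \<kappa>: "\<kappa> \<le> 1 / 2" and w: "\<And>y. \<bar>w t y - 1\<bar> \<le> \<kappa>"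
    and u: "\<And>y. \<bar>u0 t y - u0 0 y\<bar> \<le> \<kappa>" and B: "\<And>y. \<bar>u0 0 y\<bar> \<le> B"
  shows "\<bar>sst_dt t (hit s x t) x\<bar> \<le> s * (2 * B + 1)"
    and "\<bar>sst_dt t (hit s x t) x - C * s\<bar> \<le> s * (2 * \<kappa> + 2 * B * \<kappa> + \<bar>avg (u0 0) s x - C\<bar>)"
proof -
  have \<kappa>0: "\<kappa> \<ge> 0" using w[of x] by simp
  have B0: "B \<ge> 0" using B abs_ge_zero order_trans by blast
  define h where "h = hit s x t"
  note hb = hit_bounds[OF s \<kappa> w, where x = x, folded h_def]
  obtain U where U: "\<And>r. (U has_real_derivative u0 0 (\<phi> r x)) (at r)"
    using continuous_antiderivative[OF comp_flow_continuous(1)[OF u0_continuous]] by blast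
  have D0: "integral {0..1} (\<lambda>q. h * u0 0 (\<phi> (h * q) x)) = U h - U 0"
  proof -
    have "((\<lambda>q. U (h * q)) has_real_derivative h * u0 0 (\<phi> (h * q) x)) (at q)" for q
    proof -
      have "((\<lambda>q. h * q) has_real_derivative h) (at q)" by (auto intro!: derivative_eq_intros)
      from DERIV_chain2[where f = U and g = "\<lambda>q. h * q", OF U this]
      show ?thesis by (simp only: mult.commute[of h "u0 0 (\<phi> (h * q) x)"])
    qed
    from antiderivative_integral[OF this, of 0 1] show ?thesis by simp
  qed
  have "sst_dt t h x - (U h - U 0)
      = integral {0..1} (\<lambda>q. h * u0 t (\<phi> (h * q) x) - h * u0 0 (\<phi> (h * q) x))"
    unfolding sst_dt_def D0[symmetric]
    by (intro integral_diff[symmetric] integrable_continuous_real continuous_orbit_segment u0_continuous)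
  also have "\<bar>\<dots>\<bar> \<le> (h * \<kappa>) * (1 - 0)"
    unfolding real_norm_def[symmetric]
  proof (rule integral_bound)
    show "continuous_on {0..1} (\<lambda>q. h * u0 t (\<phi> (h * q) x) - h * u0 0 (\<phi> (h * q) x))"
      by (intro continuous_on_diff continuous_orbit_segment u0_continuous)
    show "norm (h * u0 t (\<phi> (h * q) x) - h * u0 0 (\<phi> (h * q) x)) \<le> h * \<kappa>" for q
      using u[of "\<phi> (h * q) x"] hb(1) unfolding right_diff_distrib[symmetric]
      by (simp add: abs_mult)
  qed simp
  finally have 1: "\<bar>sst_dt t h x - (U h - U 0)\<bar> \<le> h * \<kappa>" by simp
  have h\<kappa>: "h * \<kappa> \<le> 2 * s * \<kappa>" using hb(2) \<kappa>0 by (intro mult_right_mono) auto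
  have 2: "\<bar>U h - U 0\<bar> \<le> B * (2 * s)"
  proof -
    have "\<bar>U h - U 0\<bar> \<le> B * \<bar>h - 0\<bar>" by (rule antiderivative_lipschitz[OF U B])
    also have "\<dots> \<le> B * (2 * s)" using hb B0 by (intro mult_left_mono) auto
    finally show ?thesis .
  qed
  have \<kappa>s: "2 * s * \<kappa> \<le> s" using mult_left_mono[OF \<kappa>, of "2 * s"] s by simp
  have "\<bar>sst_dt t h x\<bar> \<le> h * \<kappa> + B * (2 * s)" using 1 2 by linarith
  also have "\<dots> \<le> s * (2 * B + 1)" using h\<kappa> \<kappa>s by (simp add: algebra_simps)
  finally show "\<bar>sst_dt t (hit s x t) x\<bar> \<le> s * (2 * B + 1)" by (simp add: h_def)
  have 3: "\<bar>U h - U s\<bar> \<le> 2 * B * \<kappa> * s"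
  proof -
    have "\<bar>U h - U s\<bar> \<le> B * \<bar>h - s\<bar>" by (rule antiderivative_lipschitz[OF U B])
    also have "\<dots> \<le> B * (2 * \<kappa> * s)" using hb B0 by (intro mult_left_mono) auto
    finally show ?thesis by (simp add: algebra_simps)
  qed
  have "avg (u0 0) s x = (U s - U 0) / s"
    unfolding avg_def using antiderivative_integral[OF U] s by simp
  then have 4: "\<bar>(U s - U 0) - C * s\<bar> = s * \<bar>avg (u0 0) s x - C\<bar>"
  proof -
    have "(U s - U 0) - C * s = s * ((U s - U 0) / s - C)" using s by (simp add: field_simps)
    then show ?thesis using s \<open>avg (u0 0) s x = (U s - U 0) / s\<close> by (simp add: abs_mult)
  qed
  have "\<bar>sst_dt t h x - C * s\<bar> \<le> h * \<kappa> + 2 * B * \<kappa> * s + s * \<bar>avg (u0 0) s x - C\<bar>"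
    using 1 3 4 by linarith
  also have "\<dots> \<le> 2 * s * \<kappa> + 2 * B * \<kappa> * s + s * \<bar>avg (u0 0) s x - C\<bar>" using h\<kappa> by simp
  also have "\<dots> = s * (2 * \<kappa> + 2 * B * \<kappa> + \<bar>avg (u0 0) s x - C\<bar>)" by (simp add: algebra_simps)
  finally show "\<bar>sst_dt t (hit s x t) x - C * s\<bar> \<le> s * (2 * \<kappa> + 2 * B * \<kappa> + \<bar>avg (u0 0) s x - C\<bar>)"
    by (simp add: h_def)
qed

text \<open>In the quotient of \<open>hit_deriv\<close>, replacing w by 1 costs
  \<open>s * (2 * B + 1) * (2 * \<kappa>)\<close>; together with the \<kappa>-terms of
  \<open>sst_dt_bound\<close> this gives the factor 4 + 6 * B.\<close>

lemma hit_velocity: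
  assumes s: "s > 0" and \<kappa>: "\<kappa> \<le> 1 / 2" and w: "\<And>y. \<bar>w t y - 1\<bar> \<le> \<kappa>"
    and u: "\<And>y. \<bar>u0 t y - u0 0 y\<bar> \<le> \<kappa>" and B: "\<And>y. \<bar>u0 0 y\<bar> \<le> B"
  obtains D where "(hit s x has_real_derivative D) (at t)"
    "\<bar>D + C * s\<bar> \<le> s * (\<kappa> * (4 + 6 * B) + \<bar>avg (u0 0) s x - C\<bar>)"
proof -
  have \<kappa>0: "\<kappa> \<ge> 0" using w[of x] by simp
  have B0: "B \<ge> 0" using B abs_ge_zero order_trans by blast
  define a where "a = w t (\<phi> (hit s x t) x)"
  define d where "d = sst_dt t (hit s x t) x"
  have a: "\<bar>a - 1\<bar> \<le> \<kappa>" unfolding a_def by (rule w)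
  then have a2: "1 / 2 \<le> a" using \<kappa> by (auto simp: abs_if split: if_splits)
  note bd = sst_dt_bound[OF s \<kappa> w u B, of x, folded d_def]
  have "\<bar>d - d / a\<bar> \<le> s * (2 * B + 1) * (2 * \<kappa>)"
  proof -
    have "d - d / a = d * ((a - 1) / a)" using a2 by (simp add: field_simps)
    then have "\<bar>d - d / a\<bar> = \<bar>d\<bar> * (\<bar>a - 1\<bar> / a)" using a2 by (simp add: abs_mult)
    also have "\<bar>a - 1\<bar> / a \<le> 2 * \<kappa>"
    proof -
      have "\<kappa> * 1 \<le> \<kappa> * (2 * a)" using a2 \<kappa>0 by (intro mult_left_mono) auto
      then show ?thesis using a a2 by (simp add: pos_divide_le_eq algebra_simps)
    qed
    then have "\<bar>d\<bar> * (\<bar>a - 1\<bar> / a) \<le> s * (2 * B + 1) * (2 * \<kappa>)"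
      using bd(1) a2 s B0 by (intro mult_mono) auto
    finally show ?thesis .
  qed
  then have "\<bar>- d / a + C * s\<bar> \<le> s * (2 * B + 1) * (2 * \<kappa>)
      + s * (2 * \<kappa> + 2 * B * \<kappa> + \<bar>avg (u0 0) s x - C\<bar>)"
    using bd(2) by (simp add: abs_le_iff)
  also have "\<dots> = s * (\<kappa> * (4 + 6 * B) + \<bar>avg (u0 0) s x - C\<bar>)" by (simp add: algebra_simps)
  finally have "\<bar>- d / a + C * s\<bar> \<le> s * (\<kappa> * (4 + 6 * B) + \<bar>avg (u0 0) s x - C\<bar>)" .
  moreover have "(hit s x has_real_derivative - d / a) (at t)"
    unfolding a_def d_def by (rule hit_deriv) (use a2 in \<open>simp add: a_def\<close>)
  ultimately show thesis by (rule that[rotated])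
qed

text \<open>Moving the base point along the flow \<open>f\<close> for a time \<open>t \<le> d\<close> shears the orbit segment of
  length \<open>s\<close>: its end point sweeps out the orbit of \<open>\<phi>\<close> at almost constant speed \<open>C * s\<close>, so the
  time average over \<open>t\<close> is almost an ergodic average.\<close>

lemma shear_average:
  assumes s: "s > 0" and d: "d > 0" "C * d < 1" and \<kappa>: "\<kappa> \<le> 1 / 2"
    and w: "\<And>t y. \<bar>t\<bar> \<le> d \<Longrightarrow> \<bar>w t y - 1\<bar> \<le> \<kappa>"
    and u: "\<And>t y. \<bar>t\<bar> \<le> d \<Longrightarrow> \<bar>u0 t y - u0 0 y\<bar> \<le> \<kappa>" and B: "\<And>y. \<bar>u0 0 y\<bar> \<le> B"
    and \<eta>: "continuous_on UNIV \<eta>" "\<And>y. \<bar>\<eta> y\<bar> \<le> K"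
  shows "C * \<bar>integral {0..d} (\<lambda>t. \<eta> (conj_flow t s x))\<bar>
      \<le> \<bar>avg \<eta> s x\<bar> + \<bar>avg \<eta> (s * (1 - C * d)) x\<bar>
        + 2 * K * d * (\<kappa> * (4 + 6 * B) + \<bar>avg (u0 0) s x - C\<bar>)"
proof -
  define E where "E = \<kappa> * (4 + 6 * B) + \<bar>avg (u0 0) s x - C\<bar>"
  have K0: "K \<ge> 0" using \<eta>(2) abs_ge_zero order_trans by blast
  have "\<exists>D. (hit s x has_real_derivative D) (at t) \<and> \<bar>D + C * s\<bar> \<le> s * E" if "t \<in> {0..d}" for t
    unfolding E_def using hit_velocity[OF s \<kappa> w u B, of t x] that by auto
  then obtain D where D: "\<And>t. t \<in> {0..d} \<Longrightarrow> (hit s x has_real_derivative D t) (at t)"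
    "\<And>t. t \<in> {0..d} \<Longrightarrow> \<bar>D t + C * s\<bar> \<le> s * E"
    by metis
  obtain H where H: "\<And>r. (H has_real_derivative \<eta> (\<phi> r x)) (at r)"
    using continuous_antiderivative[OF comp_flow_continuous(1)[OF \<eta>(1)]] by blast
  have \<eta>h: "continuous_on UNIV (\<lambda>t. \<eta> (\<phi> (hit s x t) x))"
    using continuous_on_compose2[OF comp_flow_continuous(1)[OF \<eta>(1)] hit_continuous] by simp
  obtain Y where Y: "\<And>t. (Y has_real_derivative \<eta> (\<phi> (hit s x t) x)) (at t)"
    using continuous_antiderivative[OF \<eta>h] by blast
  \<comment> \<open>The derivative of P is \<eta> at the moving end point times
    \<open>D t + C * s\<close>, which is small. This carries out the substitution from t to
    \<open>hit s x t\<close> without requiring \<open>hit\<close> to be monotone.\<close>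
  define P where "P t = C * s * Y t + H (hit s x t)" for t
  have "\<bar>P d - P 0\<bar> \<le> (K * (s * E)) * \<bar>d - 0\<bar>"
    unfolding real_norm_def[symmetric]
  proof (rule field_differentiable_bound[of "{0..d}" P "\<lambda>t. \<eta> (\<phi> (hit s x t) x) * (D t + C * s)"])
    fix t assume t: "t \<in> {0..d}"
    have "(P has_real_derivative C * s * \<eta> (\<phi> (hit s x t) x) + \<eta> (\<phi> (hit s x t) x) * D t) (at t)"
      unfolding P_def by (intro DERIV_add DERIV_cmult Y DERIV_chain2[where f = H and g = "hit s x", OF H D(1)[OF t]])
    then show "(P has_real_derivative \<eta> (\<phi> (hit s x t) x) * (D t + C * s)) (at t within {0..d})"
      by (simp add: algebra_simps has_field_derivative_at_within)
    show "norm (\<eta> (\<phi> (hit s x t) x) * (D t + C * s)) \<le> K * (s * E)"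
      unfolding real_norm_def abs_mult using \<eta>(2) D(2)[OF t] K0 by (intro mult_mono) auto
  qed (use d in auto)
  then have P: "\<bar>P d - P 0\<bar> \<le> K * (s * E) * d" using d by simp
  have "\<bar>(hit s x d + C * s * d) - (hit s x 0 + C * s * 0)\<bar> \<le> s * E * \<bar>d - 0\<bar>"
    unfolding real_norm_def[symmetric]
  proof (rule field_differentiable_bound[of "{0..d}" "\<lambda>t. hit s x t + C * s * t" "\<lambda>t. D t + C * s"])
    fix t assume t: "t \<in> {0..d}"
    show "((\<lambda>t. hit s x t + C * s * t) has_real_derivative D t + C * s) (at t within {0..d})"
      by (auto intro!: derivative_eq_intros has_field_derivative_at_within[OF D(1)[OF t]])
    show "norm (D t + C * s) \<le> s * E" using D(2)[OF t] by simp
  qed (use d in auto)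
  then have hd: "\<bar>hit s x d - s * (1 - C * d)\<bar> \<le> s * E * d" using d by (simp add: algebra_simps)
  have "\<bar>H (hit s x d) - H (s * (1 - C * d))\<bar> \<le> K * \<bar>hit s x d - s * (1 - C * d)\<bar>"
    by (rule antiderivative_lipschitz[OF H \<eta>(2)])
  also have "\<dots> \<le> K * (s * E * d)" using hd K0 by (rule mult_left_mono)
  finally have H1: "\<bar>H (hit s x d) - H (s * (1 - C * d))\<bar> \<le> K * (s * E) * d" by (simp add: algebra_simps)
  have Havg: "\<bar>H S - H 0\<bar> = S * \<bar>avg \<eta> S x\<bar>" if "S > 0" for S
  proof -
    have "avg \<eta> S x = (H S - H 0) / S"
      unfolding avg_def using antiderivative_integral[OF H] that by simp
    then show ?thesis using that by simp
  qed
  have "C * s * \<bar>Y d - Y 0\<bar> = \<bar>(P d - P 0) - (H (hit s x d) - H s)\<bar>"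
  proof -
    have "(P d - P 0) - (H (hit s x d) - H s) = C * s * (Y d - Y 0)"
      by (simp add: P_def algebra_simps)
    then show ?thesis using C_pos s by (simp add: abs_mult)
  qed
  also have "\<dots> \<le> \<bar>P d - P 0\<bar> + (\<bar>H (hit s x d) - H (s * (1 - C * d))\<bar>
      + \<bar>H (s * (1 - C * d)) - H 0\<bar> + \<bar>H s - H 0\<bar>)" by linarith
  also have "\<dots> \<le> K * (s * E) * d + (K * (s * E) * d + s * \<bar>avg \<eta> (s * (1 - C * d)) x\<bar> + s * \<bar>avg \<eta> s x\<bar>)"
  proof -
    \<comment> \<open>\<open>C * d < 1\<close> keeps the approximate end point at a positive time,
      where H is expressed by an average.\<close>
    have "s * (1 - C * d) > 0" "s * (1 - C * d) \<le> s" using s d C_pos by (auto simp: mult_le_cancel_left1)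
    then have H2: "\<bar>H (s * (1 - C * d)) - H 0\<bar> \<le> s * \<bar>avg \<eta> (s * (1 - C * d)) x\<bar>"
      using Havg[of "s * (1 - C * d)"] by (simp add: mult_right_mono)
    show ?thesis by (intro add_mono P H1 H2 eq_refl[OF Havg[OF s]])
  qed
  also have "\<dots> = s * (\<bar>avg \<eta> s x\<bar> + \<bar>avg \<eta> (s * (1 - C * d)) x\<bar> + 2 * K * d * E)"
    by (simp add: algebra_simps)
  finally have "s * (C * \<bar>Y d - Y 0\<bar>) \<le> s * (\<bar>avg \<eta> s x\<bar> + \<bar>avg \<eta> (s * (1 - C * d)) x\<bar> + 2 * K * d * E)"
    by (simp add: mult.left_commute mult.assoc)
  then have "C * \<bar>Y d - Y 0\<bar> \<le> \<bar>avg \<eta> s x\<bar> + \<bar>avg \<eta> (s * (1 - C * d)) x\<bar> + 2 * K * d * E"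
    using s by simp
  moreover have "integral {0..d} (\<lambda>t. \<eta> (conj_flow t s x)) = Y d - Y 0"
    unfolding flow_hit[symmetric] using d by (intro antiderivative_integral Y) auto
  ultimately show ?thesis unfolding E_def by simp
qed

end


section \<open>Decay of correlations\<close>

context sheared_flow
begin

text \<open>After the change of variables by \<open>integral_f\<close>, three errors remain: the
  density, the shift in \<psi> and the shift in \<eta>. The density contributes 4 \<kappa>, since |w
  - Z| \<le> 2 \<kappa> and Z \<ge> 1 / 2.\<close>

lemma correlation_shear:
  assumes wpos: "\<And>x. \<bar>w t x - 1\<bar> \<le> \<kappa>" and \<kappa>: "\<kappa> \<le> 1 / 2"
    and \<psi>: "continuous_on UNIV \<psi>" "\<And>x. \<bar>\<psi> x\<bar> \<le> L" "\<And>x. \<bar>\<psi> (f t x) - \<psi> x\<bar> \<le> e"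
    and \<eta>: "continuous_on UNIV \<eta>" "\<And>x. \<bar>\<eta> x\<bar> \<le> K" "\<And>x. \<bar>\<eta> (f (- t) x) - \<eta> x\<bar> \<le> e"
  shows "\<bar>(LINT x|M. \<psi> x * \<eta> (\<phi> s x)) - (LINT x|M. \<psi> x * \<eta> (conj_flow t s x))\<bar>
    \<le> 4 * L * K * \<kappa> + (K + L) * e"
proof -
  have K0: "K \<ge> 0" using \<eta>(2) abs_ge_zero order_trans by blast
  have L0: "L \<ge> 0" using \<psi>(2) abs_ge_zero order_trans by blast
  have e0: "e \<ge> 0" using \<psi>(3) abs_ge_zero order_trans by blast
  have wb: "1 / 2 \<le> w t x" for x using wpos[of x] \<kappa> by (auto simp: abs_if split: if_splits)
  have w0: "w t x > 0" for x using wb[of x] by simp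
  have Zb: "\<bar>Z t - 1\<bar> \<le> \<kappa>" by (rule Z_bounds[OF wpos])
  then have Z2: "1 / 2 \<le> Z t" using \<kappa> by (auto simp: abs_if split: if_splits)
  then have Z0: "Z t > 0" by simp
  have wZ: "\<bar>w t x / Z t - 1\<bar> \<le> 4 * \<kappa>" for x
  proof -
    have "\<bar>w t x - Z t\<bar> \<le> 2 * \<kappa>" using wpos[of x] Zb by (simp add: abs_le_iff)
    also have "\<dots> \<le> 4 * \<kappa> * Z t"
      using mult_left_mono[OF Z2, of "4 * \<kappa>"] wpos[of x] abs_ge_zero[of "w t x - 1"] by simp
    finally have "\<bar>w t x - Z t\<bar> / Z t \<le> 4 * \<kappa>" using Z0 by (simp add: pos_divide_le_eq)
    moreover have "w t x / Z t - 1 = (w t x - Z t) / Z t" using Z0 by (simp add: field_simps)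
    ultimately show ?thesis using Z0 by simp
  qed
  have \<eta>s: "continuous_on UNIV (\<lambda>x. \<eta> (\<phi> s x))" by (rule comp_flow_continuous(2)[OF \<eta>(1)])
  have c1: "continuous_on UNIV (\<lambda>x. \<psi> x * \<eta> (\<phi> s x))"
    by (intro continuous_on_mult \<psi> \<eta>s)
  have c2: "continuous_on UNIV (\<lambda>x. \<psi> (f t x) * \<eta> (\<phi> s (f t x)) * w t x)"
    using continuous_on_compose2[OF c1 continuous_f] by (intro continuous_on_mult[OF _ w_continuous]) simp
  have c3: "continuous_on UNIV (\<lambda>x. \<psi> x * \<eta> (conj_flow t s x))"
    using continuous_on_compose2[OF \<eta>(1) conj_flow_continuous(2)] by (intro continuous_on_mult \<psi>) simp
  define k where "k x = \<psi> (f t x) * \<eta> (\<phi> s (f t x)) * w t x / Z t - \<psi> x * \<eta> (conj_flow t s x)" for x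
  have pt: "\<bar>\<psi> (f t x) * \<eta> (\<phi> s (f t x)) * w t x / Z t - \<psi> x * \<eta> (conj_flow t s x)\<bar>
      \<le> 4 * L * K * \<kappa> + (K + L) * e" for x
  proof -
    define a where "a = \<psi> (f t x)"
    define b where "b = \<eta> (\<phi> s (f t x))"
    define b' where "b' = \<eta> (conj_flow t s x)"
    have bb: "\<bar>b' - b\<bar> \<le> e" unfolding b_def b'_def conj_flow_def by (rule \<eta>(3))
    have "a * b * w t x / Z t - \<psi> x * b'
        = a * b * (w t x / Z t - 1) + (a - \<psi> x) * b - \<psi> x * (b' - b)"
      by (simp add: algebra_simps)
    also have "\<bar>\<dots>\<bar> \<le> \<bar>a * b * (w t x / Z t - 1)\<bar> + \<bar>(a - \<psi> x) * b\<bar> + \<bar>\<psi> x * (b' - b)\<bar>"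
      by linarith
    also have "\<dots> \<le> L * K * (4 * \<kappa>) + e * K + L * e"
      unfolding abs_mult using \<psi>(2,3) \<eta>(2) wZ bb L0 K0 e0
      by (intro add_mono mult_mono) (auto simp: a_def b_def)
    finally show ?thesis unfolding a_def b_def b'_def by (simp add: algebra_simps)
  qed
  have "(LINT x|M. \<psi> x * \<eta> (\<phi> s x)) = (LINT x|M. \<psi> (f t x) * \<eta> (\<phi> s (f t x)) * w t x / Z t)"
    using integral_f[OF w0 Z0 c1] by simp
  then have eq: "(LINT x|M. \<psi> x * \<eta> (\<phi> s x)) - (LINT x|M. \<psi> x * \<eta> (conj_flow t s x)) = (LINT x|M. k x)"
    unfolding k_def using continuous_integrable[OF c2] continuous_integrable[OF c3] by simp
  have "integrable M k"
    unfolding k_def by (intro Bochner_Integration.integrable_diff integrable_divide continuous_integrable c2 c3)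
  then have le: "(LINT x|M. \<bar>k x\<bar>) \<le> (LINT x|M. 4 * L * K * \<kappa> + (K + L) * e)"
    by (intro integral_mono[OF _ _ pt[folded k_def]]) auto
  have "\<bar>LINT x|M. k x\<bar> \<le> (LINT x|M. \<bar>k x\<bar>)"
    using integral_norm_bound[of M k] by simp
  from order_trans[OF this le] show ?thesis unfolding eq by (simp add: prob_space)
qed

lemma mixing_continuous_mean_zero:
  fixes \<psi> \<eta> :: "'m \<Rightarrow> real"
  assumes \<psi>: "continuous_on UNIV \<psi>" and \<eta>: "continuous_on UNIV \<eta>" and \<eta>0: "(LINT x|M. \<eta> x) = 0"
  shows "((\<lambda>s. LINT x|M. \<psi> x * \<eta> (\<phi> s x)) \<longlongrightarrow> 0) at_top"
proof (rule tendstoI)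
  fix \<epsilon> :: real assume \<epsilon>: "\<epsilon> > 0"
  obtain L where L: "L > 0" "\<And>x. \<bar>\<psi> x\<bar> \<le> L"
    using compact_continuous_bounded[OF compact_UNIV \<psi>] by auto
  obtain K where K: "K > 0" "\<And>x. \<bar>\<eta> x\<bar> \<le> K"
    using compact_continuous_bounded[OF compact_UNIV \<eta>] by auto
  obtain B where B: "B > 0" "\<And>x. \<bar>u0 0 x\<bar> \<le> B"
    using compact_continuous_bounded[OF compact_UNIV u0_continuous] by auto
  \<comment> \<open>The total coefficient of \<kappa>: \<open>4 * L * K\<close> from
    \<open>correlation_shear\<close>, the rest from \<open>shear_average\<close> after division by C
    and d.\<close>
  define c1 where "c1 = 4 * L * K + 2 * L * K / C * (4 + 6 * B)"
  have c1: "c1 > 0" unfolding c1_def using L K B C_pos by (intro add_pos_pos mult_pos_pos divide_pos_pos) auto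
  define \<kappa> where "\<kappa> = min (1 / 2) (\<epsilon> / (4 * c1))"
  define e where "e = \<epsilon> / (4 * (K + L))"
  have \<kappa>: "\<kappa> > 0" "\<kappa> \<le> 1 / 2" "c1 * \<kappa> \<le> \<epsilon> / 4"
  proof -
    show "\<kappa> > 0" "\<kappa> \<le> 1 / 2" unfolding \<kappa>_def using c1 \<epsilon> by auto
    have "c1 * \<kappa> \<le> c1 * (\<epsilon> / (4 * c1))" unfolding \<kappa>_def using c1 by (intro mult_left_mono) auto
    then show "c1 * \<kappa> \<le> \<epsilon> / 4" using c1 by simp
  qed
  have "S * (\<epsilon> / (4 * S)) = \<epsilon> / 4" if "S > 0" for S using that by simp
  then have e: "e > 0" "(K + L) * e = \<epsilon> / 4" unfolding e_def using \<epsilon> K(1) L(1) by (simp, blast intro: add_pos_pos)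
  obtain d1 where d1: "d1 > 0" "\<And>t x. \<bar>t\<bar> \<le> d1 \<Longrightarrow> \<bar>w t x - 1\<bar> \<le> \<kappa>"
    "\<And>t x. \<bar>t\<bar> \<le> d1 \<Longrightarrow> \<bar>u0 t x - u0 0 x\<bar> \<le> \<kappa>"
    by (rule w_small[OF \<kappa>(1)]) (rule that)
  have "continuous_on UNIV (\<lambda>(t, x). \<psi> (f t x))" "continuous_on UNIV (\<lambda>(t, x). \<eta> (f t x))"
    using continuous_on_compose2[OF \<psi> f_joint] continuous_on_compose2[OF \<eta> f_joint]
    by (simp_all add: case_prod_unfold)
  note jj = this
  obtain d2 where d2: "d2 > 0" "\<And>t x. \<bar>t\<bar> \<le> d2 \<Longrightarrow> dist (\<psi> (f t x)) (\<psi> (f 0 x)) < e"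
    by (rule uniform_small_time[OF compact_UNIV jj(1) e(1)]) (rule that)
  obtain d3 where d3: "d3 > 0" "\<And>t x. \<bar>t\<bar> \<le> d3 \<Longrightarrow> dist (\<eta> (f t x)) (\<eta> (f 0 x)) < e"
    by (rule uniform_small_time[OF compact_UNIV jj(2) e(1)]) (rule that)
  \<comment> \<open>The entry \<open>1 / (2 * C)\<close> ensures C * d < 1. From here on d is fixed
    and only s tends to infinity.\<close>
  define d where "d = min (min d1 d2) (min d3 (1 / (2 * C)))"
  have d: "d > 0" "d \<le> d1" "d \<le> d2" "d \<le> d3" unfolding d_def using d1 d2 d3 C_pos by auto
  have "C * d \<le> C * (1 / (2 * C))" unfolding d_def using C_pos by (intro mult_left_mono) auto
  then have Cd: "C * d < 1" using C_pos by simp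
  define I where "I s = (LINT x|M. \<psi> x * \<eta> (\<phi> s x))" for s
  define J where "J s t = (LINT x|M. \<psi> x * \<eta> (conj_flow t s x))" for s t
  define a1 where "a1 s = (LINT x|M. \<bar>avg \<eta> s x\<bar>)" for s
  define a2 where "a2 s = (LINT x|M. \<bar>avg (u0 0) s x - C\<bar>)" for s
  have IJ: "\<bar>I s - J s t\<bar> \<le> 4 * L * K * \<kappa> + (K + L) * e" if t: "t \<in> {0..d}" for s t
    unfolding I_def J_def
  proof (rule correlation_shear)
    show "\<bar>w t x - 1\<bar> \<le> \<kappa>" for x using d1(2) d t by simp
    show "\<bar>\<psi> (f t x) - \<psi> x\<bar> \<le> e" for x using d2(2)[of t x] d t by (simp add: dist_real_def)
    show "\<bar>\<eta> (f (- t) x) - \<eta> x\<bar> \<le> e" for x using d3(2)[of "- t" x] d t by (simp add: dist_real_def)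
  qed (use \<kappa> \<psi> \<eta> L K in auto)
  have conj_joint: "continuous_on UNIV (\<lambda>(t, x). \<eta> (conj_flow t s x))" for s
  proof -
    have "continuous_on UNIV (\<lambda>z::real \<times> 'm. (fst z, s, snd z))" by (intro continuous_intros)
    from continuous_on_compose2[OF \<eta> continuous_on_compose2[OF conj_flow_joint this]]
    show ?thesis by (simp add: case_prod_unfold)
  qed
  then have Gc: "continuous_on UNIV (\<lambda>(t, x). \<psi> x * \<eta> (conj_flow t s x))" for s
    unfolding case_prod_unfold
    using continuous_on_compose2[OF \<psi> continuous_on_snd[OF continuous_on_id], of UNIV]
    by (intro continuous_on_mult) simp_all
  \<comment> \<open>\<open>I s\<close> does not depend on t, so averaging its comparison with
    \<open>J s t\<close> over [0, d] and interchanging integrals leads to the time integral of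
    \<open>shear_average\<close>. The terms with \<kappa> and e use \<epsilon> / 4 each.\<close>
  have main: "\<bar>I s\<bar> \<le> \<epsilon> / 2 + L / (C * d) * (a1 s + a1 (s * (1 - C * d))) + 2 * L * K / C * a2 s"
    if s: "s > 0" for s
  proof -
    have s': "s * (1 - C * d) > 0" using s Cd by simp
    have Jint: "J s integrable_on {0..d}"
      unfolding J_def[abs_def] by (rule integral_swap_param(3)[OF Gc])
    have "d * I s - integral {0..d} (J s) = integral {0..d} (\<lambda>t. I s - J s t)"
      using Jint d by (subst integral_diff) auto
    also have "\<bar>\<dots>\<bar> \<le> integral {0..d} (\<lambda>t. 4 * L * K * \<kappa> + (K + L) * e)"
      unfolding real_norm_def[symmetric]
      by (rule integral_norm_bound_integral) (use Jint IJ in \<open>auto intro: integrable_diff\<close>)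
    also have "\<dots> = d * (4 * L * K * \<kappa> + (K + L) * e)" using d by simp
    finally have 1: "\<bar>d * I s - integral {0..d} (J s)\<bar> \<le> d * (4 * L * K * \<kappa> + (K + L) * e)" .
    let ?T = "\<lambda>x. integral {0..d} (\<lambda>t. \<eta> (conj_flow t s x))"
    let ?R = "\<lambda>x. \<bar>avg \<eta> s x\<bar> + \<bar>avg \<eta> (s * (1 - C * d)) x\<bar>
        + 2 * K * d * (\<kappa> * (4 + 6 * B) + \<bar>avg (u0 0) s x - C\<bar>)"
    have Tc: "continuous_on UNIV ?T" by (rule integral_swap_param(2)[OF conj_joint])
    have Tb: "C * \<bar>?T x\<bar> \<le> ?R x" for x
      by (rule shear_average[OF s d(1) Cd \<kappa>(2)]) (use d1 d \<eta> K B in auto)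
    have "integral {0..d} (J s) = (LINT x|M. integral {0..d} (\<lambda>t. \<psi> x * \<eta> (conj_flow t s x)))"
      unfolding J_def[abs_def] by (rule integral_swap_param(1)[OF Gc, symmetric])
    also have "\<dots> = (LINT x|M. \<psi> x * ?T x)" by simp
    finally have JT: "integral {0..d} (J s) = (LINT x|M. \<psi> x * ?T x)" .
    have Ri: "integrable M (\<lambda>x. L * (?R x / C))"
      by (intro integrable_mult_right integrable_divide Bochner_Integration.integrable_add integrable_abs
          Bochner_Integration.integrable_diff continuous_integrable avg_continuous \<eta> u0_continuous integrable_const)
    have "\<bar>integral {0..d} (J s)\<bar> \<le> (LINT x|M. \<bar>\<psi> x * ?T x\<bar>)"
      unfolding JT using integral_norm_bound[of M "\<lambda>x. \<psi> x * ?T x"] by simp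
    also have "\<dots> \<le> (LINT x|M. L * (?R x / C))"
    proof (rule integral_mono[OF _ Ri])
      show "integrable M (\<lambda>x. \<bar>\<psi> x * ?T x\<bar>)"
        by (intro integrable_abs continuous_integrable continuous_on_mult \<psi> Tc)
      fix x
      have "\<bar>?T x\<bar> \<le> ?R x / C" using Tb[of x] C_pos by (simp add: pos_le_divide_eq mult.commute)
      then show "\<bar>\<psi> x * ?T x\<bar> \<le> L * (?R x / C)"
        unfolding abs_mult using L by (intro mult_mono) auto
    qed
    also have "\<dots> = L * ((a1 s + a1 (s * (1 - C * d)) + 2 * K * d * (\<kappa> * (4 + 6 * B) + a2 s)) / C)"
    proof -
      have i: "integrable M (\<lambda>x. \<bar>avg \<eta> s x\<bar>)" "integrable M (\<lambda>x. \<bar>avg (u0 0) s x - C\<bar>)" for s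
        by (intro integrable_abs Bochner_Integration.integrable_diff continuous_integrable avg_continuous
            \<eta> u0_continuous integrable_const)+
      show ?thesis unfolding a1_def a2_def using i by (simp add: prob_space)
    qed
    finally have 2: "\<bar>integral {0..d} (J s)\<bar>
        \<le> L * ((a1 s + a1 (s * (1 - C * d)) + 2 * K * d * (\<kappa> * (4 + 6 * B) + a2 s)) / C)" .
    have "d * \<bar>I s\<bar> = \<bar>d * I s\<bar>" using d by (simp add: abs_mult)
    also have "\<dots> \<le> d * (4 * L * K * \<kappa> + (K + L) * e)
        + L * ((a1 s + a1 (s * (1 - C * d)) + 2 * K * d * (\<kappa> * (4 + 6 * B) + a2 s)) / C)"
      using 1 2 by linarith
    also have "\<dots> = d * (c1 * \<kappa> + (K + L) * e + L / (C * d) * (a1 s + a1 (s * (1 - C * d))) + 2 * L * K / C * a2 s)"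
      unfolding c1_def using d(1) C_pos by (simp add: field_simps)
    finally have "\<bar>I s\<bar> \<le> c1 * \<kappa> + (K + L) * e + L / (C * d) * (a1 s + a1 (s * (1 - C * d))) + 2 * L * K / C * a2 s"
      using d(1) by simp
    then show ?thesis using \<kappa>(3) e(2) by simp
  qed
  have l1: "(a1 \<longlongrightarrow> 0) at_top" using mean_ergodic[OF \<eta>] \<eta>0 unfolding a1_def by simp
  have l1': "((\<lambda>s. a1 (s * (1 - C * d))) \<longlongrightarrow> 0) at_top"
    by (rule filterlim_compose[OF l1])
      (use Cd in \<open>auto intro!: filterlim_at_top_mult_tendsto_pos[OF tendsto_const] filterlim_ident\<close>)
  have l2: "(a2 \<longlongrightarrow> 0) at_top" using mean_ergodic[OF u0_continuous, of 0] unfolding a2_def C_def .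
  have "((\<lambda>s. \<epsilon> / 2 + L / (C * d) * (a1 s + a1 (s * (1 - C * d))) + 2 * L * K / C * a2 s)
      \<longlongrightarrow> \<epsilon> / 2 + L / (C * d) * (0 + 0) + 2 * L * K / C * 0) at_top"
    by (intro tendsto_intros l1 l1' l2)
  then have "\<forall>\<^sub>F s in at_top. \<epsilon> / 2 + L / (C * d) * (a1 s + a1 (s * (1 - C * d))) + 2 * L * K / C * a2 s < \<epsilon>"
    by (rule order_tendstoD(2)) (use \<epsilon> in simp)
  then show "\<forall>\<^sub>F s in at_top. dist (LINT x|M. \<psi> x * \<eta> (\<phi> s x)) 0 < \<epsilon>"
    using eventually_gt_at_top[of 0]
  proof eventually_elim
    case (elim s)
    then show ?case using main[of s] by (simp add: I_def)
  qed
qed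

lemma mixing_continuous:
  fixes \<psi> \<eta> :: "'m \<Rightarrow> real"
  assumes \<psi>: "continuous_on UNIV \<psi>" and \<eta>: "continuous_on UNIV \<eta>"
  shows "((\<lambda>s. LINT x|M. \<psi> x * \<eta> (\<phi> s x)) \<longlongrightarrow> (LINT x|M. \<psi> x) * (LINT x|M. \<eta> x)) at_top"
proof -
  define c where "c = (LINT x|M. \<eta> x)"
  have \<eta>c: "continuous_on UNIV (\<lambda>x. \<eta> x - c)" using \<eta> by (intro continuous_intros)
  have "(LINT x|M. \<eta> x - c) = 0"
    using continuous_integrable[OF \<eta>] by (simp add: c_def prob_space)
  note lim = mixing_continuous_mean_zero[OF \<psi> \<eta>c this]
  have "(LINT x|M. \<psi> x * (\<eta> (\<phi> s x) - c)) = (LINT x|M. \<psi> x * \<eta> (\<phi> s x)) - (LINT x|M. \<psi> x) * c" for s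
  proof -
    have "integrable M (\<lambda>x. \<psi> x * \<eta> (\<phi> s x))" "integrable M \<psi>"
      by (intro continuous_integrable continuous_on_mult \<psi> comp_flow_continuous(2)[OF \<eta>])+
    then show ?thesis by (simp add: right_diff_distrib)
  qed
  then show ?thesis using lim unfolding c_def[symmetric] by (simp add: LIM_zero_iff)
qed

section \<open>From real continuous to complex square integrable functions\<close>

lemma mixing_continuous_complex:
  fixes \<psi> \<eta> :: "'m \<Rightarrow> complex"
  assumes \<psi>: "continuous_on UNIV \<psi>" and \<eta>: "continuous_on UNIV \<eta>"
  shows "((\<lambda>s. LINT x|M. cnj (\<psi> x) * \<eta> (\<phi> s x)) \<longlongrightarrow> cnj (LINT x|M. \<psi> x) * (LINT x|M. \<eta> x)) at_top"
proof -
  define pr qr where "pr x = Re (\<psi> x)" and "qr x = Re (\<eta> x)" for x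
  define pi' qi where "pi' x = Im (\<psi> x)" and "qi x = Im (\<eta> x)" for x
  have c: "continuous_on UNIV pr" "continuous_on UNIV pi'" "continuous_on UNIV qr" "continuous_on UNIV qi"
    unfolding pr_def pi'_def qr_def qi_def using \<psi> \<eta> by (auto intro!: continuous_intros)
  have split: "(LINT x|M. h x) = of_real (LINT x|M. Re (h x)) + \<i> * of_real (LINT x|M. Im (h x))"
    if "continuous_on UNIV h" for h :: "'m \<Rightarrow> complex"
    using continuous_integrable[OF that] by (intro complex_eqI) (auto simp: )
  have i: "integrable M (\<lambda>x. p x * q (\<phi> s x))"
    if "continuous_on UNIV p" "continuous_on UNIV q" for p q :: "'m \<Rightarrow> real" and s
    by (intro continuous_integrable continuous_on_mult that comp_flow_continuous(2))
  have eq: "(LINT x|M. cnj (\<psi> x) * \<eta> (\<phi> s x))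
      = of_real ((LINT x|M. pr x * qr (\<phi> s x)) + (LINT x|M. pi' x * qi (\<phi> s x)))
      + \<i> * of_real ((LINT x|M. pr x * qi (\<phi> s x)) - (LINT x|M. pi' x * qr (\<phi> s x)))" for s
  proof -
    have "continuous_on UNIV (\<lambda>x. cnj (\<psi> x) * \<eta> (\<phi> s x))"
      using continuous_on_compose2[OF \<eta> flow_continuous] \<psi> by (intro continuous_intros) auto
    from split[OF this] show ?thesis
      using i[OF c(1,3), of s] i[OF c(2,4), of s] i[OF c(1,4), of s] i[OF c(2,3), of s]
      by (simp add: pr_def pi'_def qr_def qi_def)
  qed
  have lim: "cnj (LINT x|M. \<psi> x) * (LINT x|M. \<eta> x)
      = of_real ((LINT x|M. pr x) * (LINT x|M. qr x) + (LINT x|M. pi' x) * (LINT x|M. qi x))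
      + \<i> * of_real ((LINT x|M. pr x) * (LINT x|M. qi x) - (LINT x|M. pi' x) * (LINT x|M. qr x))"
    unfolding split[OF \<psi>] split[OF \<eta>] pr_def pi'_def qr_def qi_def
    by (simp add: complex_eq_iff algebra_simps)
  show ?thesis
    unfolding eq lim by (intro tendsto_intros mixing_continuous c)
qed

text \<open>The Koopman operators are isometric, so replacing \<psi> and \<eta> by continuous
  functions costs an error that is uniform in s, and the limit carries over.\<close>

lemma mixing_L2:
  assumes \<psi>: "\<psi> \<in> L2 M" and \<eta>: "\<eta> \<in> L2 M"
  shows "((\<lambda>s. L2_inner M \<psi> (koopman \<phi> s \<eta>)) \<longlongrightarrow> cnj (LINT x|M. \<psi> x) * (LINT x|M. \<eta> x)) at_top"
proof (rule tendstoI)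
  fix \<epsilon> :: real assume \<epsilon>: "\<epsilon> > 0"
  define p q where "p = (LINT x|M. \<psi> x)" and "q = (LINT x|M. \<eta> x)"
  define c where "c = 4 + (LINT x|M. (cmod (\<eta> x))\<^sup>2) + 2 * (LINT x|M. (cmod (\<psi> x))\<^sup>2)"
  \<comment> \<open>c / 2 comes from the perturbed pairing, the bracket from the perturbed product
    of means; e makes both together cost at most \<epsilon> / 2.\<close>
  define c' where "c' = c / 2 + (cmod p + cmod q + 1)"
  have "c \<ge> 0" unfolding c_def by (intro add_nonneg_nonneg mult_nonneg_nonneg) auto
  then have c': "c' > 0" unfolding c'_def by (intro add_nonneg_pos) auto
  define e where "e = min 1 (\<epsilon> / (2 * c'))"
  have e: "0 < e" "e \<le> 1" unfolding e_def using \<epsilon> c' by auto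
  have "e * c' \<le> \<epsilon> / (2 * c') * c'" unfolding e_def using c' by (intro mult_right_mono) auto
  then have ec': "e * c' \<le> \<epsilon> / 2" using c' by simp
  have e2: "e\<^sup>2 > 0" using e by simp
  obtain a where a: "continuous_on UNIV a" "integrable M (\<lambda>x. (cmod (\<psi> x - a x))\<^sup>2)"
    "(LINT x|M. (cmod (\<psi> x - a x))\<^sup>2) < e\<^sup>2"
    by (rule L2_continuous_approx[OF \<psi> e2]) (rule that)
  obtain b where b: "continuous_on UNIV b" "integrable M (\<lambda>x. (cmod (\<eta> x - b x))\<^sup>2)"
    "(LINT x|M. (cmod (\<eta> x - b x))\<^sup>2) < e\<^sup>2"
    by (rule L2_continuous_approx[OF \<eta> e2]) (rule that)
  note aL = continuous_L2[OF a(1)] and bL = continuous_L2[OF b(1)]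
  have meas: "\<psi> \<in> borel_measurable M" "\<eta> \<in> borel_measurable M" "a \<in> borel_measurable M" "b \<in> borel_measurable M"
    using \<psi> \<eta> aL bL unfolding L2_def by auto
  \<comment> \<open>Pairing with the constant 1: on a probability space the mean is dominated by the
    L2 norm.\<close>
  have mean: "cmod (LINT x|M. h x) \<le> e"
    if "h \<in> borel_measurable M" "integrable M (\<lambda>x. (cmod (h x))\<^sup>2)" "(LINT x|M. (cmod (h x))\<^sup>2) < e\<^sup>2"
    for h :: "'m \<Rightarrow> complex"
  proof -
    have "2 * cmod (LINT x|M. cnj 1 * h x) \<le> (LINT x|M. (cmod 1)\<^sup>2) / (1 / e) + (1 / e) * (LINT x|M. (cmod (h x))\<^sup>2)"
      by (rule integral_L2_mult_bound) (use that e in auto)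
    also have "(1 / e) * (LINT x|M. (cmod (h x))\<^sup>2) \<le> e"
      using that(3) e by (simp add: pos_divide_le_eq power2_eq_square)
    finally show ?thesis by (simp add: prob_space)
  qed
  have pa: "cmod (p - (LINT x|M. a x)) \<le> e"
    using mean[of "\<lambda>x. \<psi> x - a x"] a meas L2_integrable[OF \<psi>] L2_integrable[OF aL] by (simp add: p_def)
  have qb: "cmod (q - (LINT x|M. b x)) \<le> e"
    using mean[of "\<lambda>x. \<eta> x - b x"] b meas L2_integrable[OF \<eta>] L2_integrable[OF bL] by (simp add: q_def)
  have lim_close: "cmod (cnj (LINT x|M. a x) * (LINT x|M. b x) - cnj p * q) \<le> e * (cmod p + cmod q + 1)"
  proof -
    let ?p = "LINT x|M. a x" and ?q = "LINT x|M. b x"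
    have "cmod ?p \<le> cmod p + 1"
      using norm_triangle_ineq4[of p "p - ?p"] pa e by simp
    have "cnj ?p * ?q - cnj p * q = - (cnj (p - ?p) * q + cnj ?p * (q - ?q))"
      by (simp add: algebra_simps)
    also have "cmod \<dots> \<le> cmod (cnj (p - ?p) * q) + cmod (cnj ?p * (q - ?q))"
      unfolding norm_minus_cancel by (rule norm_triangle_ineq)
    also have "\<dots> = cmod (p - ?p) * cmod q + cmod ?p * cmod (q - ?q)"
      by (simp only: norm_mult complex_mod_cnj)
    also have "\<dots> \<le> e * cmod q + (cmod p + 1) * e"
      using pa qb \<open>cmod ?p \<le> cmod p + 1\<close> e by (intro add_mono mult_mono) auto
    finally show ?thesis by (simp add: algebra_simps)
  qed
  have close: "2 * cmod (L2_inner M \<psi> (koopman \<phi> s \<eta>) - (LINT x|M. cnj (a x) * b (\<phi> s x))) \<le> e * c" for s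
  proof -
    note \<eta>s = L2_comp_flow[of \<eta> s] and bs = L2_comp_flow[of b s]
    note ds = L2_comp_flow[of "\<lambda>x. \<eta> x - b x" s]
    have 1: "(\<lambda>x. \<eta> (\<phi> s x)) \<in> L2 M" "(\<lambda>x. b (\<phi> s x)) \<in> L2 M"
      using \<eta>s bs \<eta> bL unfolding L2_def by auto
    have dm: "(\<lambda>x. \<eta> x - b x) \<in> borel_measurable M" using meas by measurable
    have "2 * cmod ((LINT x|M. cnj (\<psi> x) * \<eta> (\<phi> s x)) - (LINT x|M. cnj (a x) * b (\<phi> s x)))
      \<le> e * (4 + (LINT x|M. (cmod (\<eta> (\<phi> s x)))\<^sup>2) + 2 * (LINT x|M. (cmod (\<psi> x))\<^sup>2))"
      by (rule correlation_perturbation[OF \<psi> 1(1) aL 1(2) e]) (use a b ds[OF dm b(2)] in auto)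
    then show ?thesis
      using \<eta>s \<eta> unfolding L2_inner_def koopman_def c_def L2_def by simp
  qed
  have "\<forall>\<^sub>F s in at_top. dist (LINT x|M. cnj (a x) * b (\<phi> s x)) (cnj (LINT x|M. a x) * (LINT x|M. b x)) < \<epsilon> / 2"
    using mixing_continuous_complex[OF a(1) b(1)] \<epsilon> by (intro tendstoD) auto
  then show "\<forall>\<^sub>F s in at_top. dist (L2_inner M \<psi> (koopman \<phi> s \<eta>)) (cnj (LINT x|M. \<psi> x) * (LINT x|M. \<eta> x)) < \<epsilon>"
  proof eventually_elim
    case (elim s)
    have tri: "dist w z \<le> dist w w' + dist w' z' + dist z' z" for w z w' z' :: complex
      using dist_triangle[of w z w'] dist_triangle[of w' z z'] by linarith
    have "dist (L2_inner M \<psi> (koopman \<phi> s \<eta>)) (LINT x|M. cnj (a x) * b (\<phi> s x)) \<le> e * (c / 2)"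
      using close[of s] by (simp add: dist_norm)
    moreover have "dist (cnj (LINT x|M. a x) * (LINT x|M. b x)) (cnj p * q) \<le> e * (cmod p + cmod q + 1)"
      using lim_close by (simp add: dist_norm)
    moreover have "e * (c / 2) + e * (cmod p + cmod q + 1) \<le> \<epsilon> / 2"
      using ec' unfolding c'_def by (simp add: distrib_left)
    ultimately show ?case
      using elim tri[of "L2_inner M \<psi> (koopman \<phi> s \<eta>)" "cnj p * q" "LINT x|M. cnj (a x) * b (\<phi> s x)"
          "cnj (LINT x|M. a x) * (LINT x|M. b x)"]
      unfolding p_def[symmetric] q_def[symmetric] by simp
  qed
qed

lemma mixing_kernel_complement:
  assumes \<psi>: "\<psi> \<in> L2 M"
    and \<eta>: "\<eta> \<in> L2_orthogonal_complement M (operator_kernel (generator_graph M (koopman \<phi>)))"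
  shows "((\<lambda>s. L2_inner M \<psi> (koopman \<phi> s \<eta>)) \<longlongrightarrow> 0) at_top"
proof -
  have "(\<lambda>_. 1) \<in> operator_kernel (generator_graph M (koopman \<phi>))"
    unfolding operator_kernel_def generator_graph_def
    by (simp add: L2_def koopman_def L2_norm_def)
  then have "L2_inner M (\<lambda>_. 1) \<eta> = 0" and "\<eta> \<in> L2 M"
    using \<eta> unfolding L2_orthogonal_complement_def by auto
  then show ?thesis
    using mixing_L2[OF \<psi>, of \<eta>] by (simp add: L2_inner_def)
qed

lemma strongly_mixing_flow: "strongly_mixing M \<phi>"
  unfolding strongly_mixing_def
proof (intro ballI)
  fix B C assume B: "B \<in> sets M" and C: "C \<in> sets M"
  have L2: "(\<lambda>x. of_real (indicator D x)) \<in> L2 M" if "D \<in> sets M" for D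
  proof -
    have "(\<lambda>x. (cmod (of_real (indicator D x)))\<^sup>2) = indicator D"
      by (auto simp: indicator_def fun_eq_iff)
    then show ?thesis
      unfolding L2_def using that by (auto simp: integrable_real_indicator less_top[symmetric])
  qed
  have int: "(LINT x|M. complex_of_real (indicator D x)) = of_real (measure M D)" if "D \<in> sets M" for D
    using that by (simp add: space_M)
  have "L2_inner M (\<lambda>x. of_real (indicator B x)) (koopman \<phi> s (\<lambda>x. of_real (indicator C x)))
      = of_real (measure M (B \<inter> (\<phi> s -` C \<inter> space M)))" for s
  proof -
    have "\<phi> s -` C \<inter> space M \<in> sets M"
      using measurable_sets[OF flow_measurable, of C s] C sets_M by simp
    then have BC: "B \<inter> (\<phi> s -` C \<inter> space M) \<in> sets M" using B by blast
    have "L2_inner M (\<lambda>x. of_real (indicator B x)) (koopman \<phi> s (\<lambda>x. of_real (indicator C x)))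
        = (LINT x|M. complex_of_real (indicator (B \<inter> (\<phi> s -` C \<inter> space M)) x))"
      unfolding L2_inner_def koopman_def
      by (intro Bochner_Integration.integral_cong) (auto simp: indicator_def space_M)
    then show ?thesis using int[OF BC] by simp
  qed
  then have "((\<lambda>s. complex_of_real (measure M (B \<inter> (\<phi> s -` C \<inter> space M))))
      \<longlongrightarrow> of_real (measure M B * measure M C)) at_top"
    using mixing_L2[OF L2[OF B] L2[OF C]] int[OF B] int[OF C] by simp
  then show "((\<lambda>s. measure M (B \<inter> (\<phi> s -` C \<inter> space M))) \<longlongrightarrow> measure M B * measure M C) at_top"
    unfolding tendsto_of_real_iff .
qed

end


section \<open>Minimal flows along an expanded direction\<close>

text \<open>A periodic orbit is the image of the compact interval [0, p], hence closed; being dense,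
  it is the whole space.\<close>

lemma minimal_flow_periodic_point:
  fixes \<phi> :: "real \<Rightarrow> 'm::t2_space \<Rightarrow> 'm"
  assumes \<phi>: "continuous_flow \<phi>" "minimal_flow \<phi>" and p: "\<phi> p x = x" "p > 0"
  shows "orbit \<phi> x = UNIV"
proof -
  have \<phi>0: "\<phi> 0 y = y" and add: "\<phi> (s + t) y = \<phi> s (\<phi> t y)" for s t y
    using \<phi>(1) unfolding continuous_flow_def by auto
  have cont: "continuous_on UNIV (\<lambda>t. \<phi> t x)"
    using continuous_on_curry(1) \<phi>(1) unfolding continuous_flow_def by blast
  have nat: "\<phi> (real n * p) x = x" for n
    by (induction n) (simp_all add: \<phi>0 add distrib_right p(1))
  have int: "\<phi> (of_int k * p) x = x" for k
  proof (cases "k \<ge> 0")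
    case True
    then show ?thesis using nat[of "nat k"] by simp
  next
    case False
    then have n: "\<phi> (- (of_int k * p)) x = x" using nat[of "nat (- k)"] by simp
    show ?thesis using add[of "of_int k * p" "- (of_int k * p)" x] by (simp add: n \<phi>0)
  qed
  have "orbit \<phi> x \<subseteq> (\<lambda>t. \<phi> t x) ` {0..p}"
  proof
    fix y assume "y \<in> orbit \<phi> x"
    then obtain t where t: "y = \<phi> t x" unfolding orbit_def by blast
    define k where "k = \<lfloor>t / p\<rfloor>"
    have "y = \<phi> (t - of_int k * p) x"
      using add[of "t - of_int k * p" "of_int k * p" x] int t by simp
    moreover have "of_int k * p \<le> t"
      unfolding k_def by (rule pos_le_divide_eq[OF p(2), THEN iffD1, OF of_int_floor_le])
    moreover have "t \<le> (of_int k + 1) * p"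
      unfolding k_def
      by (rule less_imp_le[OF pos_divide_less_eq[OF p(2), THEN iffD1, OF real_of_int_floor_add_one_gt]])
    ultimately show "y \<in> (\<lambda>t. \<phi> t x) ` {0..p}"
      by (intro image_eqI[of _ _ "t - of_int k * p"]) (auto simp: algebra_simps)
  qed
  moreover have "(\<lambda>t. \<phi> t x) ` {0..p} \<subseteq> orbit \<phi> x" unfolding orbit_def by blast
  ultimately have "orbit \<phi> x = (\<lambda>t. \<phi> t x) ` {0..p}" by blast
  then have "compact (orbit \<phi> x)"
    using compact_continuous_image[OF continuous_on_subset[OF cont subset_UNIV] compact_Icc] by simp
  then show ?thesis
    using \<phi>(2) compact_imp_closed closure_closed unfolding minimal_flow_def by metis
qed

text \<open>On a periodic orbit, \<open>f\<close> would rescale the period of \<open>\<phi>'\<close> to an arbitrary positive number.\<close>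

lemma minimal_expanded_flow_free:
  fixes \<phi> \<phi>' f :: "real \<Rightarrow> 'm::t2_space \<Rightarrow> 'm"
  assumes \<phi>: "continuous_flow \<phi>" "minimal_flow \<phi>" and \<phi>': "continuous_flow \<phi>'"
    and \<tau>: "reparametrisation_cocycle \<phi> \<phi>' \<tau>"
    and f: "continuous_flow f" "\<not> (\<exists>x. \<forall>t. f t x = x)"
    and lam: "lam > 1" "\<And>s t x. f t (\<phi>' s x) = \<phi>' (lam powr t * s) (f t x)"
    and p: "\<phi> p x = x"
  shows "p = 0"
proof (rule ccontr)
  assume "p \<noteq> 0"
  have \<phi>0: "\<phi> 0 y = y" and add: "\<phi> (s + t) y = \<phi> s (\<phi> t y)" for s t y
    using \<phi>(1) unfolding continuous_flow_def by auto
  have add': "\<phi>' (s + t) y = \<phi>' s (\<phi>' t y)" for s t y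
    using \<phi>' unfolding continuous_flow_def by auto
  have f0: "f t (f (- t) y) = y" for t y
  proof -
    have "f (t + - t) y = f t (f (- t) y)" "f 0 y = y"
      using f(1) unfolding continuous_flow_def by blast+
    then show ?thesis by simp
  qed
  have \<tau>1: "\<phi> s y = \<phi>' (\<tau> y s) y" "\<tau> y 0 = 0" "strict_mono (\<tau> y)" for s y
    using \<tau> unfolding reparametrisation_cocycle_def by auto
  define P where "P = \<bar>p\<bar>"
  have P: "P > 0" "\<phi> P x = x"
  proof -
    show "P > 0" using \<open>p \<noteq> 0\<close> by (simp add: P_def)
    have "\<phi> (- p) x = x" using add[of "- p" p x] p by (simp add: \<phi>0)
    then show "\<phi> P x = x" using p by (simp add: P_def abs_if)
  qed
  have orb: "orbit \<phi> x = UNIV" by (rule minimal_flow_periodic_point[OF \<phi> P(2,1)])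
  define q where "q = \<tau> x P"
  have q0: "q > 0" using strict_monoD[OF \<tau>1(3) P(1), of x] \<tau>1(2) by (simp add: q_def)
  have "\<phi>' q x = x" using \<tau>1(1)[of P x] P(2) by (simp add: q_def)
  \<comment> \<open>The period is needed at every point, because the expansion relation moves the
    base point along f.\<close>
  have q: "\<phi>' q y = y" for y
  proof -
    obtain t where "y = \<phi> t x" using orb unfolding orbit_def by blast
    then have y: "y = \<phi>' (\<tau> x t) x" using \<tau>1(1) by simp
    then have "\<phi>' q y = \<phi>' (\<tau> x t) (\<phi>' q x)"
      using add'[of q "\<tau> x t" x] add'[of "\<tau> x t" q x] by (simp add: add.commute)
    then show ?thesis using \<open>\<phi>' q x = x\<close> y by simp
  qed
  have triv': "\<phi>' s y = y" if "s > 0" for s y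
  proof -
    define t where "t = log lam (s / q)"
    have "lam powr t * q = s" using lam(1) q0 that by (simp add: t_def)
    then have "\<phi>' s (f t (f (- t) y)) = f t (\<phi>' q (f (- t) y))" using lam(2)[of t q "f (- t) y"] by simp
    then show ?thesis by (simp add: q f0)
  qed
  have triv: "\<phi> s x = x" if "s > 0" for s
    using triv'[of "\<tau> x s" x] strict_monoD[OF \<tau>1(3) that, of x] \<tau>1(1)[of s x] \<tau>1(2)[of x] by simp
  have "\<phi> s x = x" for s
  proof -
    consider "s > 0" | "s = 0" | "s < 0" by linarith
    then show ?thesis
    proof cases
      case 3
      then have "\<phi> (- s) x = x" using triv by simp
      then show ?thesis using add[of s "- s" x] by (simp add: \<phi>0)
    qed (use triv \<phi>0 in auto)
  qed
  \<comment> \<open>The whole space is one orbit, and this orbit is a point, which f would have to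
    fix.\<close>
  then have "UNIV = {x}" using orb unfolding orbit_def by auto
  then have "\<forall>t. f t x = x" by auto
  then show False using f(2) by blast
qed

text \<open>In a chart the derivative in s is the Frechet derivative in direction (0, 1), which
  depends continuously on the point; the local statements are glued over the open chart
  domains.\<close>

lemma C1_reparametrisation_velocity:
  fixes A :: "('m::t2_space, 'e::euclidean_space) chart set"
  assumes A: "smooth_atlas A"
    and \<tau>: "\<forall>c\<in>A. Ck_on 1 (\<lambda>(z, s). \<tau> (chart_inv c z) s) ((snd c ` fst c) \<times> (UNIV :: real set))"
  shows "(\<tau> x has_real_derivative deriv (\<tau> x) 0) (at 0)" "continuous_on UNIV (\<lambda>x. deriv (\<tau> x) 0)"
proof -
  define G where "G c = (\<lambda>(z, s). \<tau> (chart_inv c z) s)" for c :: "('m, 'e) chart"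
  define D where "D c p = frechet_derivative (G c) (at p) (0, 1)" for c :: "('m, 'e) chart" and p
  have chart: "open (fst c)" "homeomorphism (fst c) (snd c ` fst c) (snd c) (chart_inv c)" if "c \<in> A" for c
    using A that unfolding smooth_atlas_def by auto
  have cover: "\<exists>c\<in>A. x \<in> fst c" for x
    using A unfolding smooth_atlas_def by auto
  have der: "(\<tau> x has_real_derivative D c (snd c x, 0)) (at 0)" if c: "c \<in> A" "x \<in> fst c" for c x
  proof -
    have inv: "chart_inv c (snd c x) = x" using chart(2)[OF c(1)] c(2) by (simp add: homeomorphism_def)
    have "G c differentiable (at (snd c x, 0))"
      using \<tau> c unfolding G_def by auto
    then have "(G c has_derivative frechet_derivative (G c) (at (snd c x, 0))) (at (snd c x, 0))"
      by (simp add: frechet_derivative_works)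
    moreover have "((\<lambda>s::real. (snd c x, s)) has_derivative (\<lambda>h. (0, h))) (at 0)"
      by (auto intro!: derivative_eq_intros)
    ultimately have d: "((\<lambda>s. G c (snd c x, s)) has_derivative
        (\<lambda>h. frechet_derivative (G c) (at (snd c x, 0)) (0, h))) (at 0)"
      using has_derivative_compose[of "\<lambda>s. (snd c x, s)" "\<lambda>h. (0, h)" 0 UNIV "G c"] by simp
    have lin: "linear (frechet_derivative (G c) (at (snd c x, 0)))"
      using \<open>G c differentiable (at (snd c x, 0))\<close> by (rule linear_frechet_derivative)
    have "frechet_derivative (G c) (at (snd c x, 0)) (0, h) = D c (snd c x, 0) * h" for h
      using linear_scale[OF lin, of h "(0, 1)"] by (simp add: D_def mult.commute)
    then have "((\<lambda>s. G c (snd c x, s)) has_derivative (\<lambda>h. D c (snd c x, 0) * h)) (at 0)"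
      using d by simp
    then show ?thesis by (simp add: has_field_derivative_def G_def inv)
  qed
  then have eq: "deriv (\<tau> x) 0 = D c (snd c x, 0)" if "c \<in> A" "x \<in> fst c" for c x
    using that DERIV_imp_deriv by blast
  then show "(\<tau> x has_real_derivative deriv (\<tau> x) 0) (at 0)"
    using cover[of x] der by fastforce
  have "continuous_on (\<Union>c\<in>A. fst c) (\<lambda>x. deriv (\<tau> x) 0)"
  proof (rule continuous_on_open_UN)
    fix c assume c: "c \<in> A"
    then show "open (fst c)" by (rule chart)
    have "continuous_on ((snd c ` fst c) \<times> UNIV) (D c)"
      using \<tau> c unfolding D_def[abs_def] G_def by auto
    moreover have "continuous_on (fst c) (\<lambda>x. (snd c x, 0::real))"
      using chart(2)[OF c] by (intro continuous_intros) (simp add: homeomorphism_def)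
    ultimately have "continuous_on (fst c) (\<lambda>x. D c (snd c x, 0))"
      by (rule continuous_on_compose2) auto
    then show "continuous_on (fst c) (\<lambda>x. deriv (\<tau> x) 0)"
      using eq[OF c] by (simp cong: continuous_on_cong)
  qed
  moreover have "(\<Union>c\<in>A. fst c) = UNIV" using cover by blast
  ultimately show "continuous_on UNIV (\<lambda>x. deriv (\<tau> x) 0)" by simp
qed

text \<open>Compactness bounds \<theta> away from 0, so \<open>\<tau> y\<close> grows at least
  linearly and attains every positive number; a period of \<open>\<phi>'\<close> would thus come
  from a period of \<phi>. The lemma serves to equate times of \<open>\<phi>'\<close> by comparing
  points.\<close>

lemma reparametrised_flow_free:
  fixes \<phi> \<phi>' :: "real \<Rightarrow> 'm::metric_space \<Rightarrow> 'm"
  assumes cpt: "compact (UNIV :: 'm set)" and \<phi>': "continuous_flow \<phi>'"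
    and \<tau>: "reparametrisation_cocycle \<phi> \<phi>' \<tau>"
    and der: "\<And>x. (\<tau> x has_real_derivative \<theta> x) (at 0)"
    and \<theta>: "continuous_on UNIV \<theta>" "\<And>x. \<theta> x > 0"
    and free: "\<And>s x. \<phi> s x = x \<Longrightarrow> s = 0"
    and eq: "\<phi>' a x = \<phi>' b x"
  shows "a = b"
proof -
  have \<phi>'0: "\<phi>' 0 y = y" and add': "\<phi>' (s + t) y = \<phi>' s (\<phi>' t y)" for s t y
    using \<phi>' unfolding continuous_flow_def by auto
  have \<tau>1: "\<phi> s y = \<phi>' (\<tau> y s) y" "\<tau> y 0 = 0" "\<tau> y (s + t) = \<tau> y s + \<tau> (\<phi> s y) t" for s t y
    using \<tau> unfolding reparametrisation_cocycle_def by auto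
  have ders: "(\<tau> y has_real_derivative \<theta> (\<phi> s y)) (at s)" for y s
  proof -
    have "((\<lambda>t. \<tau> y s + \<tau> (\<phi> s y) t) has_real_derivative 0 + \<theta> (\<phi> s y)) (at 0)"
      by (intro DERIV_add DERIV_const der)
    then have "((\<lambda>t. \<tau> y (t + s)) has_real_derivative \<theta> (\<phi> s y)) (at 0)"
      by (simp add: \<tau>1(3)[symmetric] add.commute)
    then show ?thesis using DERIV_shift[of "\<tau> y" "\<theta> (\<phi> s y)" 0 s] by simp
  qed
  obtain x0 where x0: "\<And>x. \<theta> x0 \<le> \<theta> x"
    using continuous_attains_inf[OF cpt _ \<theta>(1)] by auto
  have pos: "False" if r: "r > 0" "\<phi>' r y = y" for r y
  proof -
    \<comment> \<open>With slope at least \<open>\<theta> x0\<close>, the value r is reached by this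
      time.\<close>
    define S where "S = r / \<theta> x0"
    have S: "S > 0" using r \<theta>(2) by (simp add: S_def)
    have "\<tau> y 0 - \<theta> x0 * 0 \<le> \<tau> y S - \<theta> x0 * S"
    proof (rule DERIV_nonneg_imp_nondecreasing[where f = "\<lambda>s. \<tau> y s - \<theta> x0 * s"])
      show "\<exists>D. ((\<lambda>s. \<tau> y s - \<theta> x0 * s) has_real_derivative D) (at s) \<and> 0 \<le> D" for s
        using x0 by (intro exI[of _ "\<theta> (\<phi> s y) - \<theta> x0"]) (auto intro!: derivative_eq_intros ders)
    qed (use S in simp)
    then have "r \<le> \<tau> y S" using \<theta>(2)[of x0] by (simp add: \<tau>1(2) S_def)
    then obtain s where s: "0 \<le> s" "\<tau> y s = r"
      using IVT[of "\<tau> y" 0 r S] S r ders by (auto simp: \<tau>1(2) intro: DERIV_isCont)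
    then have "\<phi> s y = y" using \<tau>1(1)[of s y] r by simp
    then have "s = 0" by (rule free)
    then show False using s r \<tau>1(2) by simp
  qed
  have fixp: "\<phi>' (c - d) y = y" if "\<phi>' c y = \<phi>' d y" for c d y
    using add'[of "- d" c y] add'[of "- d" d y] that by (simp add: \<phi>'0)
  show ?thesis
    using pos[OF _ fixp[OF eq]] pos[OF _ fixp[OF eq[symmetric]]] by (cases a b rule: linorder_cases) auto
qed

theorem theorem2p6:
  fixes A :: "('m::metric_space, 'e::euclidean_space) chart set"
    and g :: "('m, 'e) chart \<Rightarrow> 'm \<Rightarrow> 'e \<Rightarrow> 'e \<Rightarrow> real"
    and f \<phi> \<phi>' :: "real \<Rightarrow> 'm \<Rightarrow> 'm"
    and \<mu> :: "'m measure"
    and sst u :: "real \<Rightarrow> real \<Rightarrow> 'm \<Rightarrow> real"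
    and \<epsilon> :: real
  assumes "compact_connected_riemannian_manifold A g"
    and "\<epsilon> > 0"
    and "codimension_one_anosov_flow A \<epsilon> f"
    and "minimal_Wu_flow f \<phi>"
    and "unique_invariant_probability \<phi> \<mu>"
    and "uniformly_expanding_parametrisation f \<phi> \<phi>'"
    and "\<forall>s t x. f t (\<phi> s x) = \<phi> (sst t s x) (f t x)"
    and "C1_flow A \<phi>"
    and "C1_reparametrisation A \<phi> \<phi>'"
    and "is_mixed_derivative sst u"
    and "continuous_on UNIV (\<lambda>(t, s, x). u t s x)"
  shows "(\<forall>\<psi>\<in>L2 \<mu>.
            \<forall>\<eta>\<in>L2_orthogonal_complement \<mu> (operator_kernel (generator_graph \<mu> (koopman \<phi>))).
              ((\<lambda>s. L2_inner \<mu> \<psi> (koopman \<phi> s \<eta>)) \<longlongrightarrow> 0) at_top)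
         \<and> strongly_mixing \<mu> \<phi>"
proof -
  have cpt: "compact (UNIV :: 'm set)" and atlas: "smooth_atlas A"
    using assms(1) unfolding compact_connected_riemannian_manifold_def by auto
  have f: "continuous_flow f" "\<not> (\<exists>x. \<forall>t. f t x = x)"
    using assms(3) unfolding codimension_one_anosov_flow_def anosov_flow_def flow_of_class_def by auto
  have \<phi>: "continuous_flow \<phi>" "minimal_flow \<phi>"
    using assms(4) unfolding minimal_Wu_flow_def by auto
  have \<phi>': "continuous_flow \<phi>'"
    using assms(6) unfolding uniformly_expanding_parametrisation_def by auto
  obtain lam where lam: "lam > 1" "\<And>s t x. f t (\<phi>' s x) = \<phi>' (lam powr t * s) (f t x)"
    using assms(6) unfolding uniformly_expanding_parametrisation_def by auto
  obtain \<tau> where \<tau>: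
      "\<forall>c\<in>A. Ck_on 1 (\<lambda>(z, s). \<tau> (chart_inv c z) s) ((snd c ` fst c) \<times> (UNIV :: real set))"
      "reparametrisation_cocycle \<phi> \<phi>' \<tau>" "\<And>x. deriv (\<tau> x) 0 > 0"
    using assms(9) unfolding C1_reparametrisation_def by blast
  have \<tau>1: "\<phi> s y = \<phi>' (\<tau> y s) y" for s y
    using \<tau>(2) unfolding reparametrisation_cocycle_def by auto
  obtain v where v: "\<And>t s x. ((\<lambda>r. sst t r x) has_real_derivative v t s x) (at s)"
      "\<And>t s x. ((\<lambda>r. v r s x) has_real_derivative u t s x) (at t)"
    using assms(10) unfolding is_mixed_derivative_def by blast
  define \<theta> where "\<theta> x = deriv (\<tau> x) 0" for x
  note vel = C1_reparametrisation_velocity[OF atlas \<tau>(1), folded \<theta>_def]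
  have \<theta>_pos: "\<theta> x > 0" for x using \<tau>(3) by (simp add: \<theta>_def)
  have free: "s = 0" if "\<phi> s x = x" for s x
    using minimal_expanded_flow_free[OF \<phi> \<phi>' \<tau>(2) f lam that] .
  have free': "a = b" if "\<phi>' a x = \<phi>' b x" for a b x
    using reparametrised_flow_free[OF cpt \<phi>' \<tau>(2) vel(1) vel(2) \<theta>_pos free that] .
  \<comment> \<open>This places the outer derivative of the chain rule below at time 0, where it is
    \<theta>.\<close>
  have sst0: "sst t 0 x = 0" for t x
  proof (rule free)
    show "\<phi> (sst t 0 x) (f t x) = f t x"
    proof -
      have "f t (\<phi> 0 x) = \<phi> (sst t 0 x) (f t x)" using assms(7) by blast
      moreover have "\<phi> 0 x = x" using \<phi>(1) unfolding continuous_flow_def by blast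
      ultimately show ?thesis by simp
    qed
  qed
  have expand: "lam powr t * \<theta> x = \<theta> (f t x) * v t 0 x" for t x
  proof -
    \<comment> \<open>Both sides are the \<open>\<phi>'\<close>-time from \<open>f t x\<close> to
      \<open>f t (\<phi> s x)\<close>, computed once by expansion and once through \<phi>;
      differentiation at s = 0 gives the relation for \<theta>.\<close>
    have "(\<lambda>s. lam powr t * \<tau> x s) = (\<lambda>s. \<tau> (f t x) (sst t s x))"
    proof (intro ext free')
      fix s
      have "\<phi>' (lam powr t * \<tau> x s) (f t x) = f t (\<phi>' (\<tau> x s) x)" by (rule lam(2)[symmetric])
      also have "\<dots> = f t (\<phi> s x)" by (simp only: \<tau>1[of s x])
      also have "\<dots> = \<phi> (sst t s x) (f t x)" using assms(7) by blast
      also have "\<dots> = \<phi>' (\<tau> (f t x) (sst t s x)) (f t x)" by (rule \<tau>1)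
      finally show "\<phi>' (lam powr t * \<tau> x s) (f t x) = \<phi>' (\<tau> (f t x) (sst t s x)) (f t x)" .
    qed
    moreover have "((\<lambda>s. lam powr t * \<tau> x s) has_real_derivative lam powr t * \<theta> x) (at 0)"
      by (intro DERIV_cmult vel(1))
    moreover have "((\<lambda>s. \<tau> (f t x) (sst t s x)) has_real_derivative \<theta> (f t x) * v t 0 x) (at 0)"
      by (rule DERIV_chain2[where f = "\<tau> (f t x)" and g = "\<lambda>s. sst t s x"])
        (use vel(1)[of "f t x"] v(1)[of t x 0] in \<open>simp_all add: sst0\<close>)
    ultimately show ?thesis by (simp add: DERIV_unique)
  qed
  interpret prob_space \<mu>
    using assms(5) unfolding unique_invariant_probability_def invariant_probability_def by blast
  interpret sheared_flow \<mu> \<phi> f sst v u \<theta> lam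
  proof unfold_locales
    show "sets \<mu> = sets borel"
      using assms(5) unfolding unique_invariant_probability_def invariant_probability_def by blast
  qed (use cpt \<phi> f assms(5,7,11) free v lam vel \<theta>_pos expand in auto)
  show ?thesis using mixing_kernel_complement strongly_mixing_flow by blast
qed

end
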